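(* Let $p\ge 3$, $q\ge 3$ and $r\ge 2$ be integers. The graph $d(p,q,r)$ is determined by its signless Laplacian permanental polynomial; that is, for every graph $H$, if $\pi(Q(H);x)=\pi(Q(d(p,q,r));x)$ then $H$ is isomorphic to $d(p,q,r)$.
   Context: All graphs are finite, simple and undirected (not necessarily connected). For a graph $G$ with vertices $v_1,\dots,v_n$, let $A(G)$ be its $(0,1)$-adjacency matrix, $D(G)=\mathrm{diag}(d(v_1),\dots,d(v_n))$ the diagonal matrix of vertex degrees, and $Q(G)=D(G)+A(G)$ the signless Laplacian matrix. The permanent of an $n\times n$ matrix $X=(x_{ij})$ is $\mathrm{per}(X)=\sum_{\sigma}\prod_{i=1}^n x_{i\sigma(i)}$, the sum being over all permutations $\sigma$ of $\{1,\dots,n\}$. The signless Laplacian permanental polynomial of $G$ is $\pi(Q(G);x)=\mathrm{per}(xI-Q(G))$, where $I$ is the $n\times n$ identity matrix. $C_n$ and $P_n$ denote the cycle and the path on $n$ vertices. The graph $d(p,q,r)$ is obtained from vertex-disjoint copies of the cycles $C_p$ ($p\ge 3$), $C_q$ ($q\ge 3$) and the path $P_r$ by identifying one end vertex of $P_r$ with a vertex of $C_p$ and the other (different) end vertex of $P_r$ with a vertex of $C_q$. *)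

theory Defs
  imports
    "Graph_Theory.Graph_Theory"
    "HOL-Computational_Algebra.Polynomial"
    "HOL-Combinatorics.Permutations"
begin

text \<open>
  A finite simple undirected graph is a \<^locale>\<open>pair_graph\<close>: a finite loop-free digraph without
  parallel arcs whose arc relation is symmetric, an edge $uv$ being the two arcs $(u,v)$ and
  $(v,u)$. Hence the degree of a vertex is its out-degree, and \<^const>\<open>digraph_iso\<close> is
  graph isomorphism.

  Matrices attached to a graph have rows and columns indexed by the vertices themselves. By
  \<open>permanent_enumerate\<close> below, the permanent is that of the $n \times n$ matrix obtained from any
  enumeration of the vertices.
\<close>

definition permanent :: "'a set \<Rightarrow> ('a \<Rightarrow> 'a \<Rightarrow> 'r) \<Rightarrow> 'r :: comm_ring_1" where
  "permanent V M = (\<Sum>\<sigma> | \<sigma> permutes V. \<Prod>v\<in>V. M v (\<sigma> v))"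

lemma permanent_enumerate:
  assumes f: "bij_betw f {1..n} V"
  shows "permanent V M = permanent {1..n::nat} (\<lambda>i j. M (f i) (f j))"
proof -
  let ?g = "\<lambda>\<pi> x. if x \<in> V then f (\<pi> (inv_into {1..n} f x)) else x"
  have bij: "bij_betw ?g {\<pi>. \<pi> permutes {1..n}} {\<pi>. \<pi> permutes V}"
    by (rule bij_betw_permutations[OF f])
  have eq: "(\<Prod>v\<in>V. M v (?g \<pi> v)) = (\<Prod>i=1..n. M (f i) (f (\<pi> i)))" for \<pi>
  proof -
    have "(\<Prod>v\<in>V. M v (?g \<pi> v)) = (\<Prod>i=1..n. M (f i) (?g \<pi> (f i)))"
      by (rule prod.reindex_bij_betw[OF f, symmetric])
    also have "\<dots> = (\<Prod>i=1..n. M (f i) (f (\<pi> i)))"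
      using f by (intro prod.cong) (auto simp: bij_betw_def inv_into_f_f)
    finally show ?thesis .
  qed
  show ?thesis
    unfolding permanent_def sum.reindex_bij_betw[OF bij, symmetric] eq ..
qed

definition adjacency_matrix :: "'a pair_pre_digraph \<Rightarrow> 'a \<Rightarrow> 'a \<Rightarrow> int" where
  "adjacency_matrix G u v = (if (u, v) \<in> parcs G then 1 else 0)"

definition degree_matrix :: "'a pair_pre_digraph \<Rightarrow> 'a \<Rightarrow> 'a \<Rightarrow> int" where
  "degree_matrix G u v = (if u = v then int (out_degree (with_proj G) u) else 0)"

definition signless_laplacian :: "'a pair_pre_digraph \<Rightarrow> 'a \<Rightarrow> 'a \<Rightarrow> int" where
  "signless_laplacian G u v = degree_matrix G u v + adjacency_matrix G u v"

text \<open>The monomial \<open>[:0, 1:]\<close> is the indeterminate $x$.\<close>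

definition signless_laplacian_permanental_poly :: "'a pair_pre_digraph \<Rightarrow> int poly" where
  "signless_laplacian_permanental_poly G =
     permanent (pverts G)
       (\<lambda>u v. (if u = v then [:0, 1:] else 0) - [:signless_laplacian G u v:])"

text \<open>The path and the cycle (for \<open>n \<ge> 3\<close>) on the \<open>n\<close> vertices \<open>a, a + 1, \<dots>, a + n - 1\<close>.\<close>

definition path_graph :: "nat \<Rightarrow> nat \<Rightarrow> nat pair_pre_digraph" where
  "path_graph a n =
     \<lparr>pverts = {a..<a + n},
      parcs = {(i, j). i \<in> {a..<a + n} \<and> j \<in> {a..<a + n} \<and> (j = Suc i \<or> i = Suc j)}\<rparr>"

definition cycle_graph :: "nat \<Rightarrow> nat \<Rightarrow> nat pair_pre_digraph" where
  "cycle_graph a n =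
     \<lparr>pverts = {a..<a + n},
      parcs = parcs (path_graph a n) \<union> {(a, a + n - 1), (a + n - 1, a)}\<rparr>"

text \<open>
  The copies of $C_p$, $P_r$ and $C_q$ are placed on overlapping intervals, so that the
  identifications are already made: $C_p$ and $P_r$ share exactly the vertex \<open>p - 1\<close>, while
  $P_r$ and $C_q$ share exactly the other end \<open>p + r - 2\<close> of the path (see
  \<open>dumbbell_identifications\<close>).
\<close>

definition dumbbell :: "nat \<Rightarrow> nat \<Rightarrow> nat \<Rightarrow> nat pair_pre_digraph" where
  "dumbbell p q r =
     (let C = cycle_graph 0 p; P = path_graph (p - 1) r; C' = cycle_graph (p + r - 2) q
      in \<lparr>pverts = pverts C \<union> pverts P \<union> pverts C',
          parcs = parcs C \<union> parcs P \<union> parcs C'\<rparr>)"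

lemma dumbbell_identifications:
  assumes "p \<ge> 3" "q \<ge> 3" "r \<ge> 2"
  shows "pverts (cycle_graph 0 p) \<inter> pverts (path_graph (p - 1) r) = {p - 1}"
    and "pverts (path_graph (p - 1) r) \<inter> pverts (cycle_graph (p + r - 2) q) = {p + r - 2}"
    and "pverts (cycle_graph 0 p) \<inter> pverts (cycle_graph (p + r - 2) q) = {}"
  using assms by (auto simp: cycle_graph_def path_graph_def)

lemma pair_graph_path_graph: "pair_graph (path_graph a n)"
proof (rule pair_graphI_graph, unfold_locales)
  show "finite (arcs (with_proj (path_graph a n)))"
    by (rule finite_subset[of _ "{a..<a + n} \<times> {a..<a + n}"]) (auto simp: path_graph_def)
qed (auto simp: path_graph_def symmetric_def sym_def arc_to_ends_def)

lemma pair_graph_cycle_graph: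
  assumes "n \<ge> 3"
  shows "pair_graph (cycle_graph a n)"
proof -
  interpret P: pair_graph "path_graph a n" by (rule pair_graph_path_graph)
  show ?thesis
  proof (rule pair_graphI_graph, unfold_locales)
    show "finite (arcs (with_proj (cycle_graph a n)))"
      using P.pair_finite_arcs by (simp add: cycle_graph_def)
  qed (use assms in \<open>auto simp: cycle_graph_def path_graph_def symmetric_def sym_def arc_to_ends_def\<close>)
qed

lemma pair_graph_dumbbell:
  assumes "p \<ge> 3" "q \<ge> 3" "r \<ge> 2"
  shows "pair_graph (dumbbell p q r)"
proof -
  let ?C = "cycle_graph 0 p" and ?P = "path_graph (p - Suc 0) r" and ?D = "cycle_graph (p + r - 2) q"
  interpret C: pair_graph ?C using assms by (intro pair_graph_cycle_graph)
  interpret P: pair_graph ?P by (rule pair_graph_path_graph)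
  interpret D: pair_graph ?D using assms by (intro pair_graph_cycle_graph)
  show ?thesis
  proof (rule pair_graphI_graph, unfold_locales)
    show "symmetric (with_proj (dumbbell p q r))"
      using C.arcs_symmetric P.arcs_symmetric D.arcs_symmetric
      by (auto simp: symmetric_def sym_def dumbbell_def Let_def)
  qed (use C.pair_finite_verts P.pair_finite_verts D.pair_finite_verts
        C.pair_finite_arcs P.pair_finite_arcs D.pair_finite_arcs
      in \<open>auto simp: dumbbell_def Let_def arc_to_ends_def
           dest: C.in_arcsD1 C.in_arcsD2 P.in_arcsD1 P.in_arcsD2 D.in_arcsD1 D.in_arcsD2
             C.no_loops P.no_loops D.no_loops\<close>)
qed

end

theory Submission
  imports Defs "HOL-Library.FuncSet" "HOL-Computational_Algebra.Formal_Laurent_Series"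
begin

text \<open>
  The coefficients of \<open>x\<^sup>n\<^sup>-\<^sup>1\<close> and \<open>x\<^sup>n\<^sup>-\<^sup>2\<close> determine the sum and the sum of squares of the degrees, hence
  force two vertices \<open>a\<close>, \<open>b\<close> of degree three and all others of degree two. Tracing walks from \<open>a\<close> and \<open>b\<close>
  shows that such a graph is a dumbbell or a theta graph together with disjoint cycles.

  In \<open>z = 2 - x\<close> the polynomial is, up to sign, the permanent of \<open>zI + A\<close> with a loop at \<open>a\<close> and at \<open>b\<close>, and
  a path contributes Fibonacci polynomials in \<open>z\<close>. These become geometric sums for \<open>z = 1/s - s\<close>, so that after
  scaling each candidate graph yields an explicit polynomial in \<open>s\<close>. There a cycle of length \<open>l\<close> enters with the
  leading term \<open>2s\<^sup>l\<close>, times a factor that depends only on whether it contains none, one or both of \<open>a\<close> and \<open>b\<close>,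
  while a path with \<open>r\<close> vertices between \<open>a\<close> and \<open>b\<close> (ends included) enters with \<open>(-1)\<^sup>r s\<^sup>2\<^sup>r\<close>. Parity separates
  the paths from the cycles, and comparing the lowest coefficients and the number of vertices
  leaves only the given dumbbell.
\<close>

text \<open>The permanent is not invariant under similarity, so there is no spectrum to work with.
  Paths and cycles are handled by expansion along edges: a permutation uses an edge in a
  transposition or as part of a longer cycle. The resulting recursion f(k + 2) = z f(k + 1) + f(k)
  has characteristic roots with product -1, and z = 1/s - s makes them 1/s and -s.

  The obstacle is that permanents of components multiply, so a second graph may compensate a
  difference by disjoint cycles. With B = 1 + s + 2 s^2 and w = 1 + s^2, every series starts with
  B^2, and the factor of a cycle is B^2, w B or w^2 when it contains none, one or both of the cubic
  vertices. All three have constant term 1, so the lowest coefficient merely counts cycles. Only the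
  following coefficients tell the roles apart, which is why up to four consecutive ones are
  compared. Below degree 2 m, with m the least length involved, cycles change coefficients by even
  amounts only, so a reduction modulo 2 isolates the path terms before any counting begins.\<close>

section \<open>Permanents of weighted adjacency matrices\<close>

text \<open>Rows and columns are independent, so that a row and a column of different index can be deleted.\<close>

definition pm :: "('a \<Rightarrow> 'a \<Rightarrow> 'r::comm_ring_1) \<Rightarrow> 'a set \<Rightarrow> 'a set \<Rightarrow> 'r" where
  "pm M R C = (\<Sum>f | f \<in> extensional R \<and> bij_betw f R C. \<Prod>v\<in>R. M v (f v))"

lemma permanent_eq_pm: "permanent V M = pm M V V"
  unfolding permanent_def pm_def
proof (rule sum.reindex_bij_witness[of _ "\<lambda>f x. if x \<in> V then f x else x" "\<lambda>\<sigma>. restrict \<sigma> V"])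
  fix f assume f: "f \<in> {f \<in> extensional V. bij_betw f V V}"
  have "bij_betw (\<lambda>x. if x \<in> V then f x else x) V V \<longleftrightarrow> bij_betw f V V"
    by (rule bij_betw_cong) simp
  with f show "(\<lambda>x. if x \<in> V then f x else x) \<in> {\<sigma>. \<sigma> permutes V}"
    by (auto intro!: bij_imp_permutes)
next
  fix \<sigma> assume "\<sigma> \<in> {\<sigma>. \<sigma> permutes V}"
  then have "bij_betw \<sigma> V V" by (simp add: permutes_imp_bij)
  moreover have "bij_betw (restrict \<sigma> V) V V \<longleftrightarrow> bij_betw \<sigma> V V"
    by (rule bij_betw_cong) simp
  ultimately show "restrict \<sigma> V \<in> {f \<in> extensional V. bij_betw f V V}"
    by auto
qed (auto simp: fun_eq_iff extensional_def permutes_def)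

lemma finite_bij_extensional:
  assumes "finite R" "finite C"
  shows "finite {f \<in> extensional R. bij_betw f R C}"
  by (rule finite_subset[OF _ finite_PiE[of R "\<lambda>_. C"]])
     (use assms in \<open>auto simp: PiE_def bij_betw_def\<close>)

lemma pm_empty [simp]:
  fixes M :: "'a \<Rightarrow> 'a \<Rightarrow> 'r::comm_ring_1"
  shows "pm M {} {} = 1"
proof -
  have "{f :: 'a \<Rightarrow> 'a. f \<in> extensional {} \<and> bij_betw f {} {}} = {\<lambda>_. undefined}"
    by (auto simp: bij_betw_def extensional_def)
  then show ?thesis unfolding pm_def by (simp only:) simp
qed

text \<open>Laplace expansion without signs: a bijection splits into the column it gives to
  \<open>r\<close> and its restriction to the remaining rows.\<close>

lemma pm_expand_row:
  assumes fin: "finite R" "finite C" and r: "r \<in> R"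
  shows "pm M R C = (\<Sum>c\<in>C. M r c * pm M (R - {r}) (C - {c}))"
proof -
  let ?A = "\<lambda>R C. {f \<in> extensional R. bij_betw f R C}"
  have "(\<Sum>c\<in>C. M r c * pm M (R - {r}) (C - {c})) =
    (\<Sum>c\<in>C. \<Sum>f\<in>?A (R - {r}) (C - {c}). M r c * (\<Prod>v\<in>R - {r}. M v (f v)))"
    by (simp add: pm_def sum_distrib_left)
  also have "\<dots> = (\<Sum>(c, f)\<in>(SIGMA c:C. ?A (R - {r}) (C - {c})). M r c * (\<Prod>v\<in>R - {r}. M v (f v)))"
    using fin by (intro sum.Sigma) (auto intro!: finite_bij_extensional)
  also have "\<dots> = (\<Sum>f\<in>?A R C. \<Prod>v\<in>R. M v (f v))"
  proof (rule sum.reindex_bij_witness[of _ "\<lambda>f. (f r, restrict f (R - {r}))" "\<lambda>(c, g). g(r := c)"])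
    fix x assume "x \<in> (SIGMA c:C. ?A (R - {r}) (C - {c}))"
    then obtain c g where x: "x = (c, g)" and c: "c \<in> C" and g: "g \<in> extensional (R - {r})"
      and bij: "bij_betw g (R - {r}) (C - {c})" by auto
    have gr: "restrict (g(r := c)) (R - {r}) = g"
      using g by (auto simp: fun_eq_iff extensional_def)
    then show "((case x of (c, g) \<Rightarrow> g(r := c)) r, restrict (case x of (c, g) \<Rightarrow> g(r := c)) (R - {r})) = x"
      by (simp add: x)
    have "bij_betw (g(r := c)) (insert r (R - {r})) (insert c (C - {c}))"
      using bij by (auto simp: bij_betw_def inj_on_def)
    then show "(case x of (c, g) \<Rightarrow> g(r := c)) \<in> ?A R C"
      using g r c by (auto simp: x insert_absorb extensional_def)
    have "(\<Prod>v\<in>R. M v ((g(r := c)) v)) = M r c * (\<Prod>v\<in>R - {r}. M v ((g(r := c)) v))"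
      using fin r by (subst prod.remove[of R r]) auto
    also have "(\<Prod>v\<in>R - {r}. M v ((g(r := c)) v)) = (\<Prod>v\<in>R - {r}. M v (g v))"
      by (rule prod.cong) auto
    finally show "(\<Prod>v\<in>R. M v ((case x of (c, g) \<Rightarrow> g(r := c)) v)) =
        (case x of (c, f) \<Rightarrow> M r c * (\<Prod>v\<in>R - {r}. M v (f v)))"
      by (simp add: x)
  next
    fix f assume f: "f \<in> ?A R C"
    then have "bij_betw f (R - {r}) (C - {f r})"
      using r bij_betw_DiffI[of f R C "{r}" "{f r}"] by (auto simp: bij_betw_def)
    moreover have "bij_betw (restrict f (R - {r})) (R - {r}) (C - {f r}) \<longleftrightarrow> bij_betw f (R - {r}) (C - {f r})"
      by (rule bij_betw_cong) simp
    ultimately show "(f r, restrict f (R - {r})) \<in> (SIGMA c:C. ?A (R - {r}) (C - {c}))"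
      using f r by (auto simp: bij_betw_def)
    show "(case (f r, restrict f (R - {r})) of (c, g) \<Rightarrow> g(r := c)) = f"
      using f r by (auto simp: fun_eq_iff extensional_def)
  qed
  finally show ?thesis by (simp add: pm_def)
qed

lemma pm_cong:
  assumes "\<And>u v. u \<in> R \<Longrightarrow> v \<in> C \<Longrightarrow> M u v = N u v"
  shows "pm M R C = pm N R C"
  unfolding pm_def by (intro sum.cong prod.cong) (auto simp: assms bij_betw_def)

lemma pm_zero_row:
  assumes "finite R" "finite C" "r \<in> R" "\<And>c. c \<in> C \<Longrightarrow> M r c = 0"
  shows "pm M R C = 0"
  using assms by (subst pm_expand_row[of R C r]) auto

lemma pm_zero_column:
  assumes "finite R" "c \<in> C" "\<And>r. r \<in> R \<Longrightarrow> M r c = 0"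
  shows "pm M R C = 0"
  unfolding pm_def
proof (intro sum.neutral ballI)
  fix f assume "f \<in> {f \<in> extensional R. bij_betw f R C}"
  then obtain r where "r \<in> R" "f r = c" using assms(2) by (auto simp: bij_betw_def)
  with assms show "(\<Prod>v\<in>R. M v (f v)) = 0" by (auto intro!: prod_zero)
qed

text \<open>The permanent is affine in a single entry, with the complementary minor as
  slope.\<close>

lemma pm_add_arc:
  assumes fin: "finite R" "finite C"
    and M: "\<And>x y. M' x y = M x y + (if x = u \<and> y = v then 1 else 0)"
  shows "pm M' R C = pm M R C + (if u \<in> R \<and> v \<in> C then pm M (R - {u}) (C - {v}) else 0)"
proof (cases "u \<in> R")
  case True
  have *: "pm M' (R - {u}) (C - {c}) = pm M (R - {u}) (C - {c})" for c
    by (rule pm_cong) (auto simp: M)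
  have "pm M' R C = (\<Sum>c\<in>C. M' u c * pm M' (R - {u}) (C - {c}))"
    by (rule pm_expand_row[OF fin True])
  also have "\<dots> = (\<Sum>c\<in>C. M u c * pm M (R - {u}) (C - {c})) +
      (\<Sum>c\<in>C. if c = v then pm M (R - {u}) (C - {v}) else 0)"
    unfolding sum.distrib[symmetric] by (intro sum.cong) (auto simp: * M algebra_simps)
  also have "(\<Sum>c\<in>C. M u c * pm M (R - {u}) (C - {c})) = pm M R C"
    by (rule pm_expand_row[OF fin True, symmetric])
  finally show ?thesis using fin True by simp
next
  case False
  then have "pm M' R C = pm M R C" by (intro pm_cong) (auto simp: M)
  with False show ?thesis by simp
qed

text \<open>The two arcs lie in different rows, so \<open>pm_add_arc\<close> applies twice. The last
  summand takes both arcs and is the transposition of \<open>u\<close> and \<open>v\<close>; the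
  case distinctions allow for rows and columns that are already deleted.\<close>

lemma pm_add_edge:
  assumes fin: "finite R" "finite C" and "u \<noteq> v"
    and M: "\<And>x y. M' x y = M x y + (if x = u \<and> y = v \<or> x = v \<and> y = u then 1 else 0)"
  shows "pm M' R C = pm M R C
    + (if u \<in> R \<and> v \<in> C then pm M (R - {u}) (C - {v}) else 0)
    + (if v \<in> R \<and> u \<in> C then pm M (R - {v}) (C - {u}) else 0)
    + (if u \<in> R \<and> u \<in> C \<and> v \<in> R \<and> v \<in> C then pm M (R - {u} - {v}) (C - {u} - {v}) else 0)"
proof -
  let ?N = "\<lambda>x y. M x y + (if x = u \<and> y = v then 1 else 0)"
  have N: "pm ?N R C = pm M R C + (if u \<in> R \<and> v \<in> C then pm M (R - {u}) (C - {v}) else 0)"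
    if "finite R" "finite C" for R C
    by (rule pm_add_arc[OF that]) simp
  have "pm M' R C = pm ?N R C + (if v \<in> R \<and> u \<in> C then pm ?N (R - {v}) (C - {u}) else 0)"
    by (rule pm_add_arc[OF fin]) (use \<open>u \<noteq> v\<close> in \<open>auto simp: M\<close>)
  moreover have "R - {v} - {u} = R - {u} - {v}" by auto
  ultimately show ?thesis
    using fin \<open>u \<noteq> v\<close> by (simp add: N)
qed

lemma pm_insert_isolated:
  assumes "finite R" "finite C" "x \<notin> R" "x \<notin> C" "\<And>y. y \<noteq> x \<Longrightarrow> M x y = 0"
  shows "pm M (insert x R) (insert x C) = M x x * pm M R C"
proof -
  have "pm M (insert x R) (insert x C) = (\<Sum>c\<in>insert x C. M x c * pm M R (insert x C - {c}))"
    using assms by (subst pm_expand_row[of _ _ x]) auto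
  also have "\<dots> = M x x * pm M R C + (\<Sum>c\<in>C. M x c * pm M R (insert x C - {c}))"
    using assms by simp
  also have "(\<Sum>c\<in>C. M x c * pm M R (insert x C - {c})) = 0"
    using assms by (intro sum.neutral) (metis mult_zero_left)
  finally show ?thesis by simp
qed

section \<open>Joining two vertices by a path\<close>

fun walk_edges :: "'a list \<Rightarrow> ('a \<times> 'a) set" where
  "walk_edges (x # y # xs) = {(x, y), (y, x)} \<union> walk_edges (y # xs)"
| "walk_edges _ = {}"

text \<open>The diagonal is kept apart from the edges: walks are added one at a time, while
  \<open>d\<close> already holds the weights that belong to the degrees in the finished
  graph.\<close>

definition weighted_adj :: "('a \<Rightarrow> 'r) \<Rightarrow> ('a \<times> 'a) set \<Rightarrow> 'a \<Rightarrow> 'a \<Rightarrow> 'r::comm_ring_1" where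
  "weighted_adj d E u v = (if u = v then d u else if (u, v) \<in> E then 1 else 0)"

text \<open>The path on \<open>k\<close> vertices has permanent \<open>pathpoly z (k + 2)\<close>; the shift makes room for the values
  that the recursion forces on paths with \<open>-1\<close> and \<open>-2\<close> vertices.\<close>

fun pathpoly :: "'r::comm_ring_1 \<Rightarrow> nat \<Rightarrow> 'r" where
  "pathpoly z 0 = 1"
| "pathpoly z (Suc 0) = 0"
| "pathpoly z (Suc (Suc k)) = z * pathpoly z (Suc k) + pathpoly z k"

lemma pm_weighted_adj_add_edge:
  assumes "finite R" "finite C" "u \<noteq> v" "(u, v) \<notin> E" "(v, u) \<notin> E"
  shows "pm (weighted_adj d (insert (u, v) (insert (v, u) E))) R C = pm (weighted_adj d E) R C
    + (if u \<in> R \<and> v \<in> C then pm (weighted_adj d E) (R - {u}) (C - {v}) else 0)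
    + (if v \<in> R \<and> u \<in> C then pm (weighted_adj d E) (R - {v}) (C - {u}) else 0)
    + (if u \<in> R \<and> u \<in> C \<and> v \<in> R \<and> v \<in> C then pm (weighted_adj d E) (R - {u} - {v}) (C - {u} - {v}) else 0)"
  by (rule pm_add_edge) (use assms in \<open>auto simp: weighted_adj_def\<close>)

lemma pm_isolated:
  assumes "finite R" "finite C" "x \<notin> R" "x \<notin> C" "E \<subseteq> W \<times> W" "x \<notin> W"
  shows "pm (weighted_adj d E) (insert x R) (insert x C) = d x * pm (weighted_adj d E) R C"
    and "pm (weighted_adj d E) (insert x R) C = 0"
    and "pm (weighted_adj d E) R (insert x C) = 0"
proof -
  show "pm (weighted_adj d E) (insert x R) (insert x C) = d x * pm (weighted_adj d E) R C"
    using assms by (subst pm_insert_isolated) (auto simp: weighted_adj_def)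
  show "pm (weighted_adj d E) (insert x R) C = 0"
    using assms by (intro pm_zero_row[of _ _ x]) (auto simp: weighted_adj_def)
  show "pm (weighted_adj d E) R (insert x C) = 0"
    using assms by (intro pm_zero_column[of _ x]) (auto simp: weighted_adj_def)
qed

text \<open>A leaf \<open>x\<close> can only meet itself or \<open>u\<close>. If \<open>x\<close> is
  merely a row or merely a column, the edge to \<open>u\<close> is forced, and this is how minors
  with different rows and columns arise.\<close>

lemma pm_pendant:
  fixes d :: "'a \<Rightarrow> 'r::comm_ring_1"
  assumes fin: "finite R" "finite C" and "x \<notin> W" "u \<in> W" "R \<subseteq> W" "C \<subseteq> W" "E \<subseteq> W \<times> W"
  defines "M \<equiv> weighted_adj d E"
  defines "N \<equiv> weighted_adj d (insert (u, x) (insert (x, u) E))"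
  shows "pm N (insert x R) (insert x C) = d x * pm M R C + (if u \<in> R \<and> u \<in> C then pm M (R - {u}) (C - {u}) else 0)"
    and "pm N (insert x R) C = (if u \<in> C then pm M R (C - {u}) else 0)"
    and "pm N R (insert x C) = (if u \<in> R then pm M (R - {u}) C else 0)"
    and "pm N R C = pm M R C"
proof -
  have e: "u \<noteq> x" "(u, x) \<notin> E" "(x, u) \<notin> E" "x \<notin> R" "x \<notin> C" "x \<notin> R - A" "x \<notin> C - A" for A using assms by auto
  have d: "insert x R - {u} = insert x (R - {u})" "insert x C - {u} = insert x (C - {u})"
    "insert x R - {x} = R" "insert x C - {x} = C"
    "insert x R - {u} - {x} = R - {u}" "insert x C - {u} - {x} = C - {u}" using e by auto
  note iso = pm_isolated[OF _ _ _ _ \<open>E \<subseteq> W \<times> W\<close> \<open>x \<notin> W\<close>]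
  note s = N_def M_def pm_weighted_adj_add_edge[OF _ _ e(1-3)] fin e d iso
  show "pm N (insert x R) (insert x C) = d x * pm M R C + (if u \<in> R \<and> u \<in> C then pm M (R - {u}) (C - {u}) else 0)"
    by (simp add: s)
  show "pm N (insert x R) C = (if u \<in> C then pm M R (C - {u}) else 0)"
    by (simp add: s)
  show "pm N R (insert x C) = (if u \<in> R then pm M (R - {u}) C else 0)"
    by (simp add: s)
  show "pm N R C = pm M R C"
    by (simp add: s)
qed

lemma walk_edges_subset: "walk_edges xs \<subseteq> set xs \<times> set xs"
  by (induction xs rule: walk_edges.induct) auto

text \<open>The summands sort permutations by their use of the new path: neither end edge, one end
  edge in a transposition, both end edges in transpositions, or the whole path in one of its two
  directions, which leaves a minor with different rows and columns. For \<open>u = v\<close> this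
  attaches a cycle at \<open>u\<close>; one inner vertex is then excluded, since both steps would be
  the same edge.\<close>

lemma pm_add_path:
  fixes d :: "'a \<Rightarrow> 'r::comm_ring_1"
  assumes "finite W" "E \<subseteq> W \<times> W" "u \<in> W" "v \<in> W" "distinct xs" "set xs \<inter> W = {}"
    "R \<subseteq> W" "C \<subseteq> W" "\<forall>x\<in>set xs. d x = z"
    "xs = [] \<longrightarrow> u \<noteq> v \<and> (u, v) \<notin> E \<and> (v, u) \<notin> E" "u = v \<longrightarrow> length xs \<noteq> 1"
  defines "M \<equiv> weighted_adj d E"
  shows "pm (weighted_adj d (E \<union> walk_edges (u # xs @ [v]))) (set xs \<union> R) (set xs \<union> C) =
    pathpoly z (Suc (Suc (length xs))) * pm M R C
    + pathpoly z (Suc (length xs)) *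
       ((if u \<in> R \<and> u \<in> C then pm M (R - {u}) (C - {u}) else 0) +
        (if v \<in> R \<and> v \<in> C then pm M (R - {v}) (C - {v}) else 0))
    + pathpoly z (length xs) *
       (if u \<noteq> v \<and> u \<in> R \<and> u \<in> C \<and> v \<in> R \<and> v \<in> C then pm M (R - {u} - {v}) (C - {u} - {v}) else 0)
    + (if v \<in> R \<and> u \<in> C then pm M (R - {v}) (C - {u}) else 0)
    + (if u \<in> R \<and> v \<in> C then pm M (R - {u}) (C - {v}) else 0)"
  using assms(1-11) unfolding M_def
proof (induction xs arbitrary: u E W R C)
  case Nil
  then have "finite R" "finite C" by (auto intro: finite_subset)
  with Nil show ?case by (simp add: pm_weighted_adj_add_edge)
next
  case (Cons x xs)
  have fin: "finite R" "finite C" using Cons.prems by (auto intro: finite_subset)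
  let ?E = "insert (u, x) (insert (x, u) E)"
  have x: "x \<notin> W" "x \<notin> set xs" "x \<noteq> u" "x \<noteq> v" "x \<notin> R" "x \<notin> C" using Cons.prems by auto
  have eq: "E \<union> walk_edges (u # (x # xs) @ [v]) = ?E \<union> walk_edges (x # xs @ [v])" by auto
  have s: "set (x # xs) \<union> R = set xs \<union> insert x R" "set (x # xs) \<union> C = set xs \<union> insert x C" by auto
  have d: "insert x R - {v} = insert x (R - {v})" "insert x C - {v} = insert x (C - {v})"
    "insert x R - {x} = R" "insert x C - {x} = C"
    "insert x R - {x} - {v} = R - {v}" "insert x C - {x} - {v} = C - {v}"
    "R - {v} - {u} = R - {u} - {v}" "C - {v} - {u} = C - {u} - {v}" using x by auto
  note pend = pm_pendant[OF _ _ \<open>x \<notin> W\<close> \<open>u \<in> W\<close> _ _ \<open>E \<subseteq> W \<times> W\<close>]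
  have sub: "R - {v} \<subseteq> W" "C - {v} \<subseteq> W" using Cons.prems by auto
  \<comment> \<open>The vertex \<open>x\<close> is hung on \<open>u\<close> as a leaf, and the
    shorter path then runs from \<open>x\<close> to \<open>v\<close> over the vertex set enlarged by
    \<open>x\<close>.\<close>
  have IH: "pm (weighted_adj d (?E \<union> walk_edges (x # xs @ [v]))) (set xs \<union> insert x R) (set xs \<union> insert x C) =
    pathpoly z (Suc (Suc (length xs))) * pm (weighted_adj d ?E) (insert x R) (insert x C)
    + pathpoly z (Suc (length xs)) *
       (pm (weighted_adj d ?E) (insert x R - {x}) (insert x C - {x}) +
        (if v \<in> R \<and> v \<in> C then pm (weighted_adj d ?E) (insert x R - {v}) (insert x C - {v}) else 0))
    + pathpoly z (length xs) *
       (if v \<in> R \<and> v \<in> C then pm (weighted_adj d ?E) (insert x R - {x} - {v}) (insert x C - {x} - {v}) else 0)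
    + (if v \<in> R then pm (weighted_adj d ?E) (insert x R - {v}) (insert x C - {x}) else 0)
    + (if v \<in> C then pm (weighted_adj d ?E) (insert x R - {x}) (insert x C - {v}) else 0)"
    using x Cons.prems by (subst Cons.IH[of "insert x W"]) auto
  show ?case
    unfolding eq s IH d
    using Cons.prems fin sub by (simp add: pend d algebra_simps)
qed

section \<open>Graphs with two vertices of degree three\<close>

definition nbrs :: "('a \<times> 'a) set \<Rightarrow> 'a \<Rightarrow> 'a set" where
  "nbrs E v = {w. (v, w) \<in> E}"

abbreviation deg :: "('a \<times> 'a) set \<Rightarrow> 'a \<Rightarrow> nat" where
  "deg E v \<equiv> card (nbrs E v)"

definition edges_on :: "'a set \<Rightarrow> ('a \<times> 'a) set \<Rightarrow> bool" where
  "edges_on V E \<longleftrightarrow> finite V \<and> E \<subseteq> V \<times> V \<and> sym E \<and> irrefl E"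

lemma remove_edge:
  assumes E: "edges_on V E" and ux: "(u, x) \<in> E"
  defines "E' \<equiv> E - {(u, x), (x, u)}"
  shows "edges_on V E'" "E = E' \<union> {(u, x), (x, u)}" "u \<noteq> x"
    "deg E w = deg E' w + (if w = u then 1 else 0) + (if w = x then 1 else 0)"
proof -
  show "edges_on V E'" using E by (auto simp: edges_on_def E'_def sym_def irrefl_def)
  have xu: "(x, u) \<in> E" using E ux by (auto simp: edges_on_def sym_def)
  then show "E = E' \<union> {(u, x), (x, u)}" using ux by (auto simp: E'_def)
  show ne: "u \<noteq> x" using E ux by (auto simp: edges_on_def irrefl_def)
  have fin: "finite (nbrs E' w)"
    using E by (intro finite_subset[of "nbrs E' w" V]) (auto simp: edges_on_def nbrs_def E'_def)
  have "nbrs E w = nbrs E' w \<union> (if w = u then {x} else {}) \<union> (if w = x then {u} else {})"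
    using ux xu by (auto simp: nbrs_def E'_def)
  moreover have "w = u \<Longrightarrow> x \<notin> nbrs E' w" "w = x \<Longrightarrow> u \<notin> nbrs E' w"
    by (auto simp: nbrs_def E'_def)
  ultimately show "deg E w = deg E' w + (if w = u then 1 else 0) + (if w = x then 1 else 0)"
    using fin ne by auto
qed

lemma trace_path:
  assumes "edges_on V E" "S \<subseteq> V" "\<And>w. w \<in> V - S \<Longrightarrow> deg E w = 2" "u \<in> S" "deg E u > 0"
  obtains xs v E0 where "distinct xs" "set xs \<subseteq> V - S" "v \<in> S" "edges_on (V - set xs) E0"
    "E = E0 \<union> walk_edges (u # xs @ [v])" "u = v \<Longrightarrow> length xs \<ge> 2" "(u, v) \<in> E0 \<Longrightarrow> xs \<noteq> []"
    "\<And>w. w \<in> V - set xs \<Longrightarrow> deg E w = deg E0 w + (if w = u then 1 else 0) + (if w = v then 1 else 0)"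
  using assms
proof (induction "card (V - S)" arbitrary: u E S thesis rule: less_induct)
  case less
  from less.prems(6) obtain x where ux: "(u, x) \<in> E"
    by (auto simp: nbrs_def card_gt_0_iff)
  let ?E = "E - {(u, x), (x, u)}"
  have V: "finite V" "x \<in> V" using less.prems(2) ux by (auto simp: edges_on_def)
  note E' = remove_edge[OF less.prems(2) ux]
  show ?case
  proof (cases "x \<in> S")
    case True
    show ?thesis
    proof (rule less.prems(1)[of "[]" x ?E])
      show "E = ?E \<union> walk_edges (u # [] @ [x])" using E'(2) by auto
    qed (use True E' in auto)
  next
    case False
    have "deg E x = 2" using False V less.prems(4) by auto
    then have degx: "deg ?E x = 1" using E'(3) E'(4)[of x] by simp
    have less': "card (V - insert x S) < card (V - S)"
      using V False by (intro psubset_card_mono) auto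
    have deg2: "deg ?E w = 2" if "w \<in> V - insert x S" for w
      using E'(4)[of w] less.prems(4)[of w] less.prems(5) that by (auto split: if_splits)
    obtain xs v E0 where IH: "distinct xs" "set xs \<subseteq> V - insert x S" "v \<in> insert x S"
      "edges_on (V - set xs) E0" "?E = E0 \<union> walk_edges (x # xs @ [v])"
      "x = v \<Longrightarrow> length xs \<ge> 2" "(x, v) \<in> E0 \<Longrightarrow> xs \<noteq> []"
      and degE0: "\<And>w. w \<in> V - set xs \<Longrightarrow> deg ?E w = deg E0 w + (if w = x then 1 else 0) + (if w = v then 1 else 0)"
      by (rule less.hyps[OF less', of ?E x]) (use E'(1) deg2 degx less.prems(3) V in auto)
    have x: "x \<in> V - set xs" using V IH(2) by auto
    \<comment> \<open>The single edge left at \<open>x\<close> is the first edge of the remaining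
      walk, so that walk does not end at \<open>x\<close> and leaves \<open>x\<close>
      isolated.\<close>
    have v: "v \<noteq> x" "deg E0 x = 0" using degE0[OF x] degx by (auto split: if_splits)
    have "finite (nbrs E0 x)"
      using IH(4) by (intro finite_subset[of "nbrs E0 x" V]) (auto simp: edges_on_def nbrs_def)
    with v(2) have "nbrs E0 x = {}" by simp
    then have E0: "edges_on (V - set (x # xs)) E0"
      using IH(4) unfolding edges_on_def nbrs_def sym_def by auto
    show ?thesis
    proof (rule less.prems(1)[of "x # xs" v E0])
      show "E = E0 \<union> walk_edges (u # (x # xs) @ [v])" using E'(2) IH(5) by auto
      show "length (x # xs) \<ge> 2" if "u = v"
      proof (rule ccontr)
        assume "\<not> length (x # xs) \<ge> 2"
        then have "xs = []" by (cases xs) auto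
        \<comment> \<open>A closed walk with one inner vertex would return along the edge just
          deleted.\<close>
        with IH(5) that have "(x, u) \<in> ?E" by auto
        then show False by simp
      qed
      show "deg E w = deg E0 w + (if w = u then 1 else 0) + (if w = v then 1 else 0)"
        if "w \<in> V - set (x # xs)" for w
        using that E'(4)[of w] degE0[of w] by simp
    qed (use IH v False x E0 in auto)
  qed
qed

lemma edges_on_isolated:
  assumes "edges_on V E" "deg E x = 0"
  shows "edges_on (V - {x}) E"
proof -
  have "finite (nbrs E x)"
    using assms(1) by (intro finite_subset[of "nbrs E x" V]) (auto simp: edges_on_def nbrs_def)
  with assms have "nbrs E x = {}" by simp
  with assms(1) show ?thesis unfolding edges_on_def nbrs_def sym_def by blast
qed

text \<open>The degrees of \<open>a\<close> and \<open>b\<close> are left open, so that walks between them can be removed one by one.\<close>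

definition two_core :: "'a set \<Rightarrow> ('a \<times> 'a) set \<Rightarrow> 'a \<Rightarrow> 'a \<Rightarrow> bool" where
  "two_core V E a b \<longleftrightarrow> edges_on V E \<and> a \<in> V \<and> b \<in> V \<and> a \<noteq> b \<and> (\<forall>w\<in>V - {a, b}. deg E w = 2)"

lemma two_core_trace:
  assumes "two_core V E a b" "deg E a > 0"
  obtains xs E' where "two_core (V - set xs) E' a b" "distinct xs" "set xs \<subseteq> V - {a, b}"
      "E = E' \<union> walk_edges (a # xs @ [b])" "deg E a = deg E' a + 1" "deg E b = deg E' b + 1"
      "(a, b) \<in> E' \<Longrightarrow> xs \<noteq> []"
  | xs E' where "two_core (V - set xs) E' a b" "distinct xs" "set xs \<subseteq> V - {a, b}"
      "E = E' \<union> walk_edges (a # xs @ [a])" "deg E a = deg E' a + 2" "deg E b = deg E' b"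
      "length xs \<ge> 2"
proof -
  have V: "edges_on V E" "a \<in> V" "b \<in> V" "a \<noteq> b" "\<And>w. w \<in> V - {a, b} \<Longrightarrow> deg E w = 2"
    using assms by (auto simp: two_core_def)
  have S: "{a, b} \<subseteq> V" using V by simp
  obtain xs v E' where *: "distinct xs" "set xs \<subseteq> V - {a, b}" "v \<in> {a, b}" "edges_on (V - set xs) E'"
    "E = E' \<union> walk_edges (a # xs @ [v])" "a = v \<Longrightarrow> length xs \<ge> 2" "(a, v) \<in> E' \<Longrightarrow> xs \<noteq> []"
    and degE: "\<And>w. w \<in> V - set xs \<Longrightarrow> deg E w = deg E' w + (if w = a then 1 else 0) + (if w = v then 1 else 0)"
    by (rule trace_path[OF V(1) S V(5) _ assms(2)]) auto
  have ab: "a \<in> V - set xs" "b \<in> V - set xs" using * V by auto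
  have two: "two_core (V - set xs) E' a b"
    unfolding two_core_def
  proof (intro conjI ballI)
    fix w assume w: "w \<in> V - set xs - {a, b}"
    then have "deg E w = 2" "w \<noteq> v" "w \<noteq> a" using V(5) *(3) by auto
    with degE[of w] w show "deg E' w = 2" by simp
  qed (use * ab V in auto)
  show thesis
  proof (cases "v = a")
    case True
    show thesis by (rule that(2)[OF two *(1,2)]) (use True * V(4) degE[OF ab(1)] degE[OF ab(2)] in auto)
  next
    case False
    then have "v = b" using * by auto
    then show thesis by (intro that(1)[OF two *(1,2)]) (use * V(4) degE[OF ab(1)] degE[OF ab(2)] in auto)
  qed
qed

lemma two_core_sym: "two_core V E a b \<Longrightarrow> two_core V E b a"
  by (auto simp: two_core_def insert_commute)

lemma two_core_regular:
  assumes "two_core V E a b" "deg E a = 0" "deg E b = 0"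
  shows "edges_on (V - {a, b}) E" "\<And>w. w \<in> V - {a, b} \<Longrightarrow> deg E w = 2"
proof -
  have "edges_on (V - {a} - {b}) E"
    using assms by (intro edges_on_isolated) (auto simp: two_core_def)
  moreover have "V - {a} - {b} = V - {a, b}" by auto
  ultimately show "edges_on (V - {a, b}) E" by simp
qed (use assms in \<open>auto simp: two_core_def\<close>)

text \<open>The lists run along the walks without their ends, so the cycles have lengths
  \<open>length A + 1\<close> and \<open>length B + 1\<close>, and the path has
  \<open>length R + 2\<close> vertices. The 2-regular rest on \<open>W\<close> consists of disjoint
  cycles.\<close>

definition dumbbell_with_cycles ::
  "'a set \<Rightarrow> ('a \<times> 'a) set \<Rightarrow> 'a \<Rightarrow> 'a \<Rightarrow> 'a list \<Rightarrow> 'a list \<Rightarrow> 'a list \<Rightarrow> 'a set \<Rightarrow> ('a \<times> 'a) set \<Rightarrow> bool" where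
  "dumbbell_with_cycles V E a b A R B W E0 \<longleftrightarrow>
     distinct (A @ [a] @ R @ [b] @ B) \<and> set (A @ [a] @ R @ [b] @ B) \<inter> W = {} \<and>
     V = set (A @ [a] @ R @ [b] @ B) \<union> W \<and> length A \<ge> 2 \<and> length B \<ge> 2 \<and>
     E = E0 \<union> walk_edges (a # R @ [b]) \<union> walk_edges (a # A @ [a]) \<union> walk_edges (b # B @ [b]) \<and>
     edges_on W E0 \<and> (\<forall>w\<in>W. deg E0 w = 2)"

text \<open>In a simple graph at most one of the three paths is a single edge; this is the condition
  on the lists being empty.\<close>

definition theta_with_cycles ::
  "'a set \<Rightarrow> ('a \<times> 'a) set \<Rightarrow> 'a \<Rightarrow> 'a \<Rightarrow> 'a list \<Rightarrow> 'a list \<Rightarrow> 'a list \<Rightarrow> 'a set \<Rightarrow> ('a \<times> 'a) set \<Rightarrow> bool" where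
  "theta_with_cycles V E a b xs ys zs W E0 \<longleftrightarrow>
     distinct (a # b # xs @ ys @ zs) \<and> set (a # b # xs @ ys @ zs) \<inter> W = {} \<and>
     V = set (a # b # xs @ ys @ zs) \<union> W \<and>
     (xs \<noteq> [] \<or> ys \<noteq> []) \<and> (ys \<noteq> [] \<or> zs \<noteq> []) \<and> (xs \<noteq> [] \<or> zs \<noteq> []) \<and>
     E = E0 \<union> walk_edges (a # xs @ [b]) \<union> walk_edges (a # ys @ [b]) \<union> walk_edges (a # zs @ [b]) \<and>
     edges_on W E0 \<and> (\<forall>w\<in>W. deg E0 w = 2)"

text \<open>A walk between \<open>a\<close> and \<open>b\<close> uses one of the three edge ends at
  each of them, a closed walk two at the same vertex. The number of walks between them is therefore
  odd: three give a theta graph, and one leaves a closed walk at each vertex.\<close>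

lemma two_cubic_vertices_cases:
  assumes V: "two_core V E a b" and deg: "deg E a = 3" "deg E b = 3"
  obtains A R B W E0 where "dumbbell_with_cycles V E a b A R B W E0"
  | xs ys zs W E0 where "theta_with_cycles V E a b xs ys zs W E0"
proof -
  note dumbbell = that(1) and theta = that(2)
  \<comment> \<open>The walk to \<open>b\<close> may be traced before or after the closed walk at
    \<open>a\<close>; both orders end here.\<close>
  have dumbbellI: thesis
    if "distinct A" "distinct B" "distinct R" "set A \<subseteq> V - {a, b}" "set R \<subseteq> V - {a, b}" "set B \<subseteq> V - {a, b}"
      "set A \<inter> set R = {}" "set A \<inter> set B = {}" "set R \<inter> set B = {}"
      "two_core (V - (set A \<union> set R \<union> set B)) E0 a b" "deg E0 a = 0" "deg E0 b = 0" "length A \<ge> 2" "length B \<ge> 2"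
      "E = E0 \<union> walk_edges (a # R @ [b]) \<union> walk_edges (a # A @ [a]) \<union> walk_edges (b # B @ [b])" for A R B E0
  proof (rule dumbbell)
    show "dumbbell_with_cycles V E a b A R B (V - (set A \<union> set R \<union> set B) - {a, b}) E0"
      unfolding dumbbell_with_cycles_def
      using two_core_regular[OF that(10-12)] that V by (auto simp: two_core_def)
  qed
  have pos: "deg E a > 0" using deg by simp
  show thesis
  proof (cases rule: two_core_trace[OF V pos])
    case (1 xs E1)
    then have d1: "deg E1 a = 2" "deg E1 b = 2" "deg E1 a > 0" using deg by auto
    show ?thesis
    proof (cases rule: two_core_trace[OF 1(1) d1(3)])
      case ys: (1 ys E2)
      then have d2: "deg E2 a = 1" "deg E2 b = 1" "deg E2 a > 0" using d1 by auto
      show ?thesis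
      proof (cases rule: two_core_trace[OF ys(1) d2(3)])
        case zs: (1 zs E3)
        have d3: "deg E3 a = 0" "deg E3 b = 0" using zs d2 by auto
        have ne: "xs \<noteq> [] \<or> ys \<noteq> []" "ys \<noteq> [] \<or> zs \<noteq> []" "xs \<noteq> [] \<or> zs \<noteq> []"
          using 1 ys zs by auto
        show ?thesis
        proof (rule theta)
          show "theta_with_cycles V E a b xs ys zs (V - set xs - set ys - set zs - {a, b}) E3"
            unfolding theta_with_cycles_def
            using two_core_regular[OF zs(1) d3] 1 ys zs V ne by (auto simp: two_core_def)
        qed
      next
        case (2 zs E3)
        then show ?thesis using d2 by simp
      qed
    next
      case A: (2 A E2)
      then have d2: "deg E2 a = 0" "deg E2 b = 2" "deg E2 b > 0" using d1 by auto
      show ?thesis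
      proof (cases rule: two_core_trace[OF two_core_sym[OF A(1)] d2(3)])
        case (1 B E3)
        then show ?thesis using d2 by simp
      next
        case B: (2 B E3)
        have d3: "deg E3 a = 0" "deg E3 b = 0" using B d2 by auto
        have "V - set xs - set A - set B = V - (set A \<union> set xs \<union> set B)" by auto
        with two_core_sym[OF B(1)] have "two_core (V - (set A \<union> set xs \<union> set B)) E3 a b" by simp
        then show ?thesis
          by (rule dumbbellI[rotated 9]) (use 1 A B d3 in auto)
      qed
    qed
  next
    case A: (2 A E1)
    then have d1: "deg E1 a = 1" "deg E1 b = 3" "deg E1 a > 0" using deg by auto
    show ?thesis
    proof (cases rule: two_core_trace[OF A(1) d1(3)])
      case R: (1 R E2)
      then have d2: "deg E2 a = 0" "deg E2 b = 2" "deg E2 b > 0" using d1 by auto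
      show ?thesis
      proof (cases rule: two_core_trace[OF two_core_sym[OF R(1)] d2(3)])
        case (1 B E3)
        then show ?thesis using d2 by simp
      next
        case B: (2 B E3)
        have d3: "deg E3 a = 0" "deg E3 b = 0" using B d2 by auto
        have "V - set A - set R - set B = V - (set A \<union> set R \<union> set B)" by auto
        with two_core_sym[OF B(1)] have "two_core (V - (set A \<union> set R \<union> set B)) E3 a b" by simp
        then show ?thesis
          by (rule dumbbellI[rotated 9]) (use A R B d3 in auto)
      qed
    next
      case (2 R E2)
      then show ?thesis using d1 by simp
    qed
  qed
qed

section \<open>Permanents of dumbbells and theta graphs with cycles\<close>

text \<open>These minors are closed under adding walks at \<open>a\<close> and \<open>b\<close>: by
  \<open>pm_add_path\<close> each addition acts on them linearly. The matrices are symmetric, so the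
  two minors with different rows and columns share one value.\<close>

definition core_state ::
  "('a \<Rightarrow> 'a \<Rightarrow> 'r::comm_ring_1) \<Rightarrow> 'a set \<Rightarrow> 'a \<Rightarrow> 'a \<Rightarrow> 'r \<Rightarrow> 'r \<Rightarrow> 'r \<Rightarrow> 'r \<Rightarrow> 'r \<Rightarrow> bool" where
  "core_state M V a b y ya yb yab yd \<longleftrightarrow> pm M V V = y \<and>
     pm M (V - {a}) (V - {a}) = ya \<and> pm M (V - {b}) (V - {b}) = yb \<and>
     pm M (V - {a} - {b}) (V - {a} - {b}) = yab \<and>
     pm M (V - {a}) (V - {b}) = yd \<and> pm M (V - {b}) (V - {a}) = yd"

lemma core_state_isolated:
  fixes d :: "'a \<Rightarrow> 'r::comm_ring_1"
  assumes W: "finite W" "E \<subseteq> W \<times> W" "a \<notin> W" "b \<notin> W" "a \<noteq> b"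
  defines "Q \<equiv> pm (weighted_adj d E) W W"
  shows "core_state (weighted_adj d E) (insert a (insert b W)) a b
    (d a * d b * Q) (d b * Q) (d a * Q) Q 0"
proof -
  have s: "insert a (insert b W) - {a} = insert b W" "insert a (insert b W) - {b} = insert a W"
    "insert b W - {b} = W" using W by auto
  have b: "pm (weighted_adj d E) (insert b W) (insert b W) = d b * Q"
    unfolding Q_def using W by (intro pm_isolated(1)[of _ _ _ E W]) auto
  have a: "pm (weighted_adj d E) (insert a W) (insert a W) = d a * Q"
    unfolding Q_def using W by (intro pm_isolated(1)[of _ _ _ E W]) auto
  have ab: "pm (weighted_adj d E) (insert a (insert b W)) (insert a (insert b W)) = d a * (d b * Q)"
    unfolding b[symmetric] using W by (intro pm_isolated(1)[of _ _ _ E W]) auto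
  have "pm (weighted_adj d E) (insert b W) (insert a W) = 0" "pm (weighted_adj d E) (insert a W) (insert b W) = 0"
    using W by (auto intro!: pm_isolated(2)[of _ _ _ E W])
  with s a b ab show ?thesis by (simp add: core_state_def Q_def mult.assoc)
qed

lemma core_state_add_path:
  fixes d :: "'a \<Rightarrow> 'r::comm_ring_1"
  assumes V: "finite V" "E \<subseteq> V \<times> V" "a \<in> V" "b \<in> V" "a \<noteq> b"
    and xs: "distinct xs" "set xs \<inter> V = {}" "\<forall>x\<in>set xs. d x = z"
      "xs = [] \<longrightarrow> (a, b) \<notin> E \<and> (b, a) \<notin> E"
    and st: "core_state (weighted_adj d E) V a b y ya yb yab yd"
  defines "p \<equiv> pathpoly z (length xs + 2)" and "p' \<equiv> pathpoly z (length xs + 1)" and "p'' \<equiv> pathpoly z (length xs)"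
  shows "core_state (weighted_adj d (E \<union> walk_edges (a # xs @ [b]))) (set xs \<union> V) a b
    (p * y + p' * (ya + yb) + p'' * yab + 2 * yd) (p * ya + p' * yab) (p * yb + p' * yab) (p * yab) (p * yd + yab)"
proof -
  let ?M = "weighted_adj d (E \<union> walk_edges (a # xs @ [b]))"
  have s: "set xs \<union> V - {a} = set xs \<union> (V - {a})" "set xs \<union> V - {b} = set xs \<union> (V - {b})"
    "set xs \<union> (V - {a}) - {b} = set xs \<union> (V - {a} - {b})"
    "V - {b} - {a} = V - {a} - {b}"
    using V xs by auto
  have [simp]: "b \<noteq> a" using V by simp
  have c: "xs = [] \<longrightarrow> a \<noteq> b \<and> (a, b) \<notin> E \<and> (b, a) \<notin> E" "a = b \<longrightarrow> length xs \<noteq> 1"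
    using xs V by auto
  note path = pm_add_path[OF V(1-4) xs(1,2) _ _ xs(3) c]
  note st = st[unfolded core_state_def]
  show ?thesis
    unfolding core_state_def s p_def p'_def p''_def
    using V xs st
    by (simp add: path s algebra_simps Diff_subset[THEN subset_trans] del: pathpoly.simps)
qed

text \<open>The factor \<open>c\<close> collects the two transpositions of \<open>a\<close> with an
  end of \<open>xs\<close> and the two orientations of the new cycle.\<close>

lemma core_state_add_closed_path:
  fixes d :: "'a \<Rightarrow> 'r::comm_ring_1"
  assumes V: "finite V" "E \<subseteq> V \<times> V" "a \<in> V" "b \<in> V" "a \<noteq> b"
    and xs: "distinct xs" "set xs \<inter> V = {}" "\<forall>x\<in>set xs. d x = z" "length xs \<ge> 2"
    and st: "core_state (weighted_adj d E) V a b y ya yb yab yd"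
  defines "p \<equiv> pathpoly z (length xs + 2)" and "c \<equiv> 2 * (pathpoly z (length xs + 1) + 1)"
  shows "core_state (weighted_adj d (E \<union> walk_edges (a # xs @ [a]))) (set xs \<union> V) a b
    (p * y + c * ya) (p * ya) (p * yb + c * yab) (p * yab) (p * yd)"
proof -
  have s: "set xs \<union> V - {a} = set xs \<union> (V - {a})" "set xs \<union> V - {b} = set xs \<union> (V - {b})"
    "set xs \<union> (V - {a}) - {b} = set xs \<union> (V - {a} - {b})"
    "V - {b} - {a} = V - {a} - {b}"
    using V xs by auto
  have [simp]: "b \<noteq> a" "xs \<noteq> []" "length xs \<noteq> Suc 0" using V xs by auto
  have c: "xs = [] \<longrightarrow> a \<noteq> a \<and> (a, a) \<notin> E \<and> (a, a) \<notin> E" "a = a \<longrightarrow> length xs \<noteq> 1"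
    by simp_all
  note path = pm_add_path[OF V(1-3) V(3) xs(1,2) _ _ xs(3) c]
  note st = st[unfolded core_state_def]
  show ?thesis
    unfolding core_state_def s p_def c_def
    using V xs st
    by (simp add: path s algebra_simps Diff_subset[THEN subset_trans] del: pathpoly.simps)
qed

lemma core_state_sym: "core_state M V a b y ya yb yab yd \<Longrightarrow> core_state M V b a y yb ya yab yd"
proof -
  have "V - {b} - {a} = V - {a} - {b}" by auto
  then show "core_state M V a b y ya yb yab yd \<Longrightarrow> core_state M V b a y yb ya yab yd"
    by (simp add: core_state_def)
qed

text \<open>The permanent of a cycle on \<open>n\<close> vertices, by the role of one chosen vertex:
  fixed, exchanged with one of two neighbours, or moved along the whole cycle in one of two
  directions.\<close>

definition cyclepoly :: "'r::comm_ring_1 \<Rightarrow> nat \<Rightarrow> 'r" where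
  "cyclepoly z n = z * pathpoly z (n + 1) + 2 * pathpoly z n + 2"

text \<open>A walk traced from any vertex \<open>c\<close> with \<open>S = {c}\<close> closes up to
  one cycle and exhausts the edges at \<open>c\<close>; removing it leaves a 2-regular
  graph.\<close>

lemma pm_regular:
  fixes d :: "'a \<Rightarrow> 'r::comm_ring_1"
  assumes "edges_on W E" "\<And>w. w \<in> W \<Longrightarrow> deg E w = 2" "\<And>w. w \<in> W \<Longrightarrow> d w = z"
  obtains ks where "\<And>k. k \<in> set ks \<Longrightarrow> k \<ge> 3" "sum_list ks = card W"
    "pm (weighted_adj d E) W W = prod_list (map (cyclepoly z) ks)"
  using assms
proof (induction "card W" arbitrary: W E thesis rule: less_induct)
  case less
  show ?case
  proof (cases "W = {}")
    case True
    then show ?thesis using less.prems(1)[of "[]"] by simp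
  next
    case False
    then obtain c where c: "c \<in> W" by auto
    have fin: "finite W" using less.prems(2) by (simp add: edges_on_def)
    have pos: "deg E c > 0" and sub: "{c} \<subseteq> W" using less.prems(3)[OF c] c by auto
    obtain xs v E0 where xs: "distinct xs" "set xs \<subseteq> W - {c}" "v \<in> {c}" "edges_on (W - set xs) E0"
      "E = E0 \<union> walk_edges (c # xs @ [v])" "c = v \<Longrightarrow> length xs \<ge> 2" "(c, v) \<in> E0 \<Longrightarrow> xs \<noteq> []"
      and degE: "\<And>w. w \<in> W - set xs \<Longrightarrow> deg E w = deg E0 w + (if w = c then 1 else 0) + (if w = v then 1 else 0)"
      by (rule trace_path[OF less.prems(2) sub _ _ pos]) (use less.prems(3) in auto)
    have v: "v = c" using xs by simp
    define W' where "W' = W - set xs - {c}"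
    have W: "W - set xs = insert c W'" "c \<notin> W'" using c xs by (auto simp: W'_def)
    have "deg E0 c = 0" using degE[of c] v c xs less.prems(3)[OF c] by auto
    then have E0: "edges_on W' E0" unfolding W'_def by (rule edges_on_isolated[OF xs(4)])
    then have E0': "E0 \<subseteq> W' \<times> W'" "finite W'" by (auto simp: edges_on_def)
    have deg2: "deg E0 w = 2" if "w \<in> W'" for w
      using that degE[of w] less.prems(3)[of w] v by (auto simp: W'_def)
    have cardW: "card W = length xs + 1 + card W'"
    proof -
      have "W = set xs \<union> insert c W'" using W xs by auto
      moreover have "set xs \<inter> insert c W' = {}" using xs by (auto simp: W'_def)
      ultimately have "card W = card (set xs) + card (insert c W')"
        using E0' by (metis card_Un_disjoint finite_insert finite_set)
      then show ?thesis using W E0' xs(1) by (simp add: distinct_card)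
    qed
    then have "card W' < card W" by simp
    then obtain ks where ks: "\<And>k. k \<in> set ks \<Longrightarrow> k \<ge> 3" "sum_list ks = card W'"
      "pm (weighted_adj d E0) W' W' = prod_list (map (cyclepoly z) ks)"
      using less.hyps[OF _ _ E0 deg2] less.prems(4) by (auto simp: W'_def)
    have len: "length xs \<ge> 2" using xs v by simp
    have WW: "W = set xs \<union> insert c W'" "insert c W' - {c} = W'" using W xs by auto
    have dis: "set xs \<inter> insert c W' = {}" using xs by (auto simp: W'_def)
    have E0'': "E0 \<subseteq> insert c W' \<times> insert c W'" "finite (insert c W')" using E0' by auto
    have dxs: "\<forall>x\<in>set xs. d x = z" using less.prems(4) xs by auto
    have "pm (weighted_adj d E) W W = pathpoly z (length xs + 2) * pm (weighted_adj d E0) (insert c W') (insert c W')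
        + 2 * (pathpoly z (length xs + 1) + 1) * pm (weighted_adj d E0) W' W'"
      unfolding xs(5) v WW(1)
      by (subst pm_add_path[OF E0''(2,1) _ _ xs(1) dis _ _ dxs])
         (use len W(2) in \<open>auto simp: algebra_simps\<close>)
    also have "pm (weighted_adj d E0) (insert c W') (insert c W') = z * pm (weighted_adj d E0) W' W'"
      using pm_isolated(1)[OF E0'(2,2) W(2,2) E0'(1) W(2), of d] less.prems(4)[OF c] by simp
    finally have "pm (weighted_adj d E) W W = cyclepoly z (length xs + 1) * prod_list (map (cyclepoly z) ks)"
      by (simp add: cyclepoly_def ks(3) algebra_simps)
    then show ?thesis
      using ks(1,2) cardW len by (intro less.prems(1)[of "(length xs + 1) # ks"]) auto
  qed
qed

text \<open>The cycle of \<open>cyclepoly\<close> with diagonal entry \<open>z + 1\<close> at the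
  vertex of degree three where the path is attached.\<close>

definition looped_cyclepoly :: "'r::comm_ring_1 \<Rightarrow> nat \<Rightarrow> 'r" where
  "looped_cyclepoly z p = (z + 1) * pathpoly z (p + 1) + 2 * pathpoly z p + 2"

text \<open>The path \<open>P\<^sub>r\<close> has \<open>r - 2\<close> inner vertices; the truncated subtraction is harmless since only
  \<open>r \<ge> 2\<close> occurs. The parameters of \<open>thetapoly\<close> are the numbers of inner vertices of the three paths.\<close>

definition dumbbellpoly :: "'r::comm_ring_1 \<Rightarrow> nat \<Rightarrow> nat \<Rightarrow> nat \<Rightarrow> 'r" where
  "dumbbellpoly z p q r =
     looped_cyclepoly z p * looped_cyclepoly z q * pathpoly z r
     + (looped_cyclepoly z p * pathpoly z (q + 1) + pathpoly z (p + 1) * looped_cyclepoly z q) * pathpoly z (r - 1)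
     + pathpoly z (p + 1) * pathpoly z (q + 1) * pathpoly z (r - 2)"

definition thetapoly :: "'r::comm_ring_1 \<Rightarrow> nat \<Rightarrow> nat \<Rightarrow> nat \<Rightarrow> 'r" where
  "thetapoly z i j k = (let f = pathpoly z in
     (z + 1)^2 * f (i + 2) * f (j + 2) * f (k + 2)
     + 2 * (z + 1) * (f (i + 1) * f (j + 2) * f (k + 2) + f (i + 2) * f (j + 1) * f (k + 2) + f (i + 2) * f (j + 2) * f (k + 1))
     + 2 * (f (i + 1) * f (j + 1) * f (k + 2) + f (i + 1) * f (j + 2) * f (k + 1) + f (i + 2) * f (j + 1) * f (k + 1))
     + (f i * f (j + 2) * f (k + 2) + f (i + 2) * f j * f (k + 2) + f (i + 2) * f (j + 2) * f k)
     + 2 * (f (i + 2) + f (j + 2) + f (k + 2)))"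

section \<open>Evaluation on graphs with two cubic vertices\<close>

lemma core_add_walk:
  assumes "finite V" "E \<subseteq> V \<times> V" "u \<in> V" "v \<in> V"
  shows "finite (set xs \<union> V)" "E \<union> walk_edges (u # xs @ [v]) \<subseteq> (set xs \<union> V) \<times> (set xs \<union> V)"
proof -
  have "walk_edges (u # xs @ [v]) \<subseteq> set (u # xs @ [v]) \<times> set (u # xs @ [v])"
    by (rule walk_edges_subset)
  also have "\<dots> \<subseteq> (set xs \<union> V) \<times> (set xs \<union> V)" using assms by auto
  finally show "E \<union> walk_edges (u # xs @ [v]) \<subseteq> (set xs \<union> V) \<times> (set xs \<union> V)"
    using assms by blast
qed (use assms in simp)

text \<open>Lets a later walk of a theta graph be the single edge between the cubic
  vertices.\<close>

lemma not_in_walk_edges: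
  assumes "us \<noteq> []" "a \<notin> set us" "b \<notin> set us" "a \<noteq> b"
  shows "(a, b) \<notin> walk_edges (a # us @ [b])" "(b, a) \<notin> walk_edges (a # us @ [b])"
proof -
  obtain u us' where us: "us = u # us'" using assms by (cases us) auto
  have "walk_edges (u # us' @ [b]) \<subseteq> set (u # us' @ [b]) \<times> set (u # us' @ [b])"
    by (rule walk_edges_subset)
  then have "(a, b) \<notin> walk_edges (u # us' @ [b])" "(b, a) \<notin> walk_edges (u # us' @ [b])"
    using assms us by auto
  then show "(a, b) \<notin> walk_edges (a # us @ [b])" "(b, a) \<notin> walk_edges (a # us @ [b])"
    using assms us by auto
qed

lemma pm_dumbbell_with_cycles:
  fixes d :: "'a \<Rightarrow> 'r::comm_ring_1"
  assumes D: "dumbbell_with_cycles V E a b A R B W E0"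
    and d: "d a = z + 1" "d b = z + 1" "\<And>w. w \<in> V - {a, b} \<Longrightarrow> d w = z"
  shows "pm (weighted_adj d E) V V =
    dumbbellpoly z (length A + 1) (length B + 1) (length R + 2) * pm (weighted_adj d E0) W W"
proof -
  have dist: "distinct A" "distinct R" "distinct B" "a \<noteq> b" "b \<noteq> a" "a \<notin> W" "b \<notin> W"
    and disj: "set A \<inter> ({a, b} \<union> set R \<union> W) = {}" "set R \<inter> ({a, b} \<union> W) = {}"
      "set B \<inter> ({a, b} \<union> set R \<union> set A \<union> W) = {}"
    and V: "V = set B \<union> (set A \<union> (set R \<union> (insert a (insert b W))))"
    and E: "E = E0 \<union> walk_edges (a # R @ [b]) \<union> walk_edges (a # A @ [a]) \<union> walk_edges (b # B @ [b])"
    and W: "finite W" "E0 \<subseteq> W \<times> W" and len: "length A \<ge> 2" "length B \<ge> 2"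
    using D by (auto simp: dumbbell_with_cycles_def edges_on_def)
  have dz: "\<forall>x\<in>set R. d x = z" "\<forall>x\<in>set A. d x = z" "\<forall>x\<in>set B. d x = z"
    using disj d(3) unfolding V by blast+
  let ?V0 = "insert a (insert b W)"
  have 0: "core_state (weighted_adj d E0) ?V0 a b ((z + 1) * (z + 1) * pm (weighted_adj d E0) W W)
      ((z + 1) * pm (weighted_adj d E0) W W) ((z + 1) * pm (weighted_adj d E0) W W) (pm (weighted_adj d E0) W W) 0"
    using core_state_isolated[OF W dist(6,7,4), of d] d by simp
  have V0: "finite ?V0" "E0 \<subseteq> ?V0 \<times> ?V0" "a \<in> ?V0" "b \<in> ?V0" using W by auto
  have nE: "R = [] \<longrightarrow> (a, b) \<notin> E0 \<and> (b, a) \<notin> E0" using W dist by auto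
  have dR: "set R \<inter> ?V0 = {}" using disj by auto
  note 1 = core_state_add_path[OF V0 dist(4,2) dR dz(1) nE 0]
  note V1 = core_add_walk[OF V0, of R]
  have ab1: "a \<in> set R \<union> ?V0" "b \<in> set R \<union> ?V0" by auto
  have dA: "set A \<inter> (set R \<union> ?V0) = {}" using disj by auto
  note 2 = core_state_add_closed_path[OF V1 ab1 dist(4,1) dA dz(2) len(1) 1]
  note V2 = core_add_walk[OF V1 ab1(1,1), of A]
  have ab2: "b \<in> set A \<union> (set R \<union> ?V0)" "a \<in> set A \<union> (set R \<union> ?V0)" by auto
  have dB: "set B \<inter> (set A \<union> (set R \<union> ?V0)) = {}" using disj by auto
  note 3 = core_state_add_closed_path[OF V2 ab2 dist(5,3) dB dz(3) len(2) core_state_sym[OF 2]]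
  show ?thesis
    unfolding V E conjunct1[OF 3[unfolded core_state_def]]
    by (simp add: dumbbellpoly_def looped_cyclepoly_def algebra_simps del: pathpoly.simps)
qed

lemma pm_theta_with_cycles:
  fixes d :: "'a \<Rightarrow> 'r::comm_ring_1"
  assumes D: "theta_with_cycles V E a b xs ys zs W E0"
    and d: "d a = z + 1" "d b = z + 1" "\<And>w. w \<in> V - {a, b} \<Longrightarrow> d w = z"
  shows "pm (weighted_adj d E) V V =
    thetapoly z (length xs) (length ys) (length zs) * pm (weighted_adj d E0) W W"
proof -
  have dist: "distinct xs" "distinct ys" "distinct zs" "a \<noteq> b" "a \<notin> W" "b \<notin> W"
    and disj: "set xs \<inter> ({a, b} \<union> W) = {}" "set ys \<inter> ({a, b} \<union> set xs \<union> W) = {}"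
      "set zs \<inter> ({a, b} \<union> set xs \<union> set ys \<union> W) = {}"
    and V: "V = set zs \<union> (set ys \<union> (set xs \<union> (insert a (insert b W))))"
    and E: "E = E0 \<union> walk_edges (a # xs @ [b]) \<union> walk_edges (a # ys @ [b]) \<union> walk_edges (a # zs @ [b])"
    and W: "finite W" "E0 \<subseteq> W \<times> W"
    and ne: "xs \<noteq> [] \<or> ys \<noteq> []" "ys \<noteq> [] \<or> zs \<noteq> []" "xs \<noteq> [] \<or> zs \<noteq> []"
    using D by (auto simp: theta_with_cycles_def edges_on_def)
  have dz: "\<forall>x\<in>set xs. d x = z" "\<forall>x\<in>set ys. d x = z" "\<forall>x\<in>set zs. d x = z"
    using disj d(3) unfolding V by blast+
  let ?V0 = "insert a (insert b W)"
  have 0: "core_state (weighted_adj d E0) ?V0 a b ((z + 1) * (z + 1) * pm (weighted_adj d E0) W W)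
      ((z + 1) * pm (weighted_adj d E0) W W) ((z + 1) * pm (weighted_adj d E0) W W) (pm (weighted_adj d E0) W W) 0"
    using core_state_isolated[OF W dist(5,6,4), of d] d by simp
  have V0: "finite ?V0" "E0 \<subseteq> ?V0 \<times> ?V0" "a \<in> ?V0" "b \<in> ?V0" using W by auto
  have nE0: "(a, b) \<notin> E0" "(b, a) \<notin> E0" using W dist by auto
  have nx: "xs = [] \<longrightarrow> (a, b) \<notin> E0 \<and> (b, a) \<notin> E0" using nE0 by simp
  have nW: "us \<noteq> [] \<Longrightarrow> (a, b) \<notin> walk_edges (a # us @ [b]) \<and> (b, a) \<notin> walk_edges (a # us @ [b])"
    if "set us \<inter> {a, b} = {}" for us
    using not_in_walk_edges[of us a b] that dist by auto
  have ux: "set xs \<inter> {a, b} = {}" and uy: "set ys \<inter> {a, b} = {}" using disj by auto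
  have ny: "ys = [] \<longrightarrow> (a, b) \<notin> E0 \<union> walk_edges (a # xs @ [b]) \<and> (b, a) \<notin> E0 \<union> walk_edges (a # xs @ [b])"
    using nE0 ne nW[OF ux] by blast
  have nz: "zs = [] \<longrightarrow> (a, b) \<notin> E0 \<union> walk_edges (a # xs @ [b]) \<union> walk_edges (a # ys @ [b]) \<and>
      (b, a) \<notin> E0 \<union> walk_edges (a # xs @ [b]) \<union> walk_edges (a # ys @ [b])"
    using nE0 ne nW[OF ux] nW[OF uy] by blast
  have dx: "set xs \<inter> ?V0 = {}" using disj by auto
  note 1 = core_state_add_path[OF V0 dist(4,1) dx dz(1) nx 0]
  note V1 = core_add_walk[OF V0, of xs]
  have ab1: "a \<in> set xs \<union> ?V0" "b \<in> set xs \<union> ?V0" by auto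
  have dy: "set ys \<inter> (set xs \<union> ?V0) = {}" using disj by auto
  note 2 = core_state_add_path[OF V1 ab1 dist(4,2) dy dz(2) ny 1]
  note V2 = core_add_walk[OF V1 ab1, of ys]
  have ab2: "a \<in> set ys \<union> (set xs \<union> ?V0)" "b \<in> set ys \<union> (set xs \<union> ?V0)" by auto
  have dzs: "set zs \<inter> (set ys \<union> (set xs \<union> ?V0)) = {}" using disj by auto
  note 3 = core_state_add_path[OF V2 ab2 dist(4,3) dzs dz(3) nz 2]
  show ?thesis
    unfolding V E conjunct1[OF 3[unfolded core_state_def]]
    by (simp add: thetapoly_def Let_def algebra_simps power2_eq_square del: pathpoly.simps)
qed

section \<open>Substituting a difference of reciprocals\<close>

text \<open>With t = 1/s this is s^k (t^k + (-s)^k + 2): the two characteristic roots and the two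
  orientations of the cycle.\<close>

definition cycle_series :: "'r::comm_ring_1 \<Rightarrow> nat \<Rightarrow> 'r" where
  "cycle_series s k = 1 + 2 * s ^ k + (-1) ^ k * s ^ (2 * k)"

text \<open>For t = 1/s the path recursion is solved by t^k and (-s)^k. Up to scaling,
  \<open>loop_u\<close> and \<open>loop_v\<close> are the components of a looped cycle along these
  two solutions; in that basis the path acts diagonally, whence the two products in
  \<open>dumbbell_series\<close>.\<close>

definition loop_u :: "'r::comm_ring_1 \<Rightarrow> nat \<Rightarrow> 'r" where
  "loop_u s p = 1 + s + 2 * s\<^sup>2 + 2 * (1 + s\<^sup>2) * s ^ p + (-1) ^ p * (1 - s) * s ^ (2 * p)"

definition loop_v :: "'r::comm_ring_1 \<Rightarrow> nat \<Rightarrow> 'r" where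
  "loop_v s p = s * (1 + s) + 2 * (1 + s\<^sup>2) * s ^ p + (-1) ^ p * (2 - s + s\<^sup>2) * s ^ (2 * p)"

definition dumbbell_series :: "'r::comm_ring_1 \<Rightarrow> nat \<Rightarrow> nat \<Rightarrow> nat \<Rightarrow> 'r" where
  "dumbbell_series s p q r =
     loop_u s p * loop_u s q + (-1) ^ r * s ^ (2 * r - 2) * loop_v s p * loop_v s q"

text \<open>The value \<open>h i\<close> is, up to sign, the ratio of the two geometric solutions
  along a path with \<open>i\<close> inner vertices. The mixed powers in the last line come from
  permutations running around a cycle through both cubic vertices.\<close>

definition theta_series :: "'r::comm_ring_1 \<Rightarrow> nat \<Rightarrow> nat \<Rightarrow> nat \<Rightarrow> 'r" where
  "theta_series s i j k = (let h = \<lambda>i. (-1) ^ Suc i * s ^ (2 * i) in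
     (1 + s + 2 * s\<^sup>2)\<^sup>2 - s ^ 4 * (1 + s)\<^sup>2 * (h i + h j + h k)
     + s ^ 4 * (1 - s)\<^sup>2 * (h i * h j + h i * h k + h j * h k)
     - s ^ 6 * (2 - s + s\<^sup>2)\<^sup>2 * h i * h j * h k
     + 2 * (1 + s\<^sup>2)\<^sup>2 * s\<^sup>2 * (s ^ (i + j) * (1 - s\<^sup>2 * h k) + s ^ (i + k) * (1 - s\<^sup>2 * h j) + s ^ (j + k) * (1 - s\<^sup>2 * h i)))"

section \<open>Scaled permanents as geometric sums\<close>

context
  fixes s t z w :: "'r::idom"
  assumes ts: "t * s = 1"
  defines "z \<equiv> t - s" and "w \<equiv> 1 + s\<^sup>2"
begin

lemma sz: "s * z = 1 - s\<^sup>2"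
  using ts by (simp add: z_def algebra_simps power2_eq_square)

lemma cancel_s: "s * x = s * y \<Longrightarrow> x = y"
  using ts by (metis mult.assoc mult.left_neutral)

text \<open>The roots of x^2 = z x + 1 are t and -s. The factor w = s (t + s) is s times their
  difference and clears the denominator of the two-term formula; s^k clears the negative
  powers.\<close>

lemma scaled_pathpoly: "w * s ^ k * pathpoly z k = s\<^sup>2 + (-1) ^ k * s ^ (2 * k)"
proof (induction k rule: induct_nat_012)
  case (ge2 k)
  have "w * s ^ Suc (Suc k) * pathpoly z (Suc (Suc k)) =
    (s * z) * (w * s ^ Suc k * pathpoly z (Suc k)) + s\<^sup>2 * (w * s ^ k * pathpoly z k)"
    by (simp add: algebra_simps power2_eq_square)
  also have "\<dots> = (1 - s\<^sup>2) * (s\<^sup>2 + (-1) ^ Suc k * s ^ (2 * Suc k)) + s\<^sup>2 * (s\<^sup>2 + (-1) ^ k * s ^ (2 * k))"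
    by (simp only: ge2 sz)
  also have "\<dots> = s\<^sup>2 + (-1) ^ Suc (Suc k) * s ^ (2 * Suc (Suc k))"
    by (simp add: algebra_simps power2_eq_square)
  finally show ?case .
qed (auto simp: w_def power2_eq_square)

lemma scaled_pathpoly1: "w * s ^ k * pathpoly z (k + 1) = s - (-1) ^ k * s * (s ^ k)\<^sup>2"
proof (rule cancel_s)
  show "s * (w * s ^ k * pathpoly z (k + 1)) = s * (s - (-1) ^ k * s * (s ^ k)\<^sup>2)"
    using scaled_pathpoly[of "k + 1"]
    by (simp add: algebra_simps power2_eq_square power_add mult_2_right mult_2 del: pathpoly.simps)
qed

lemma scaled_pathpoly0: "w * s ^ k * pathpoly z k = s\<^sup>2 + (-1) ^ k * (s ^ k)\<^sup>2"
  using scaled_pathpoly[of k] by (simp add: power_mult[symmetric] mult.commute)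

lemma scaled_pathpoly2: "w * s ^ k * pathpoly z (k + 2) = 1 + (-1) ^ k * s\<^sup>2 * (s ^ k)\<^sup>2"
proof (rule cancel_s, rule cancel_s)
  show "s * (s * (w * s ^ k * pathpoly z (k + 2))) = s * (s * (1 + (-1) ^ k * s\<^sup>2 * (s ^ k)\<^sup>2))"
    using scaled_pathpoly[of "k + 2"]
    by (simp add: algebra_simps power2_eq_square power_add mult_2_right mult_2 del: pathpoly.simps)
qed

lemma scaled_cyclepoly:
  assumes "w \<noteq> 0"
  shows "s ^ k * cyclepoly z k = cycle_series s k"
proof -
  have ring: "w * (x * (z * f1 + 2 * f0 + 2)) = z * (w * x * f1) + 2 * (w * x * f0) + 2 * w * x" for x f0 f1
    by algebra
  have "w * (s ^ k * cyclepoly z k) =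
      z * (s - (-1) ^ k * s * (s ^ k)\<^sup>2) + 2 * (s\<^sup>2 + (-1) ^ k * (s ^ k)\<^sup>2) + 2 * w * s ^ k"
    unfolding cyclepoly_def ring scaled_pathpoly0 scaled_pathpoly1 ..
  also have "\<dots> = (s * z) * (1 - (-1) ^ k * (s ^ k)\<^sup>2) + 2 * (s\<^sup>2 + (-1) ^ k * (s ^ k)\<^sup>2) + 2 * w * s ^ k"
    by algebra
  also have "\<dots> = w * cycle_series s k"
    unfolding sz w_def cycle_series_def mult_2[of k] power_add by algebra
  finally show ?thesis using assms by simp
qed

lemma scaled_looped_cyclepoly:
  "w * s ^ p * looped_cyclepoly z p = (1 + s + s\<^sup>2) + 2 * w * s ^ p + (-1) ^ p * (1 - s + s\<^sup>2) * (s ^ p)\<^sup>2"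
proof -
  have ring: "w * x * ((z + 1) * f1 + 2 * f0 + 2) = (z + 1) * (w * x * f1) + 2 * (w * x * f0) + 2 * w * x" for x f0 f1
    by algebra
  have "w * s ^ p * looped_cyclepoly z p =
      (z + 1) * (s - (-1) ^ p * s * (s ^ p)\<^sup>2) + 2 * (s\<^sup>2 + (-1) ^ p * (s ^ p)\<^sup>2) + 2 * w * s ^ p"
    unfolding looped_cyclepoly_def ring scaled_pathpoly0 scaled_pathpoly1 ..
  also have "\<dots> = (s * z + s) * (1 - (-1) ^ p * (s ^ p)\<^sup>2) + 2 * (s\<^sup>2 + (-1) ^ p * (s ^ p)\<^sup>2) + 2 * w * s ^ p"
    by algebra
  also have "\<dots> = (1 + s + s\<^sup>2) + 2 * w * s ^ p + (-1) ^ p * (1 - s + s\<^sup>2) * (s ^ p)\<^sup>2"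
    unfolding sz by algebra
  finally show ?thesis .
qed

text \<open>As r = k + 2, the exponent of \<open>s\<close> is the number of vertices. Theta graphs
  get the same factor w^3 and a power of \<open>s\<close> by the same rule, so graphs of equal order
  remain comparable after scaling.\<close>

lemma scaled_dumbbellpoly:
  "w ^ 3 * s ^ (p + q + k) * dumbbellpoly z p q (k + 2) = dumbbell_series s p q (k + 2)"
proof -
  define a b e f where "a = s ^ p" and "b = s ^ q" and "e = ((-1) ^ p :: 'r)" and "f = ((-1) ^ q :: 'r)"
  define c g where "c = s ^ k" and "g = ((-1) ^ k :: 'r)"
  define C where "C = (\<lambda>(a::'r) e. (1 + s + s\<^sup>2) + 2 * w * a + e * (1 - s + s\<^sup>2) * a\<^sup>2)"
  define Y where "Y = (\<lambda>(a::'r) e. s - e * s * a\<^sup>2)"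
  have ring: "w ^ 3 * (x * y * v) * (A * B * f2 + (A * b1 + a1 * B) * f1 + a1 * b1 * f0) =
      (w * x * A) * (w * y * B) * (w * v * f2) + ((w * x * A) * (w * y * b1) + (w * x * a1) * (w * y * B)) * (w * v * f1)
      + (w * x * a1) * (w * y * b1) * (w * v * f0)" for x y v A B a1 b1 f0 f1 f2
    by algebra
  \<comment> \<open>A bilinear form in (A, a1) and (B, b1) becomes a sum of two products: the path
    between the cycles is diagonalised into its two geometric components.\<close>
  have ring': "A * B * (1 + g * s\<^sup>2 * c\<^sup>2) + (A * b1 + a1 * B) * (s - g * s * c\<^sup>2) + a1 * b1 * (s\<^sup>2 + g * c\<^sup>2) =
      (A + s * a1) * (B + s * b1) + g * c\<^sup>2 * (s * A - a1) * (s * B - b1)" for A B a1 b1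
    by algebra
  have CY: "w * s ^ p * looped_cyclepoly z p = C a e" "w * s ^ q * looped_cyclepoly z q = C b f"
    "w * s ^ p * pathpoly z (p + 1) = Y a e" "w * s ^ q * pathpoly z (q + 1) = Y b f"
    by (simp_all only: scaled_looped_cyclepoly scaled_pathpoly1 C_def Y_def a_def b_def e_def f_def)
  have G: "w * s ^ k * pathpoly z (k + 2) = 1 + g * s\<^sup>2 * c\<^sup>2" "w * s ^ k * pathpoly z (k + 1) = s - g * s * c\<^sup>2"
    "w * s ^ k * pathpoly z k = s\<^sup>2 + g * c\<^sup>2"
    by (simp_all only: scaled_pathpoly0 scaled_pathpoly1 scaled_pathpoly2 c_def g_def)
  have "dumbbellpoly z p q (k + 2) = looped_cyclepoly z p * looped_cyclepoly z q * pathpoly z (k + 2)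
     + (looped_cyclepoly z p * pathpoly z (q + 1) + pathpoly z (p + 1) * looped_cyclepoly z q) * pathpoly z (k + 1)
     + pathpoly z (p + 1) * pathpoly z (q + 1) * pathpoly z k"
    by (simp add: dumbbellpoly_def del: pathpoly.simps)
  then have "w ^ 3 * s ^ (p + q + k) * dumbbellpoly z p q (k + 2) =
      (C a e + s * Y a e) * (C b f + s * Y b f) + g * c\<^sup>2 * (s * C a e - Y a e) * (s * C b f - Y b f)"
    unfolding power_add by (simp only: ring CY G ring')
  moreover have "C a e + s * Y a e = loop_u s p" "C b f + s * Y b f = loop_u s q"
    unfolding C_def Y_def loop_u_def w_def a_def b_def e_def f_def mult_2[of p] mult_2[of q] power_add by algebra+
  moreover have "s * C a e - Y a e = s * loop_v s p" "s * C b f - Y b f = s * loop_v s q"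
    unfolding C_def Y_def loop_v_def w_def a_def b_def e_def f_def mult_2[of p] mult_2[of q] power_add by algebra+
  moreover have "dumbbell_series s p q (k + 2) =
      loop_u s p * loop_u s q + g * c\<^sup>2 * (s * loop_v s p) * (s * loop_v s q)"
  proof -
    have "(-1) ^ (k + 2) * s ^ (2 * (k + 2) - 2) = g * c\<^sup>2 * s * s"
      by (simp add: c_def g_def power2_eq_square power_add mult_2)
    then show ?thesis unfolding dumbbell_series_def by (simp only: mult.assoc) (simp only: mult.left_commute)
  qed
  ultimately show ?thesis by simp
qed

text \<open>The left-hand side consists of the summands of \<open>thetapoly\<close> other than its
  last one, after scaling, with \<open>\<kappa>\<close> standing for s (z + 1). The right-hand side
  regroups them by elementary symmetric functions.\<close>

lemma theta_identity:
  fixes x y v :: 'r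
  defines "\<kappa> \<equiv> 1 + s - s\<^sup>2"
  defines "F \<equiv> \<lambda>h. 1 - s\<^sup>2 * h" and "F1 \<equiv> \<lambda>h. 1 + h" and "F0 \<equiv> \<lambda>h. s\<^sup>2 - h"
  shows "\<kappa>\<^sup>2 * F x * F y * F v + 2 * \<kappa> * s\<^sup>2 * (F1 x * F y * F v + F x * F1 y * F v + F x * F y * F1 v)
     + 2 * s ^ 4 * (F1 x * F1 y * F v + F1 x * F y * F1 v + F x * F1 y * F1 v)
     + s\<^sup>2 * (F0 x * F y * F v + F x * F0 y * F v + F x * F y * F0 v) =
     (1 + s + 2 * s\<^sup>2)\<^sup>2 - s ^ 4 * (1 + s)\<^sup>2 * (x + y + v) + s ^ 4 * (1 - s)\<^sup>2 * (x * y + x * v + y * v)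
     - s ^ 6 * (2 - s + s\<^sup>2)\<^sup>2 * x * y * v"
  unfolding F_def F1_def F0_def \<kappa>_def by algebra

lemma scaled_thetapoly:
  "w ^ 3 * s ^ (i + j + k + 2) * thetapoly z i j k = theta_series s i j k"
proof -
  define h :: "nat \<Rightarrow> 'r" where "h = (\<lambda>i. (-1) ^ Suc i * s ^ (2 * i))"
  define F F1 F0 where "F = (\<lambda>h. 1 - s\<^sup>2 * h)" and "F1 = (\<lambda>h. 1 + h :: 'r)" and "F0 = (\<lambda>h. s\<^sup>2 - h)"
  have f: "w * s ^ i * pathpoly z (i + 2) = F (h i)" "w * s ^ i * pathpoly z (i + 1) = s * F1 (h i)"
    "w * s ^ i * pathpoly z i = F0 (h i)" for i
    using scaled_pathpoly0[of i] scaled_pathpoly1[of i] scaled_pathpoly2[of i]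
    by (simp_all add: F_def F1_def F0_def h_def algebra_simps power_add power2_eq_square mult_2 mult_2_right del: pathpoly.simps)
  have ring: "w ^ 3 * (x * y * v * s\<^sup>2) *
     ((z + 1)\<^sup>2 * a2 * b2 * c2 + 2 * (z + 1) * (a1 * b2 * c2 + a2 * b1 * c2 + a2 * b2 * c1)
     + 2 * (a1 * b1 * c2 + a1 * b2 * c1 + a2 * b1 * c1) + (a0 * b2 * c2 + a2 * b0 * c2 + a2 * b2 * c0) + 2 * (a2 + b2 + c2)) =
     (s * z + s)\<^sup>2 * (w * x * a2) * (w * y * b2) * (w * v * c2)
    + 2 * (s * z + s) * s * ((w * x * a1) * (w * y * b2) * (w * v * c2) + (w * x * a2) * (w * y * b1) * (w * v * c2) + (w * x * a2) * (w * y * b2) * (w * v * c1))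
    + s\<^sup>2 * 2 * ((w * x * a1) * (w * y * b1) * (w * v * c2) + (w * x * a1) * (w * y * b2) * (w * v * c1) + (w * x * a2) * (w * y * b1) * (w * v * c1))
    + s\<^sup>2 * ((w * x * a0) * (w * y * b2) * (w * v * c2) + (w * x * a2) * (w * y * b0) * (w * v * c2) + (w * x * a2) * (w * y * b2) * (w * v * c0))
    + 2 * w\<^sup>2 * s\<^sup>2 * (x * y * (w * v * c2) + x * v * (w * y * b2) + y * v * (w * x * a2))"
    for x y v a0 a1 a2 b0 b1 b2 c0 c1 c2
    by algebra
  have ring': "K\<^sup>2 * a2 * b2 * c2
    + 2 * K * s * ((s * a1) * b2 * c2 + a2 * (s * b1) * c2 + a2 * b2 * (s * c1))
    + s\<^sup>2 * 2 * ((s * a1) * (s * b1) * c2 + (s * a1) * b2 * (s * c1) + a2 * (s * b1) * (s * c1))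
    + s\<^sup>2 * (a0 * b2 * c2 + a2 * b0 * c2 + a2 * b2 * c0) + Z =
      (K\<^sup>2 * a2 * b2 * c2 + 2 * K * s\<^sup>2 * (a1 * b2 * c2 + a2 * b1 * c2 + a2 * b2 * c1)
      + 2 * s ^ 4 * (a1 * b1 * c2 + a1 * b2 * c1 + a2 * b1 * c1)
      + s\<^sup>2 * (a0 * b2 * c2 + a2 * b0 * c2 + a2 * b2 * c0)) + Z" for K Z a0 a1 a2 b0 b1 b2 c0 c1 c2
    by algebra
  have szs: "s * z + s = 1 + s - s\<^sup>2" by (simp add: sz)
  have "thetapoly z i j k = (z + 1)\<^sup>2 * pathpoly z (i + 2) * pathpoly z (j + 2) * pathpoly z (k + 2)
     + 2 * (z + 1) * (pathpoly z (i + 1) * pathpoly z (j + 2) * pathpoly z (k + 2) + pathpoly z (i + 2) * pathpoly z (j + 1) * pathpoly z (k + 2) + pathpoly z (i + 2) * pathpoly z (j + 2) * pathpoly z (k + 1))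
     + 2 * (pathpoly z (i + 1) * pathpoly z (j + 1) * pathpoly z (k + 2) + pathpoly z (i + 1) * pathpoly z (j + 2) * pathpoly z (k + 1) + pathpoly z (i + 2) * pathpoly z (j + 1) * pathpoly z (k + 1))
     + (pathpoly z i * pathpoly z (j + 2) * pathpoly z (k + 2) + pathpoly z (i + 2) * pathpoly z j * pathpoly z (k + 2) + pathpoly z (i + 2) * pathpoly z (j + 2) * pathpoly z k)
     + 2 * (pathpoly z (i + 2) + pathpoly z (j + 2) + pathpoly z (k + 2))"
    by (simp only: thetapoly_def Let_def)
  then have "w ^ 3 * s ^ (i + j + k + 2) * thetapoly z i j k =
      ((1 + s - s\<^sup>2)\<^sup>2 * F (h i) * F (h j) * F (h k)
    + 2 * (1 + s - s\<^sup>2) * s\<^sup>2 * (F1 (h i) * F (h j) * F (h k) + F (h i) * F1 (h j) * F (h k) + F (h i) * F (h j) * F1 (h k))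
    + 2 * s ^ 4 * (F1 (h i) * F1 (h j) * F (h k) + F1 (h i) * F (h j) * F1 (h k) + F (h i) * F1 (h j) * F1 (h k))
    + s\<^sup>2 * (F0 (h i) * F (h j) * F (h k) + F (h i) * F0 (h j) * F (h k) + F (h i) * F (h j) * F0 (h k)))
    + 2 * w\<^sup>2 * s\<^sup>2 * (s ^ i * s ^ j * F (h k) + s ^ i * s ^ k * F (h j) + s ^ j * s ^ k * F (h i))"
    unfolding power_add by (simp only: ring f szs ring')
  then show ?thesis
    unfolding F_def F1_def F0_def theta_identity
    by (simp only: theta_series_def Let_def h_def w_def power_add)
qed

lemma prod_list_scaled_cyclepoly:
  assumes "w \<noteq> 0"
  shows "s ^ sum_list ks * prod_list (map (cyclepoly z) ks) = prod_list (map (cycle_series s) ks)"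
  by (induction ks) (simp_all add: scaled_cyclepoly[OF assms, symmetric] power_add algebra_simps)

end

section \<open>From Laurent series to power series\<close>

lemma fps_to_fls_prod_list: "fps_to_fls (prod_list xs) = prod_list (map fps_to_fls xs)"
  by (induction xs) (simp_all add: fls_times_fps_to_fls)

lemma fps_to_fls_series:
  fixes p q r :: nat
  shows "fps_to_fls (cycle_series (fps_X :: int fps) p) = cycle_series fls_X p"
    "fps_to_fls (dumbbell_series (fps_X :: int fps) p q r) = dumbbell_series fls_X p q r"
    "fps_to_fls (theta_series (fps_X :: int fps) p q r) = theta_series fls_X p q r"
  by (simp_all add: cycle_series_def dumbbell_series_def theta_series_def loop_u_def loop_v_def Let_def
      fls_times_fps_to_fls fps_to_fls_power)

text \<open>Laurent series supply the inverse of the variable; after scaling no negative power is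
  left and the identity descends to power series. The equation between the vertex numbers makes the
  scaling powers agree on both sides.\<close>

lemma series_eq:
  defines "z \<equiv> fls_X_inv - fls_X :: int fls"
  assumes "r \<ge> 2" "\<And>k. k \<in> set ks \<Longrightarrow> k \<ge> 3"
  shows "r' \<ge> 2 \<Longrightarrow> dumbbellpoly z p q r = dumbbellpoly z p' q' r' * prod_list (map (cyclepoly z) ks) \<Longrightarrow>
      p + q + r = p' + q' + r' + sum_list ks \<Longrightarrow>
      dumbbell_series (fps_X :: int fps) p q r = dumbbell_series fps_X p' q' r' * prod_list (map (cycle_series fps_X) ks)"
    and "dumbbellpoly z p q r = thetapoly z i j k * prod_list (map (cyclepoly z) ks) \<Longrightarrow>
      p + q + r = i + j + k + 4 + sum_list ks \<Longrightarrow>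
      dumbbell_series (fps_X :: int fps) p q r = theta_series fps_X i j k * prod_list (map (cycle_series fps_X) ks)"
proof -
  let ?s = "fls_X :: int fls" and ?t = "fls_X_inv :: int fls"
  have ts: "?t * ?s = 1" by (simp add: fls_X_inv_times_conv_shift fls_X_conv_shift_1)
  have w: "1 + ?s\<^sup>2 \<noteq> 0"
  proof
    assume "1 + ?s\<^sup>2 = 0"
    then have "fls_nth (1 + ?s\<^sup>2) 0 = 0" by simp
    then show False by (simp add: power2_eq_square)
  qed
  obtain m where m: "r = m + 2" using \<open>r \<ge> 2\<close> by (metis le_add_diff_inverse2)
  note D = scaled_dumbbellpoly[OF ts, of p q m, folded z_def m] and K = prod_list_scaled_cyclepoly[OF ts w, of ks, folded z_def]
  have series_map: "prod_list (map (cycle_series ?s) ks) = fps_to_fls (prod_list (map (cycle_series fps_X) ks))"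
    by (simp add: fps_to_fls_prod_list fps_to_fls_series o_def)
  {
    assume "r' \<ge> 2" and *: "dumbbellpoly z p q r = dumbbellpoly z p' q' r' * prod_list (map (cyclepoly z) ks)"
      and n: "p + q + r = p' + q' + r' + sum_list ks"
    obtain m' where m': "r' = m' + 2" using \<open>r' \<ge> 2\<close> by (metis le_add_diff_inverse2)
    have n': "p + q + m = (p' + q' + m') + sum_list ks" using n m m' by simp
    have "dumbbell_series ?s p q r = (1 + ?s\<^sup>2) ^ 3 * ?s ^ (p' + q' + m') * dumbbellpoly z p' q' r' *
        (?s ^ sum_list ks * prod_list (map (cyclepoly z) ks))"
      unfolding D[symmetric] * n' power_add by (simp add: algebra_simps)
    also have "\<dots> = dumbbell_series ?s p' q' r' * prod_list (map (cycle_series ?s) ks)"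
      unfolding K scaled_dumbbellpoly[OF ts, of p' q' m', folded z_def m'] ..
    finally show "dumbbell_series (fps_X :: int fps) p q r = dumbbell_series fps_X p' q' r' * prod_list (map (cycle_series fps_X) ks)"
      unfolding series_map fps_to_fls_series[symmetric] fls_times_fps_to_fls[symmetric] by (simp only: fps_to_fls_eq_iff)
  }
  {
    assume *: "dumbbellpoly z p q r = thetapoly z i j k * prod_list (map (cyclepoly z) ks)"
      and n: "p + q + r = i + j + k + 4 + sum_list ks"
    have n': "p + q + m = (i + j + k + 2) + sum_list ks" using n m by simp
    have "dumbbell_series ?s p q r = (1 + ?s\<^sup>2) ^ 3 * ?s ^ (i + j + k + 2) * thetapoly z i j k *
        (?s ^ sum_list ks * prod_list (map (cyclepoly z) ks))"
      unfolding D[symmetric] * n' power_add by (simp add: algebra_simps)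
    also have "\<dots> = theta_series ?s i j k * prod_list (map (cycle_series ?s) ks)"
      unfolding K scaled_thetapoly[OF ts, of i j k, folded z_def] ..
    finally show "dumbbell_series (fps_X :: int fps) p q r = theta_series fps_X i j k * prod_list (map (cycle_series fps_X) ks)"
      unfolding series_map fps_to_fls_series[symmetric] fls_times_fps_to_fls[symmetric] by (simp only: fps_to_fls_eq_iff)
  }
qed

section \<open>Low-order coefficients\<close>

abbreviation X :: "int fps" where "X \<equiv> fps_X"

definition psum :: "nat list \<Rightarrow> int fps" where
  "psum ks = sum_list (map (\<lambda>k. X ^ k) ks)"

lemma psum_simps [simp]: "psum [] = 0" "psum (k # ks) = X ^ k + psum ks"
  by (simp_all add: psum_def)

lemma psum_nth: "psum ks $ n = int (count_list ks n)"
  by (induction ks) auto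

section \<open>Congruence modulo a power of the variable\<close>

definition ceq :: "nat \<Rightarrow> int fps \<Rightarrow> int fps \<Rightarrow> bool" where
  "ceq N A B \<longleftrightarrow> X ^ N dvd (A - B)"

lemma ceq_nth: "ceq N A B \<Longrightarrow> n < N \<Longrightarrow> A $ n = B $ n"
proof -
  assume "ceq N A B" "n < N"
  then obtain C where "A - B = X ^ N * C" by (auto simp: ceq_def)
  then have "(A - B) $ n = 0" using \<open>n < N\<close> by (simp add: fps_X_power_mult_nth)
  then show ?thesis by simp
qed

lemma ceq_trans: "ceq N A B \<Longrightarrow> ceq N B C \<Longrightarrow> ceq N A C"
  unfolding ceq_def using dvd_add[of "X ^ N" "A - B" "B - C"] by simp

lemma ceq_mult:
  assumes "ceq N A B" "ceq N C D"
  shows "ceq N (A * C) (B * D)"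
proof -
  have "A * C - B * D = (A - B) * C + B * (C - D)" by (simp add: algebra_simps)
  then show ?thesis using assms unfolding ceq_def by (auto intro!: dvd_add)
qed

lemma X_power_dvd: "N \<le> e \<Longrightarrow> X ^ N dvd X ^ e"
  by (rule le_imp_power_dvd)

lemma dvd_psum:
  assumes "\<And>k. k \<in> set ks \<Longrightarrow> m \<le> k"
  shows "X ^ m dvd psum ks"
  using assms by (induction ks) (auto intro!: dvd_add X_power_dvd)

text \<open>Since N \<le> 2 m, products of two leading terms and the final terms of order 2 k all
  vanish modulo \<open>X ^ N\<close>.\<close>

lemma ceq_cycles:
  assumes "\<And>k. k \<in> set ks \<Longrightarrow> m \<le> k" "N \<le> 2 * m"
  shows "ceq N (prod_list (map (cycle_series X) ks)) (1 + 2 * psum ks)"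
  using assms(1)
proof (induction ks)
  case (Cons k ks)
  have "ceq N (cycle_series X k * prod_list (map (cycle_series X) ks)) (cycle_series X k * (1 + 2 * psum ks))"
    using Cons by (intro ceq_mult) (auto simp: ceq_def)
  moreover have "ceq N (cycle_series X k * (1 + 2 * psum ks)) (1 + 2 * psum (k # ks))"
  proof -
    have "cycle_series X k * (1 + 2 * psum ks) - (1 + 2 * psum (k # ks)) =
        X ^ (2 * k) * ((-1) ^ k * (1 + 2 * psum ks)) + 4 * (X ^ k * psum ks)"
      by (simp add: cycle_series_def algebra_simps)
    moreover have "X ^ N dvd X ^ (2 * k)" using Cons.prems assms(2) by (intro X_power_dvd) force
    moreover have "X ^ N dvd X ^ k * psum ks"
    proof -
      have "X ^ m * X ^ m dvd X ^ k * psum ks"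
        using Cons.prems by (intro mult_dvd_mono X_power_dvd dvd_psum) auto
      moreover have "X ^ N dvd X ^ m * X ^ m"
        using assms(2) by (simp add: power_add[symmetric] X_power_dvd)
      ultimately show ?thesis by (rule dvd_trans[rotated])
    qed
    ultimately show ?thesis unfolding ceq_def by (auto intro!: dvd_add dvd_mult dvd_mult2)
  qed
  ultimately show ?case by (auto intro: ceq_trans)
qed (simp add: ceq_def)

text \<open>The part of the path summand of \<open>dumbbell_series\<close> that is free of cycle
  terms: each \<open>loop_v\<close> begins with X (1 + X).\<close>

definition bridge :: "nat \<Rightarrow> int fps" where
  "bridge r = (-1) ^ r * (1 + X)\<^sup>2 * X ^ (2 * r)"

definition bcoeff :: "nat \<Rightarrow> nat \<Rightarrow> int" where
  "bcoeff r n = (-1) ^ r * (if n = 2 * r then 1 else if n = 2 * r + 1 then 2 else if n = 2 * r + 2 then 1 else 0)"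

lemma bridge_nth: "bridge r $ n = bcoeff r n"
proof -
  have c: "(-1) ^ r = fps_const ((-1) ^ r :: int)"
    by (cases "even r") simp_all
  have "bridge r = fps_const ((-1) ^ r) * (X ^ (2 * r) * (1 + 2 * X + X\<^sup>2))"
    unfolding bridge_def c by algebra
  moreover have "(1 + 2 * X + X\<^sup>2) $ k = (if k = 0 then 1 else if k = 1 then 2 else if k = 2 then 1 else 0)" for k
    by (auto simp: numeral_fps_const fps_X_power_nth fps_numeral_nth)
  ultimately show ?thesis
    by (auto simp: bcoeff_def fps_X_power_mult_nth fps_numeral_nth)
qed

text \<open>The factor w B pairs the leading term 2 w X^p of one looped cycle with the part B of the
  other. The last summand pairs the path with a cycle and has order at least 2 r - 1 + m; for r
  \<ge> 2 it is felt at degree m + 3 at the earliest, and there only when r = 2.\<close>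

lemma ceq_dumbbell:
  assumes "m \<le> p" "m \<le> q" "N \<le> 2 * m" "r \<ge> 1"
  defines "w \<equiv> 1 + X\<^sup>2" and "B \<equiv> 1 + X + 2 * X\<^sup>2"
  shows "ceq N (dumbbell_series X p q r)
    (B\<^sup>2 + 2 * (w * B * psum [p, q]) + bridge r + 2 * (-1) ^ r * (X ^ (2 * r - 1) * (((1 + X) * w) * psum [p, q])))"
proof -
  define a b e f where "a = X ^ p" and "b = X ^ q" and "e = ((-1) ^ p :: int fps)" and "f = ((-1) ^ q :: int fps)"
  define d where "d = 2 - X + X\<^sup>2"
  obtain r' where r: "r = Suc r'" using \<open>r \<ge> 1\<close> by (cases r) auto
  define g where "g = (-1) ^ r * X ^ (2 * r')"
  have sq: "X ^ (2 * p) = a\<^sup>2" "X ^ (2 * q) = b\<^sup>2"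
    by (simp_all add: a_def b_def power_mult[symmetric] mult.commute)
  have r2: "X ^ (2 * r) = X ^ (2 * r') * X\<^sup>2" "X ^ (2 * r - 1) = X ^ (2 * r') * X"
    by (simp_all add: r power2_eq_square mult.commute mult.left_commute)
  have U: "loop_u X p = B + 2 * w * a + e * (1 - X) * a\<^sup>2" "loop_u X q = B + 2 * w * b + f * (1 - X) * b\<^sup>2"
    by (simp_all only: loop_u_def sq B_def w_def a_def b_def e_def f_def)
  have V: "loop_v X p = X * (1 + X) + 2 * w * a + e * d * a\<^sup>2" "loop_v X q = X * (1 + X) + 2 * w * b + f * d * b\<^sup>2"
    by (simp_all only: loop_v_def sq d_def w_def a_def b_def e_def f_def)
  have "(-1) ^ r * X ^ (2 * r - 2) = g" by (simp add: g_def r)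
  then have D: "dumbbell_series X p q r = loop_u X p * loop_u X q + g * loop_v X p * loop_v X q"
    by (simp only: dumbbell_series_def)
  have br: "bridge r = g * (X * (1 + X))\<^sup>2"
    unfolding bridge_def g_def r2 by algebra
  have ps: "psum [p, q] = a + b" by (simp add: a_def b_def)
  have cr: "2 * (-1) ^ r * (X ^ (2 * r - 1) * (((1 + X) * w) * (a + b))) = g * (2 * w * (X * (1 + X)) * (a + b))"
    unfolding g_def r2 by algebra
  have "(B + 2 * w * a + e * (1 - X) * a\<^sup>2) * (B + 2 * w * b + f * (1 - X) * b\<^sup>2)
      + g * (c + 2 * w * a + e * d * a\<^sup>2) * (c + 2 * w * b + f * d * b\<^sup>2)
      - (B\<^sup>2 + 2 * (w * B * (a + b)) + g * c\<^sup>2 + g * (2 * w * c * (a + b)))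
     = a * b * (4 * w\<^sup>2 + g * 4 * w\<^sup>2)
      + a * a * (e * (1 - X) * (B + 2 * w * b + f * (1 - X) * b\<^sup>2) + g * (e * d * (c + 2 * w * b + f * d * b\<^sup>2)))
      + b * b * (f * (1 - X) * (B + 2 * w * a) + g * (f * d * (c + 2 * w * a)))" for c
    by algebra
  from this[of "X * (1 + X)"]
  have eq: "dumbbell_series X p q r - (B\<^sup>2 + 2 * (w * B * psum [p, q]) + bridge r + 2 * (-1) ^ r * (X ^ (2 * r - 1) * (((1 + X) * w) * psum [p, q])))
     = a * b * (4 * w\<^sup>2 + g * 4 * w\<^sup>2)
      + a * a * (e * (1 - X) * (B + 2 * w * b + f * (1 - X) * b\<^sup>2) + g * (e * d * (X * (1 + X) + 2 * w * b + f * d * b\<^sup>2)))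
      + b * b * (f * (1 - X) * (B + 2 * w * a) + g * (f * d * (X * (1 + X) + 2 * w * a)))"
    unfolding D U V br ps cr .
  have h: "X ^ N dvd a * b" "X ^ N dvd a * a" "X ^ N dvd b * b"
    using assms(1-3) by (auto simp: a_def b_def power_add[symmetric] intro!: X_power_dvd)
  show ?thesis unfolding ceq_def eq
    by (intro dvd_add dvd_mult2[OF h(1)] dvd_mult2[OF h(2)] dvd_mult2[OF h(3)])
qed

text \<open>A path with \<open>i\<close> inner vertices has i + 2 vertices, whence
  \<open>bridge (i + 2)\<close>, and two paths form a cycle of length i + j + 2. The neglected
  products of a cycle with the third path have order at least m + 4, or at least 2 m if that path is
  the shortest.\<close>

lemma ceq_theta:
  assumes "i \<le> j" "j \<le> k" "1 \<le> j" "m \<le> i + j + 2" "N \<le> 2 * m" "N \<le> m + 4"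
  defines "w \<equiv> 1 + X\<^sup>2" and "B \<equiv> 1 + X + 2 * X\<^sup>2"
  shows "ceq N (theta_series X i j k)
    (B\<^sup>2 + bridge (i + 2) + bridge (j + 2) + bridge (k + 2) + 2 * (w\<^sup>2 * psum [i + j + 2, i + k + 2, j + k + 2]))"
proof -
  define h where "h = (\<lambda>i. (-1) ^ Suc i * X ^ (2 * i))"
  define x y z where "x = X ^ i" and "y = X ^ j" and "z = X ^ k"
  define a b c :: "int fps" where "a = (-1) ^ Suc i" and "b = (-1) ^ Suc j" and "c = (-1) ^ Suc k"
  have sq: "X ^ (2 * i) = x\<^sup>2" "X ^ (2 * j) = y\<^sup>2" "X ^ (2 * k) = z\<^sup>2"
    by (simp_all add: x_def y_def z_def power_mult[symmetric] mult.commute)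
  have h: "(-1) ^ Suc i * X ^ (2 * i) = a * x\<^sup>2" "(-1) ^ Suc j * X ^ (2 * j) = b * y\<^sup>2" "(-1) ^ Suc k * X ^ (2 * k) = c * z\<^sup>2"
    by (simp_all only: sq a_def b_def c_def)
  have T: "theta_series X i j k = B\<^sup>2 - X ^ 4 * (1 + X)\<^sup>2 * (a * x\<^sup>2 + b * y\<^sup>2 + c * z\<^sup>2)
     + X ^ 4 * (1 - X)\<^sup>2 * (a * x\<^sup>2 * (b * y\<^sup>2) + a * x\<^sup>2 * (c * z\<^sup>2) + b * y\<^sup>2 * (c * z\<^sup>2))
     - X ^ 6 * (2 - X + X\<^sup>2)\<^sup>2 * (a * x\<^sup>2) * (b * y\<^sup>2) * (c * z\<^sup>2)
     + 2 * w\<^sup>2 * X\<^sup>2 * (x * y * (1 - X\<^sup>2 * (c * z\<^sup>2)) + x * z * (1 - X\<^sup>2 * (b * y\<^sup>2)) + y * z * (1 - X\<^sup>2 * (a * x\<^sup>2)))"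
    unfolding theta_series_def Let_def B_def w_def h power_add x_def y_def z_def by (rule refl)
  have "bridge (n + 2) = - (X ^ 4 * (1 + X)\<^sup>2 * ((-1) ^ Suc n * X ^ (2 * n)))" for n
    by (simp add: bridge_def power_add numeral_eq_Suc)
  from this[of i] this[of j] this[of k]
  have br: "bridge (i + 2) = - (X ^ 4 * (1 + X)\<^sup>2 * (a * x\<^sup>2))" "bridge (j + 2) = - (X ^ 4 * (1 + X)\<^sup>2 * (b * y\<^sup>2))"
    "bridge (k + 2) = - (X ^ 4 * (1 + X)\<^sup>2 * (c * z\<^sup>2))"
    unfolding h .
  have ps: "psum [i + j + 2, i + k + 2, j + k + 2] = X\<^sup>2 * (x * y + x * z + y * z)"
    unfolding psum_simps power_add x_def[symmetric] y_def[symmetric] z_def[symmetric] by algebra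
  have "theta_series X i j k - (B\<^sup>2 + bridge (i + 2) + bridge (j + 2) + bridge (k + 2) + 2 * (w\<^sup>2 * psum [i + j + 2, i + k + 2, j + k + 2]))
    = (X ^ 4 * x\<^sup>2 * y\<^sup>2) * ((1 - X)\<^sup>2 * a * b - X\<^sup>2 * (2 - X + X\<^sup>2)\<^sup>2 * a * b * c * z\<^sup>2)
    + (X ^ 4 * x\<^sup>2 * z\<^sup>2) * ((1 - X)\<^sup>2 * a * c) + (X ^ 4 * y\<^sup>2 * z\<^sup>2) * ((1 - X)\<^sup>2 * b * c)
    + (X ^ 4 * x * y * z\<^sup>2) * (- 2 * w\<^sup>2 * c) + (X ^ 4 * x * z * y\<^sup>2) * (- 2 * w\<^sup>2 * b) + (X ^ 4 * y * z * x\<^sup>2) * (- 2 * w\<^sup>2 * a)"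
    unfolding T br ps by algebra
  moreover have h: "X ^ N dvd X ^ 4 * x\<^sup>2 * y\<^sup>2" "X ^ N dvd X ^ 4 * x\<^sup>2 * z\<^sup>2" "X ^ N dvd X ^ 4 * y\<^sup>2 * z\<^sup>2"
    "X ^ N dvd X ^ 4 * x * y * z\<^sup>2" "X ^ N dvd X ^ 4 * x * z * y\<^sup>2" "X ^ N dvd X ^ 4 * y * z * x\<^sup>2"
    using assms(1-6) by (auto simp: x_def y_def z_def power_add[symmetric] power_mult[symmetric] intro!: X_power_dvd)
  ultimately show ?thesis unfolding ceq_def
    by (simp only:) (intro dvd_add h[THEN dvd_mult2])
qed

section \<open>Coefficients near the shortest cycle\<close>

lemma nth_mult_psum:
  assumes "\<forall>k\<in>set ks. m \<le> k"
  shows "(f * psum ks) $ (m + j) = (\<Sum>t\<le>j. f $ t * int (count_list ks (m + j - t)))"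
proof -
  have "(f * psum ks) $ (m + j) = (\<Sum>t=0..m + j. f $ t * int (count_list ks (m + j - t)))"
    by (simp add: fps_mult_nth psum_nth)
  also have "\<dots> = (\<Sum>t\<le>j. f $ t * int (count_list ks (m + j - t)))"
  proof (rule sum.mono_neutral_right)
    show "\<forall>t\<in>{0..m + j} - {..j}. f $ t * int (count_list ks (m + j - t)) = 0"
    proof
      fix t assume "t \<in> {0..m + j} - {..j}"
      then have "m + j - t \<notin> set ks" using assms by force
      then show "f $ t * int (count_list ks (m + j - t)) = 0" by (simp add: count_list_0_iff)
    qed
  qed auto
  finally show ?thesis .
qed

lemma nth_mult_psum_low:
  assumes "\<forall>k\<in>set ks. m \<le> k" "n < m"
  shows "(f * psum ks) $ n = 0"
proof -
  obtain C where "psum ks = X ^ m * C" using dvd_psum[of ks m] assms by (auto simp: dvd_def)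
  then have "f * psum ks = X ^ m * (f * C)" by simp
  then show ?thesis using \<open>n < m\<close> by (simp only: fps_X_power_mult_nth) simp
qed

text \<open>From its length on, a cycle contributes twice the coefficients 1, 1, 3, 1 of w B (one
  cubic vertex), 1, 2, 5, 4 of B^2 (none) or 1, 0, 2, 0 of w^2 (both). The comparisons below rest on
  these numbers.\<close>

lemma series_coeffs:
  fixes ks m
  assumes "\<forall>k\<in>set ks. m \<le> k"
  defines "c \<equiv> \<lambda>n. int (count_list ks n)"
  defines "w \<equiv> 1 + X\<^sup>2" and "B \<equiv> 1 + X + 2 * X\<^sup>2"
  shows "(w * B * psum ks) $ m = c m" "(w * B * psum ks) $ (m + 1) = c m + c (m + 1)"
    "(w * B * psum ks) $ (m + 2) = 3 * c m + c (m + 1) + c (m + 2)"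
    "(w * B * psum ks) $ (m + 3) = c m + 3 * c (m + 1) + c (m + 2) + c (m + 3)"
    "(B\<^sup>2 * psum ks) $ m = c m" "(B\<^sup>2 * psum ks) $ (m + 1) = 2 * c m + c (m + 1)"
    "(B\<^sup>2 * psum ks) $ (m + 2) = 5 * c m + 2 * c (m + 1) + c (m + 2)"
    "(B\<^sup>2 * psum ks) $ (m + 3) = 4 * c m + 5 * c (m + 1) + 2 * c (m + 2) + c (m + 3)"
    "(w\<^sup>2 * psum ks) $ m = c m" "(w\<^sup>2 * psum ks) $ (m + 1) = c (m + 1)"
    "(w\<^sup>2 * psum ks) $ (m + 2) = 2 * c m + c (m + 2)" "(w\<^sup>2 * psum ks) $ (m + 3) = 2 * c (m + 1) + c (m + 3)"
proof -
  have wB: "w * B = 1 + X + 3 * X^2 + X^3 + 2 * X^4"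
    unfolding w_def B_def by algebra
  have B2: "B\<^sup>2 = 1 + 2 * X + 5 * X^2 + 4 * X^3 + 4 * X^4"
    unfolding B_def by algebra
  have w2: "w\<^sup>2 = 1 + 2 * X^2 + X^4"
    unfolding w_def by algebra
  have wBn: "(w * B) $ 0 = 1" "(w * B) $ (Suc 0) = 1" "(w * B) $ (Suc (Suc 0)) = 3" "(w * B) $ (Suc (Suc (Suc 0))) = 1"
    unfolding wB by (simp_all add: fps_X_power_nth numeral_fps_const)
  have B2n: "(B\<^sup>2) $ 0 = 1" "(B\<^sup>2) $ (Suc 0) = 2" "(B\<^sup>2) $ (Suc (Suc 0)) = 5" "(B\<^sup>2) $ (Suc (Suc (Suc 0))) = 4"
    unfolding B2 by (simp_all add: fps_X_power_nth numeral_fps_const)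
  have w2n: "(w\<^sup>2) $ 0 = 1" "(w\<^sup>2) $ (Suc 0) = 0" "(w\<^sup>2) $ (Suc (Suc 0)) = 2" "(w\<^sup>2) $ (Suc (Suc (Suc 0))) = 0"
    unfolding w2 by (simp_all add: fps_X_power_nth numeral_fps_const)
  have n: "(f * psum ks) $ (m + j) = (\<Sum>t\<le>j. f $ t * int (count_list ks (m + j - t)))" for f j
    using assms(1) by (rule nth_mult_psum)
  have s: "(f * psum ks) $ m = (\<Sum>t\<le>0. f $ t * c (m - t))"
      "(f * psum ks) $ (m + 1) = (\<Sum>t\<le>Suc 0. f $ t * c (m + 1 - t))"
      "(f * psum ks) $ (m + 2) = (\<Sum>t\<le>Suc (Suc 0). f $ t * c (m + 2 - t))"
      "(f * psum ks) $ (m + 3) = (\<Sum>t\<le>Suc (Suc (Suc 0)). f $ t * c (m + 3 - t))" for f :: "int fps"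
    using n[of f 0] n[of f 1] n[of f 2] n[of f 3] by (simp_all add: c_def numeral_eq_Suc)
  have gen: "(f * psum ks) $ m = c0 * c m" "(f * psum ks) $ (m + 1) = c1 * c m + c0 * c (m + 1)"
      "(f * psum ks) $ (m + 2) = c2 * c m + c1 * c (m + 1) + c0 * c (m + 2)"
      "(f * psum ks) $ (m + 3) = c3 * c m + c2 * c (m + 1) + c1 * c (m + 2) + c0 * c (m + 3)"
    if "f $ 0 = c0" "f $ Suc 0 = c1" "f $ Suc (Suc 0) = c2" "f $ Suc (Suc (Suc 0)) = c3" for f c0 c1 c2 c3
    unfolding s by (simp_all add: that numeral_eq_Suc)
  show "(w * B * psum ks) $ m = c m" "(w * B * psum ks) $ (m + 1) = c m + c (m + 1)"
    "(w * B * psum ks) $ (m + 2) = 3 * c m + c (m + 1) + c (m + 2)"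
    "(w * B * psum ks) $ (m + 3) = c m + 3 * c (m + 1) + c (m + 2) + c (m + 3)"
    unfolding gen[OF wBn] by simp_all
  show "(B\<^sup>2 * psum ks) $ m = c m" "(B\<^sup>2 * psum ks) $ (m + 1) = 2 * c m + c (m + 1)"
    "(B\<^sup>2 * psum ks) $ (m + 2) = 5 * c m + 2 * c (m + 1) + c (m + 2)"
    "(B\<^sup>2 * psum ks) $ (m + 3) = 4 * c m + 5 * c (m + 1) + 2 * c (m + 2) + c (m + 3)"
    unfolding gen[OF B2n] by simp_all
  show "(w\<^sup>2 * psum ks) $ m = c m" "(w\<^sup>2 * psum ks) $ (m + 1) = c (m + 1)"
    "(w\<^sup>2 * psum ks) $ (m + 2) = 2 * c m + c (m + 2)" "(w\<^sup>2 * psum ks) $ (m + 3) = 2 * c (m + 1) + c (m + 3)"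
    unfolding gen[OF w2n] by simp_all
qed

declare psum_simps [simp del]

lemma even_fps_nth: "even ((2 * A :: int fps) $ n)" "(2 * A :: int fps) $ n = 2 * A $ n"
proof -
  show "(2 * A :: int fps) $ n = 2 * A $ n" by (simp add: numeral_fps_const)
  then show "even ((2 * A :: int fps) $ n)" by simp
qed

text \<open>Below \<open>X ^ N\<close> only \<open>C\<close> meets the cycles, because
  \<open>E\<close> times a leading cycle term has order at least e + m.\<close>

lemma ceq_mult_cycles:
  assumes H: "ceq N H (C + E)" and E: "X ^ e dvd E" and ks: "\<And>k. k \<in> set ks \<Longrightarrow> m \<le> k"
    and N: "N \<le> 2 * m" "N \<le> m + e"
  shows "ceq N (H * prod_list (map (cycle_series X) ks)) (C + E + 2 * (C * psum ks))"
proof -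
  have "ceq N (H * prod_list (map (cycle_series X) ks)) ((C + E) * (1 + 2 * psum ks))"
    by (intro ceq_mult H ceq_cycles[OF ks N(1)])
  moreover have "ceq N ((C + E) * (1 + 2 * psum ks)) (C + E + 2 * (C * psum ks))"
  proof -
    have "X ^ e * X ^ m dvd E * psum ks"
      by (intro mult_dvd_mono E dvd_psum ks)
    moreover have "X ^ N dvd X ^ e * X ^ m"
      using N(2) by (simp add: power_add[symmetric] X_power_dvd)
    ultimately have "X ^ N dvd 2 * (E * psum ks)" by (blast intro: dvd_trans dvd_mult)
    moreover have "(C + E) * (1 + 2 * psum ks) - (C + E + 2 * (C * psum ks)) = 2 * (E * psum ks)"
      by algebra
    ultimately show ?thesis by (simp add: ceq_def)
  qed
  ultimately show ?thesis by (rule ceq_trans)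
qed

text \<open>The truncated series without B^2, the part that dumbbells and theta graphs share for all
  parameters.\<close>

definition dumbbell_dev :: "nat \<Rightarrow> nat \<Rightarrow> nat \<Rightarrow> int fps" where
  "dumbbell_dev p q r = 2 * ((1 + X\<^sup>2) * (1 + X + 2 * X\<^sup>2) * psum [p, q]) + bridge r
     + 2 * (-1) ^ r * (X ^ (2 * r - 1) * (((1 + X) * (1 + X\<^sup>2)) * psum [p, q]))"

definition theta_dev :: "nat \<Rightarrow> nat \<Rightarrow> nat \<Rightarrow> int fps" where
  "theta_dev i j k = bridge (i + 2) + bridge (j + 2) + bridge (k + 2)
     + 2 * ((1 + X\<^sup>2)\<^sup>2 * psum [i + j + 2, i + k + 2, j + k + 2])"

lemma dumbbell_dev_nth:
  fixes p q r m :: nat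
  assumes "m \<le> p" "m \<le> q" "r \<ge> 2"
  defines "c \<equiv> \<lambda>n. int (count_list [p, q] n)"
  shows "n < m \<Longrightarrow> dumbbell_dev p q r $ n = bcoeff r n"
    "dumbbell_dev p q r $ m = 2 * c m + bcoeff r m"
    "dumbbell_dev p q r $ (m + 1) = 2 * (c m + c (m + 1)) + bcoeff r (m + 1)"
    "dumbbell_dev p q r $ (m + 2) = 2 * (3 * c m + c (m + 1) + c (m + 2)) + bcoeff r (m + 2)"
    "dumbbell_dev p q r $ (m + 3) = 2 * (c m + 3 * c (m + 1) + c (m + 2) + c (m + 3)) + bcoeff r (m + 3)
       + (if r = 2 then 2 * c m else 0)"
proof -
  have pq: "\<forall>k\<in>set [p, q]. m \<le> k" using assms by auto
  define F where "F = ((1 + X) * (1 + X\<^sup>2)) * psum [p, q]"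
  have F0: "F $ n = 0" if "n < m" for n
    unfolding F_def using pq that by (rule nth_mult_psum_low)
  have Fm: "F $ m = c m"
    using nth_mult_psum[OF pq, where j = 0] by (simp add: F_def c_def)
  have e: "(2 * (-1) ^ r * (X ^ (2 * r - 1) * F)) $ n = 2 * (-1) ^ r * (X ^ (2 * r - 1) * F) $ n" for n
    by (cases "even r") (simp_all add: numeral_fps_const)
  have cr: "(2 * (-1) ^ r * (X ^ (2 * r - 1) * F)) $ n = 0" if "n < m + 3" for n
    unfolding e fps_X_power_mult_nth using \<open>r \<ge> 2\<close> that F0[of "n - (2 * r - 1)"] by auto
  have cr3: "(2 * (-1) ^ r * (X ^ (2 * r - 1) * F)) $ (m + 3) = (if r = 2 then 2 * c m else 0)"
  proof (cases "r = 2")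
    case True
    then show ?thesis unfolding e fps_X_power_mult_nth using Fm by simp
  next
    case False
    then show ?thesis unfolding e fps_X_power_mult_nth using \<open>r \<ge> 2\<close> F0[of "m + 3 - (2 * r - 1)"] by auto
  qed
  have s: "dumbbell_dev p q r $ n = 2 * ((1 + X\<^sup>2) * (1 + X + 2 * X\<^sup>2) * psum [p, q]) $ n + bcoeff r n
      + (2 * (-1) ^ r * (X ^ (2 * r - 1) * F)) $ n" for n
    by (simp only: dumbbell_dev_def fps_add_nth even_fps_nth bridge_nth F_def)
  show "n < m \<Longrightarrow> dumbbell_dev p q r $ n = bcoeff r n"
    unfolding s using cr[of n] nth_mult_psum_low[OF pq] by simp
  show "dumbbell_dev p q r $ m = 2 * c m + bcoeff r m"
    "dumbbell_dev p q r $ (m + 1) = 2 * (c m + c (m + 1)) + bcoeff r (m + 1)"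
    "dumbbell_dev p q r $ (m + 2) = 2 * (3 * c m + c (m + 1) + c (m + 2)) + bcoeff r (m + 2)"
    "dumbbell_dev p q r $ (m + 3) = 2 * (c m + 3 * c (m + 1) + c (m + 2) + c (m + 3)) + bcoeff r (m + 3)
       + (if r = 2 then 2 * c m else 0)"
    unfolding s series_coeffs(1-4)[OF pq] cr3 c_def using cr[of m] cr[of "m + 1"] cr[of "m + 2"] by simp_all
qed

lemma theta_dev_nth:
  fixes i j k m :: nat
  assumes "i \<le> j" "j \<le> k" "m \<le> i + j + 2"
  defines "b \<equiv> \<lambda>n. bcoeff (i + 2) n + bcoeff (j + 2) n + bcoeff (k + 2) n"
  defines "c \<equiv> \<lambda>n. int (count_list [i + j + 2, i + k + 2, j + k + 2] n)"
  shows "n < m \<Longrightarrow> theta_dev i j k $ n = b n"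
    "theta_dev i j k $ m = 2 * c m + b m"
    "theta_dev i j k $ (m + 1) = 2 * c (m + 1) + b (m + 1)"
    "theta_dev i j k $ (m + 2) = 2 * (2 * c m + c (m + 2)) + b (m + 2)"
    "theta_dev i j k $ (m + 3) = 2 * (2 * c (m + 1) + c (m + 3)) + b (m + 3)"
proof -
  have cyc: "\<forall>l\<in>set [i + j + 2, i + k + 2, j + k + 2]. m \<le> l" using assms by auto
  have s: "theta_dev i j k $ n = 2 * ((1 + X\<^sup>2)\<^sup>2 * psum [i + j + 2, i + k + 2, j + k + 2]) $ n + b n" for n
    by (simp only: theta_dev_def fps_add_nth even_fps_nth bridge_nth b_def)
  show "n < m \<Longrightarrow> theta_dev i j k $ n = b n"
    unfolding s using nth_mult_psum_low[OF cyc] by simp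
  show "theta_dev i j k $ m = 2 * c m + b m"
    "theta_dev i j k $ (m + 1) = 2 * c (m + 1) + b (m + 1)"
    "theta_dev i j k $ (m + 2) = 2 * (2 * c m + c (m + 2)) + b (m + 2)"
    "theta_dev i j k $ (m + 3) = 2 * (2 * c (m + 1) + c (m + 3)) + b (m + 3)"
    unfolding s series_coeffs(9-12)[OF cyc] c_def by simp_all
qed

lemma bridge_dvd: "e \<le> 2 * r \<Longrightarrow> X ^ e dvd bridge r"
  unfolding bridge_def by (intro dvd_mult X_power_dvd)

lemma dumbbell_dev_dvd:
  assumes "e \<le> p" "e \<le> q" "e \<le> 4" "r \<ge> 2"
  shows "X ^ e dvd dumbbell_dev p q r"
proof -
  have "X ^ e dvd psum [p, q]" using assms by (intro dvd_psum) auto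
  then show ?thesis unfolding dumbbell_dev_def using assms by (intro dvd_add bridge_dvd) auto
qed

lemma theta_dev_dvd:
  assumes "i \<le> j" "j \<le> k" "e \<le> i + j + 2" "e \<le> 4"
  shows "X ^ e dvd theta_dev i j k"
proof -
  have "X ^ e dvd psum [i + j + 2, i + k + 2, j + k + 2]" using assms by (intro dvd_psum) auto
  then show ?thesis unfolding theta_dev_def using assms by (intro dvd_add bridge_dvd) auto
qed

text \<open>As m \<ge> 3, truncation at m + 3 \<le> 2 m is allowed, and three coefficients from
  degree m on become available.\<close>

lemma dumbbell_compare:
  fixes p q r p' q' r' ks m
  assumes eq: "dumbbell_series X p q r = dumbbell_series X p' q' r' * prod_list (map (cycle_series X) ks)"
    and m: "3 \<le> m" "m \<le> p" "m \<le> q" "m \<le> p'" "m \<le> q'" "\<forall>k\<in>set ks. m \<le> k" and r: "r \<ge> 2" "r' \<ge> 2"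
    and n: "n < m + 3"
  shows "dumbbell_dev p q r $ n = dumbbell_dev p' q' r' $ n + 2 * ((1 + X + 2 * X\<^sup>2)\<^sup>2 * psum ks) $ n"
proof -
  let ?B = "1 + X + 2 * X\<^sup>2"
  have 1: "ceq (m + 3) (dumbbell_series X p q r) (?B\<^sup>2 + dumbbell_dev p q r)"
    using ceq_dumbbell[of m p q "m + 3" r] m r by (simp add: dumbbell_dev_def add.assoc)
  have "ceq (m + 3) (dumbbell_series X p' q' r') (?B\<^sup>2 + dumbbell_dev p' q' r')"
    using ceq_dumbbell[of m p' q' "m + 3" r'] m r by (simp add: dumbbell_dev_def add.assoc)
  then have 2: "ceq (m + 3) (dumbbell_series X p q r) (?B\<^sup>2 + dumbbell_dev p' q' r' + 2 * (?B\<^sup>2 * psum ks))"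
    unfolding eq by (rule ceq_mult_cycles[where e = 3 and m = m]) (use m r in \<open>auto intro!: dumbbell_dev_dvd\<close>)
  have "(?B\<^sup>2 + dumbbell_dev p q r) $ n = (?B\<^sup>2 + dumbbell_dev p' q' r' + 2 * (?B\<^sup>2 * psum ks)) $ n"
    using ceq_nth[OF 1 n] ceq_nth[OF 2 n] by (rule trans[OF sym])
  then show ?thesis by (simp add: even_fps_nth(2))
qed

lemma theta_compare:
  fixes p q r i j k ks m
  assumes eq: "dumbbell_series X p q r = theta_series X i j k * prod_list (map (cycle_series X) ks)"
    and m: "3 \<le> m" "m \<le> p" "m \<le> q" "i \<le> j" "j \<le> k" "1 \<le> j" "m \<le> i + j + 2" "\<forall>k\<in>set ks. m \<le> k" and r: "r \<ge> 2"
    and n: "n < m + 3 \<or> n = m + 3 \<and> m \<ge> 4"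
  shows "dumbbell_dev p q r $ n = theta_dev i j k $ n + 2 * ((1 + X + 2 * X\<^sup>2)\<^sup>2 * psum ks) $ n"
proof -
  let ?B = "1 + X + 2 * X\<^sup>2"
  \<comment> \<open>A fourth coefficient, at degree m + 3, takes truncation order m + 4 \<le> 2 m
    and hence m \<ge> 4.\<close>
  define N e where "N = (if m \<ge> 4 then m + 4 else m + 3)" and "e = (if m \<ge> 4 then 4 else 3 :: nat)"
  have N: "N \<le> 2 * m" "N \<le> m + 4" "N \<le> m + e" "n < N" "e \<le> m" "e \<le> 4" using m n by (auto simp: N_def e_def)
  have 1: "ceq N (dumbbell_series X p q r) (?B\<^sup>2 + dumbbell_dev p q r)"
    using ceq_dumbbell[of m p q N r] m r N by (simp add: dumbbell_dev_def add.assoc)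
  have "ceq N (theta_series X i j k) (?B\<^sup>2 + theta_dev i j k)"
    using ceq_theta[of i j k m N] m N by (simp add: theta_dev_def add.assoc)
  then have 2: "ceq N (dumbbell_series X p q r) (?B\<^sup>2 + theta_dev i j k + 2 * (?B\<^sup>2 * psum ks))"
    unfolding eq by (rule ceq_mult_cycles[where e = e and m = m]) (use m r N in \<open>auto intro!: theta_dev_dvd\<close>)
  have "(?B\<^sup>2 + dumbbell_dev p q r) $ n = (?B\<^sup>2 + theta_dev i j k + 2 * (?B\<^sup>2 * psum ks)) $ n"
    using ceq_nth[OF 1 N(4)] ceq_nth[OF 2 N(4)] by (rule trans[OF sym])
  then show ?thesis by (simp add: even_fps_nth(2))
qed

text \<open>The first nonzero coefficient of \<open>b r\<close> sits at 2 r and is odd. If two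
  members agree modulo 2 below \<open>N\<close>, they have the same index or both start at
  \<open>N\<close> or later, so congruence forces equality there.\<close>

lemma parity_bridge:
  fixes b :: "nat \<Rightarrow> nat \<Rightarrow> int"
  assumes low: "\<And>r n. n < 2 * r \<Longrightarrow> b r n = 0" and odd: "\<And>r. odd (b r (2 * r))"
    and even: "\<And>n. n < N \<Longrightarrow> even (b r n - b r' n)" and n: "n < N"
  shows "b r n = b r' n"
proof (cases r r' rule: linorder_cases)
  case less
  then have "N \<le> 2 * r" using even[of "2 * r"] odd[of r] low[of "2 * r" r'] by fastforce
  then show ?thesis using n less low[of n r] low[of n r'] by simp
next
  case greater
  then have "N \<le> 2 * r'" using even[of "2 * r'"] odd[of r'] low[of "2 * r'" r] by fastforce
  then show ?thesis using n greater low[of n r] low[of n r'] by simp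
qed simp

lemma parity_bcoeff:
  assumes "\<And>n. n < N \<Longrightarrow> even (bcoeff r n - bcoeff r' n)" "n < N"
  shows "bcoeff r n = bcoeff r' n"
  by (rule parity_bridge[of bcoeff, OF _ _ assms]) (auto simp: bcoeff_def)

lemma dumbbell_dev_parity: "even (dumbbell_dev p q r $ n - bcoeff r n)"
proof -
  have "dumbbell_dev p q r = 2 * ((1 + X\<^sup>2) * (1 + X + 2 * X\<^sup>2) * psum [p, q] +
     (-1) ^ r * (X ^ (2 * r - 1) * (((1 + X) * (1 + X\<^sup>2)) * psum [p, q]))) + bridge r"
    unfolding dumbbell_dev_def by algebra
  then show ?thesis by (simp add: even_fps_nth bridge_nth)
qed

lemma theta_dev_parity:
  "even (theta_dev i j k $ n - (bcoeff (i + 2) n + bcoeff (j + 2) n + bcoeff (k + 2) n))"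
  unfolding theta_dev_def fps_add_nth bridge_nth even_fps_nth(2) by simp

section \<open>A dumbbell against a dumbbell with cycles\<close>

lemma dumbbell_cycles_disjoint:
  assumes eq: "dumbbell_series X p q r = dumbbell_series X p' q' r' * prod_list (map (cycle_series X) ks)"
    and ge: "p \<ge> 3" "q \<ge> 3" "p' \<ge> 3" "q' \<ge> 3" "\<forall>k\<in>set ks. k \<ge> 3" "r \<ge> 2" "r' \<ge> 2"
  shows "{p, q} \<inter> {p', q'} \<noteq> {}"
proof
  assume disj: "{p, q} \<inter> {p', q'} = {}"
  define m where "m = Min (set ([p, q] @ [p', q'] @ ks))"
  have m_le: "m \<le> x" if "x \<in> set ([p, q] @ [p', q'] @ ks)" for x
    unfolding m_def using that by (intro Min_le) simp_all
  have m_in: "m \<in> set ([p, q] @ [p', q'] @ ks)"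
    unfolding m_def by (intro Min_in) simp_all
  have m: "3 \<le> m" "m \<le> p" "m \<le> q" "m \<le> p'" "m \<le> q'" "\<forall>k\<in>set ks. m \<le> k"
    using m_in m_le ge by auto
  note cmp = dumbbell_compare[OF eq m ge(6,7)]
  have b: "bcoeff r n = bcoeff r' n" if "n < m + 3" for n
  proof (rule parity_bcoeff[OF _ that])
    fix n assume "n < m + 3"
    from cmp[OF this] dumbbell_dev_parity[of p q r n] dumbbell_dev_parity[of p' q' r' n]
    show "even (bcoeff r n - bcoeff r' n)" by presburger
  qed
  define c c' k where "c = (\<lambda>n. int (count_list [p, q] n))" and "c' = (\<lambda>n. int (count_list [p', q'] n))"
    and "k = (\<lambda>n. int (count_list ks n))"
  have ks: "\<forall>k\<in>set ks. m \<le> k" using m by simp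
  note d = dumbbell_dev_nth[OF m(2,3) ge(6)] and d' = dumbbell_dev_nth[OF m(4,5) ge(7)] and K = series_coeffs(5-8)[OF ks]
  have lt: "m < m + 3" "m + 2 < m + 3" by simp_all
  have E0: "c m = c' m + k m"
    using cmp[OF lt(1)] b[OF lt(1)] unfolding d d' K c_def c'_def k_def by linarith
  have E2: "3 * c m + c (m + 1) + c (m + 2) = 3 * c' m + c' (m + 1) + c' (m + 2) + 5 * k m + 2 * k (m + 1) + k (m + 2)"
    using cmp[OF lt(2)] b[OF lt(2)] unfolding d d' K c_def c'_def k_def by presburger
  have "c m > 0 \<Longrightarrow> c' m = 0" "c m + c (m + 1) + c (m + 2) \<le> 2" using disj by (auto simp: c_def c'_def)
  moreover have "c n \<ge> 0" "c' n \<ge> 0" "k n \<ge> 0" for n by (simp_all add: c_def c'_def k_def)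
  moreover have "c m + c' m + k m > 0"
  proof -
    have "count_list ([p, q] @ [p', q'] @ ks) m > 0" using m_in by (metis count_list_0_iff not_gr_zero)
    then have "count_list [p, q] m + count_list [p', q'] m + count_list ks m > 0"
      by (simp only: count_list_append add.assoc)
    then show ?thesis unfolding c_def c'_def k_def by linarith
  qed
  \<comment> \<open>By \<open>E0\<close>, a length \<open>m\<close> on the left recurs as a separate
    cycle on the right, where each counts 5 instead of 3 at degree m + 2. The two cycles on the left
    cannot make up the difference, and if \<open>m\<close> is missing on the left it is missing
    everywhere.\<close>
  ultimately show False using E0 E2 by smt
qed

lemma loop_nth:
  assumes "p \<ge> 3"
  shows "loop_u X p $ 0 = 1" "loop_u X p $ 1 = 1" "X\<^sup>2 dvd loop_v X p - X"
proof -
  define p' where "p' = p - 2"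
  have p: "p = 2 + p'" "2 * p = 2 + (2 + 2 * p')" using assms by (simp_all add: p'_def)
  have pw: "X ^ p = X\<^sup>2 * X ^ p'" "X ^ (2 * p) = X\<^sup>2 * (X\<^sup>2 * X ^ (2 * p'))"
    unfolding power_add[symmetric] p[symmetric] by (rule refl)+
  have "loop_u X p = 1 + X + X\<^sup>2 * (2 + 2 * (1 + X\<^sup>2) * X ^ p' + (-1) ^ p * (1 - X) * (X\<^sup>2 * X ^ (2 * p')))"
    unfolding loop_u_def pw by algebra
  moreover have "(X\<^sup>2 * A) $ 0 = 0" "(X\<^sup>2 * A) $ 1 = 0" for A by (simp_all add: fps_X_power_mult_nth)
  ultimately show "loop_u X p $ 0 = 1" "loop_u X p $ 1 = 1" by simp_all
  have "loop_v X p - X = X\<^sup>2 * (1 + 2 * (1 + X\<^sup>2) * X ^ p' + (-1) ^ p * (2 - X + X\<^sup>2) * (X\<^sup>2 * X ^ (2 * p')))"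
    unfolding loop_v_def pw by algebra
  then show "X\<^sup>2 dvd loop_v X p - X" by simp
qed

lemma signed_X_power_mult_nth:
  "((-1) ^ r * X ^ (2 * r - 2) * A) $ n = (if n < 2 * r - 2 then 0 else (-1) ^ r * A $ (n - (2 * r - 2)))"
proof -
  have "((-1) ^ r * X ^ (2 * r - 2) * A) $ n = (-1) ^ r * (X ^ (2 * r - 2) * A) $ n"
    by (cases "even r") (simp_all add: mult.assoc)
  then show ?thesis by (simp add: fps_X_power_mult_nth)
qed

lemma parity_loop:
  fixes A :: "int fps"
  assumes A: "A $ 0 = 0" "A $ 1 = 0" "A $ 2 = 1" and r: "r \<ge> 2" "r' \<ge> 2"
    and even: "\<And>n. n < N \<Longrightarrow> even (((-1) ^ r * X ^ (2 * r - 2) * A) $ n - ((-1) ^ r' * X ^ (2 * r' - 2) * A) $ n)" and n: "n < N"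
  shows "((-1) ^ r * X ^ (2 * r - 2) * A) $ n = ((-1) ^ r' * X ^ (2 * r' - 2) * A) $ n"
proof -
  \<comment> \<open>The values for r < 2 are placeholders with an odd entry at 2 r, as
    \<open>parity_bridge\<close> quantifies over all indices.\<close>
  define b where "b = (\<lambda>r n. if r \<ge> 2 then ((-1) ^ r * X ^ (2 * r - 2) * A) $ n else if n = 2 * r then 1 else 0)"
  have "b r n = b r' n"
  proof (rule parity_bridge[of b, OF _ _ _ n])
    show "b r n = 0" if "n < 2 * r" for r n
    proof -
      have "n - (2 * r - 2) = 0 \<or> n - (2 * r - 2) = 1" using that by auto
      then show ?thesis using A(1,2) that unfolding b_def signed_X_power_mult_nth by auto
    qed
    show "odd (b r (2 * r))" for r
    proof -
      have "2 * r - (2 * r - 2) = 2" if "r \<ge> 2" using that by simp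
      then show ?thesis using A unfolding b_def signed_X_power_mult_nth by auto
    qed
  qed (use even r in \<open>simp add: b_def\<close>)
  then show ?thesis using r by (simp add: b_def)
qed

text \<open>The terms of the shared cycle \<open>p\<close> are kept exactly in \<open>U\<close> and
  \<open>V\<close>, so that \<open>m\<close> is the minimum of the other lengths only. A length
  \<open>m\<close> on the left forces a separate cycle on the right, which counts twice at degree m
  + 1 where a cycle of the dumbbell counts once.\<close>

lemma dumbbell_cycles_shared:
  assumes eq: "dumbbell_series X p q r = dumbbell_series X p q' r' * prod_list (map (cycle_series X) ks)"
    and ge: "p \<ge> 3" "q \<ge> 3" "q' \<ge> 3" "\<forall>k\<in>set ks. k \<ge> 3" "r \<ge> 2" "r' \<ge> 2"
  shows "q = q'"
proof (rule ccontr)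
  assume neq: "q \<noteq> q'"
  define m where "m = Min (set ([q, q'] @ ks))"
  have m_le: "m \<le> x" if "x \<in> set ([q, q'] @ ks)" for x
    unfolding m_def using that by (intro Min_le) simp_all
  have m_in: "m \<in> set ([q, q'] @ ks)"
    unfolding m_def by (intro Min_in) simp_all
  have m: "3 \<le> m" "m \<le> q" "m \<le> q'" "\<forall>k\<in>set ks. m \<le> k"
    using m_in m_le ge by auto
  define U V where "U = loop_u X p" and "V = loop_v X p"
  define w B where "w = 1 + X\<^sup>2" and "B = 1 + X + 2 * X\<^sup>2"
  define A where "A = V * (X * (1 + X))"
  define E where "E = (\<lambda>q r. 2 * (U * w * psum [q]) + (-1) ^ r * X ^ (2 * r - 2) * A)"
  have D: "ceq (m + 2) (dumbbell_series X p q r) (U * B + E q r)" if "q \<ge> m" "r \<ge> 2" for q r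
  proof -
    define a e where "a = X ^ q" and "e = ((-1) ^ q :: int fps)"
    have sq: "X ^ (2 * q) = a * a" by (simp add: a_def power_add mult_2)
    obtain r' where r': "2 * r - 2 = r' + 2" using \<open>r \<ge> 2\<close> by (metis add.commute le_Suc_ex Suc_1 diff_diff_left le_diff_conv2 mult_le_mono2 mult_2 nat_mult_1_right numeral_Bit0 le_add_diff_inverse2 add_leD2)
    have uq: "loop_u X q = B + 2 * w * a + e * (1 - X) * (a * a)" and vq: "loop_v X q = X * (1 + X) + 2 * w * a + e * (2 - X + X\<^sup>2) * (a * a)"
      by (simp_all only: loop_u_def loop_v_def w_def B_def e_def sq a_def)
    have "dumbbell_series X p q r - (U * B + E q r) =
      a * a * (U * e * (1 - X)) + (X ^ 2 * a) * ((-1) ^ r * X ^ r' * V * (2 * w + e * (2 - X + X\<^sup>2) * a))"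
      unfolding dumbbell_series_def E_def uq vq r' power_add U_def[symmetric] V_def[symmetric] A_def psum_simps a_def[symmetric]
      by algebra
    moreover have "X ^ (m + 2) dvd a * a" "X ^ (m + 2) dvd X ^ 2 * a"
      unfolding a_def power_add[symmetric] using that m by (intro X_power_dvd; linarith)+
    ultimately show ?thesis unfolding ceq_def by (simp only:) (intro dvd_add; simp)
  qed
  have Edvd: "X ^ 2 dvd E q' r'"
  proof -
    have "X ^ 2 dvd psum [q']" using m by (intro dvd_psum) auto
    moreover have "X ^ 2 dvd X ^ (2 * r' - 2)" using ge by (intro X_power_dvd) auto
    ultimately show ?thesis unfolding E_def by (auto intro!: dvd_add)
  qed
  have 1: "ceq (m + 2) (dumbbell_series X p q r) (U * B + E q r)" by (rule D) (use m ge in auto)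
  have "ceq (m + 2) (dumbbell_series X p q' r') (U * B + E q' r')" by (rule D) (use m ge in auto)
  then have 2: "ceq (m + 2) (dumbbell_series X p q r) (U * B + E q' r' + 2 * (U * B * psum ks))"
    unfolding eq by (rule ceq_mult_cycles[OF _ Edvd, where m = m]) (use m in auto)
  have cmp: "E q r $ n = E q' r' $ n + 2 * (U * B * psum ks) $ n" if "n < m + 2" for n
  proof -
    have "(U * B + E q r) $ n = (U * B + E q' r' + 2 * (U * B * psum ks)) $ n"
      using ceq_nth[OF 1 that] ceq_nth[OF 2 that] by (rule trans[OF sym])
    then show ?thesis unfolding fps_add_nth even_fps_nth(2) by simp
  qed
  define b where "b = (\<lambda>r n. ((-1) ^ r * X ^ (2 * r - 2) * A) $ n)"
  have En: "E q r $ n = 2 * (U * w * psum [q]) $ n + b r n" for q r n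
    by (simp add: E_def b_def even_fps_nth)
  obtain V' where V: "V = X + X\<^sup>2 * V'"
    using loop_nth(3)[OF ge(1)] by (auto simp: V_def dvd_def algebra_simps)
  have A: "A = X\<^sup>2 * ((1 + X * V') * (1 + X))" unfolding A_def V by algebra
  have An: "A $ 0 = 0" "A $ 1 = 0" "A $ 2 = 1" unfolding A fps_X_power_mult_nth by simp_all
  have bb: "b r n = b r' n" if "n < m + 2" for n
    unfolding b_def
  proof (rule parity_loop[OF An ge(5,6) _ that])
    fix n assume "n < m + 2"
    from cmp[OF this]
    show "even (((-1) ^ r * X ^ (2 * r - 2) * A) $ n - ((-1) ^ r' * X ^ (2 * r' - 2) * A) $ n)"
      unfolding En b_def by presburger
  qed
  define c where "c = (\<lambda>(ks :: nat list) n. int (count_list ks n))"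
  have Uw: "(U * w) $ 0 = 1" "(U * w) $ Suc 0 = 1" and UB: "(U * B) $ 0 = 1" "(U * B) $ Suc 0 = 2"
    using loop_nth(1,2)[OF ge(1)] by (simp_all add: U_def w_def B_def fps_mult_nth numeral_fps_const)
  have co: "(f * psum ks) $ m = f $ 0 * c ks m" "(f * psum ks) $ (m + 1) = f $ 0 * c ks (m + 1) + f $ Suc 0 * c ks m"
    if "\<forall>k\<in>set ks. m \<le> k" for f ks
    using nth_mult_psum[OF that, of f 0] nth_mult_psum[OF that, of f 1] by (simp_all add: c_def)
  have q: "\<forall>k\<in>set [q]. m \<le> k" "\<forall>k\<in>set [q']. m \<le> k" using m by simp_all
  have lt: "m < m + 2" "m + 1 < m + 2" by simp_all
  have E0: "c [q] m = c [q'] m + c ks m"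
    using cmp[OF lt(1)] bb[OF lt(1)] unfolding En co[OF q(1)] co[OF q(2)] co[OF m(4)] Uw UB by linarith
  have E1: "c [q] m + c [q] (m + 1) = c [q'] m + c [q'] (m + 1) + 2 * c ks m + c ks (m + 1)"
    using cmp[OF lt(2)] bb[OF lt(2)] unfolding En co[OF q(1)] co[OF q(2)] co[OF m(4)] Uw UB by presburger
  have "c [q] m + c [q] (m + 1) \<le> 1" "c [q] m > 0 \<Longrightarrow> c [q'] m = 0" using neq by (auto simp: c_def)
  moreover have "c ks n \<ge> 0" for ks n by (simp add: c_def)
  moreover have "c [q] m + c [q'] m + c ks m > 0"
  proof -
    have "count_list ([q] @ [q'] @ ks) m > 0" using m_in by (metis append_Cons append_Nil count_list_0_iff not_gr_zero)
    then have "count_list [q] m + count_list [q'] m + count_list ks m > 0"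
      by (simp only: count_list_append add.assoc)
    then show ?thesis unfolding c_def by linarith
  qed
  ultimately show False using E0 E1 by smt
qed

text \<open>With both cycles shared, \<open>U\<close> and \<open>A\<close> are kept exactly and only
  the path terms may differ. Parity makes these agree up to degree \<open>m\<close>, so the shortest
  separate cycle would leave twice its multiplicity uncancelled.\<close>

lemma dumbbell_cycles_same:
  assumes eq: "dumbbell_series X p q r = dumbbell_series X p q r' * prod_list (map (cycle_series X) ks)"
    and ge: "p \<ge> 3" "q \<ge> 3" "\<forall>k\<in>set ks. k \<ge> 3" "r \<ge> 2" "r' \<ge> 2"
  shows "ks = []"
proof (rule ccontr)
  assume ne: "ks \<noteq> []"
  define m where "m = Min (set ks)"
  have m: "\<forall>k\<in>set ks. m \<le> k" "m \<in> set ks" unfolding m_def using ne by simp_all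
  have m3: "m \<ge> 3" using m ge by auto
  define U A where "U = loop_u X p * loop_u X q" and "A = loop_v X p * loop_v X q"
  define E where "E = (\<lambda>r. (-1) ^ r * X ^ (2 * r - 2) * A)"
  have D: "dumbbell_series X p q r = U + E r" for r by (simp add: dumbbell_series_def U_def A_def E_def mult.assoc)
  have Edvd: "X ^ 1 dvd E r'"
    unfolding E_def using ge by (intro dvd_mult2 dvd_mult X_power_dvd) auto
  have 2: "ceq (m + 1) (dumbbell_series X p q r) (U + E r' + 2 * (U * psum ks))"
    unfolding eq by (rule ceq_mult_cycles[OF _ Edvd, where m = m]) (use m m3 D in \<open>auto simp: ceq_def\<close>)
  have cmp: "E r $ n = E r' $ n + 2 * (U * psum ks) $ n" if "n < m + 1" for n
    using ceq_nth[OF 2 that] unfolding D fps_add_nth even_fps_nth(2) by simp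
  obtain V' V'' where V: "loop_v X p = X + X\<^sup>2 * V'" "loop_v X q = X + X\<^sup>2 * V''"
    using loop_nth(3)[OF ge(1)] loop_nth(3)[OF ge(2)] by (auto simp: dvd_def algebra_simps)
  have A: "A = X\<^sup>2 * ((1 + X * V') * (1 + X * V''))" unfolding A_def V by algebra
  have An: "A $ 0 = 0" "A $ 1 = 0" "A $ 2 = 1" unfolding A fps_X_power_mult_nth by simp_all
  have "E r $ n = E r' $ n" if "n < m + 1" for n
    unfolding E_def
  proof (rule parity_loop[OF An ge(4,5) _ that])
    fix n assume "n < m + 1"
    from cmp[OF this]
    show "even (((-1) ^ r * X ^ (2 * r - 2) * A) $ n - ((-1) ^ r' * X ^ (2 * r' - 2) * A) $ n)"
      unfolding E_def by presburger
  qed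
  then have "(U * psum ks) $ m = 0" using cmp[of m] by simp
  moreover have "(U * psum ks) $ (m + 0) = U $ 0 * int (count_list ks m)"
    using nth_mult_psum[OF m(1), of U 0] by simp
  moreover have "U $ 0 = 1" unfolding U_def using loop_nth(1) ge by simp
  ultimately have "count_list ks m = 0" by simp
  then show False using m by (simp add: count_list_0_iff)
qed

lemma dumbbell_series_sym: "dumbbell_series X p q r = dumbbell_series X q p r"
  by (simp add: dumbbell_series_def algebra_simps)

theorem dumbbell_series_determined:
  assumes eq: "dumbbell_series X p q r = dumbbell_series X p' q' r' * prod_list (map (cycle_series X) ks)"
    and ge: "p \<ge> 3" "q \<ge> 3" "p' \<ge> 3" "q' \<ge> 3" "\<forall>k\<in>set ks. k \<ge> 3" "r \<ge> 2" "r' \<ge> 2"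
  shows "ks = []" "p = p' \<and> q = q' \<or> p = q' \<and> q = p'"
proof -
  have "p = p' \<and> q = q' \<or> p = q' \<and> q = p'"
  proof -
    consider "p = p'" | "p = q'" | "q = p'" | "q = q'"
      using dumbbell_cycles_disjoint[OF eq ge] by auto
    then show ?thesis
    proof cases
      case 1
      then show ?thesis using dumbbell_cycles_shared[of p q r q' r' ks] eq ge by auto
    next
      case 2
      then show ?thesis using dumbbell_cycles_shared[of p q r p' r' ks] eq ge dumbbell_series_sym[of p' q' r'] by auto
    next
      case 3
      then show ?thesis using dumbbell_cycles_shared[of q p r q' r' ks] eq ge dumbbell_series_sym[of p q r] by auto
    next
      case 4
      then show ?thesis
        using dumbbell_cycles_shared[of q p r p' r' ks] eq ge dumbbell_series_sym[of p q r] dumbbell_series_sym[of p' q' r'] by auto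
    qed
  qed
  then show "p = p' \<and> q = q' \<or> p = q' \<and> q = p'" .
  then have "dumbbell_series X p' q' r' = dumbbell_series X p q r'"
    using dumbbell_series_sym[of p q r'] by auto
  then show "ks = []" using dumbbell_cycles_same[of p q r r' ks] eq ge by simp
qed

declare [[simproc del: poly_fps_eq]]

section \<open>A dumbbell against a theta graph with cycles\<close>

lemma theta_equations:
  fixes p q r i j k m :: nat and ks :: "nat list"
  assumes eq: "dumbbell_series X p q r = theta_series X i j k * prod_list (map (cycle_series X) ks)"
    and m: "3 \<le> m" "m \<le> p" "m \<le> q" "i \<le> j" "j \<le> k" "1 \<le> j" "m \<le> i + j + 2" "\<forall>k\<in>set ks. m \<le> k" and r: "r \<ge> 2"
  defines "b \<equiv> \<lambda>n. bcoeff r n - (bcoeff (i + 2) n + bcoeff (j + 2) n + bcoeff (k + 2) n)"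
  defines "c \<equiv> \<lambda>n. int (count_list [p, q] n)" and "t \<equiv> \<lambda>n. int (count_list [i + j + 2, i + k + 2, j + k + 2] n)"
    and "l \<equiv> \<lambda>n. int (count_list ks n)"
  shows "n < m + 3 \<or> n = m + 3 \<and> m \<ge> 4 \<Longrightarrow> even (b n)"
    "2 * c m + b m = 2 * t m + 2 * l m"
    "2 * (c m + c (m + 1)) + b (m + 1) = 2 * t (m + 1) + 2 * (2 * l m + l (m + 1))"
    "2 * (3 * c m + c (m + 1) + c (m + 2)) + b (m + 2) =
       2 * (2 * t m + t (m + 2)) + 2 * (5 * l m + 2 * l (m + 1) + l (m + 2))"
    "m \<ge> 4 \<Longrightarrow> 2 * (c m + 3 * c (m + 1) + c (m + 2) + c (m + 3)) + b (m + 3) + (if r = 2 then 2 * c m else 0) =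
       2 * (2 * t (m + 1) + t (m + 3)) + 2 * (4 * l m + 5 * l (m + 1) + 2 * l (m + 2) + l (m + 3))"
proof -
  note cmp = theta_compare[OF eq m r]
  note D = dumbbell_dev_nth[OF m(2,3) r] and T = theta_dev_nth[OF m(4,5,7)] and K = series_coeffs(5-8)[OF m(8)]
  show "even (b n)" if "n < m + 3 \<or> n = m + 3 \<and> m \<ge> 4"
    using cmp[OF that] dumbbell_dev_parity[of p q r n] theta_dev_parity[of i j k n] unfolding b_def by presburger
  have lt: "m < m + 3 \<or> m = m + 3 \<and> m \<ge> 4" "m + 1 < m + 3 \<or> m + 1 = m + 3 \<and> m \<ge> 4" "m + 2 < m + 3 \<or> m + 2 = m + 3 \<and> m \<ge> 4"
    by simp_all
  show "2 * c m + b m = 2 * t m + 2 * l m"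
    using cmp[OF lt(1)] unfolding D T K b_def c_def t_def l_def by presburger
  show "2 * (c m + c (m + 1)) + b (m + 1) = 2 * t (m + 1) + 2 * (2 * l m + l (m + 1))"
    using cmp[OF lt(2)] unfolding D T K b_def c_def t_def l_def by presburger
  show "2 * (3 * c m + c (m + 1) + c (m + 2)) + b (m + 2) =
       2 * (2 * t m + t (m + 2)) + 2 * (5 * l m + 2 * l (m + 1) + l (m + 2))"
    using cmp[OF lt(3)] unfolding D T K b_def c_def t_def l_def by presburger
  show "2 * (c m + 3 * c (m + 1) + c (m + 2) + c (m + 3)) + b (m + 3) + (if r = 2 then 2 * c m else 0) =
       2 * (2 * t (m + 1) + t (m + 3)) + 2 * (4 * l m + 5 * l (m + 1) + 2 * l (m + 2) + l (m + 3))" if "m \<ge> 4"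
  proof -
    have "m + 3 < m + 3 \<or> m + 3 = m + 3 \<and> m \<ge> 4" using that by simp
    from cmp[OF this] show ?thesis unfolding D T K b_def c_def t_def l_def by presburger
  qed
qed

lemma bcoeff_low: "n < 2 * r \<Longrightarrow> bcoeff r n = 0"
  by (simp add: bcoeff_def)

lemma bcoeff_diag: "bcoeff r (2 * r) = (-1) ^ r" "odd (bcoeff r (2 * r))"
  by (simp_all add: bcoeff_def)

lemma bcoeff_even_zero:
  assumes "\<And>n. n < N \<Longrightarrow> even (bcoeff r n)" "n < N"
  shows "bcoeff r n = 0"
  using assms bcoeff_diag(2)[of r] bcoeff_low[of n r] by (metis not_less order.strict_trans1)

lemma member_le_sum_list_nat: "(k :: nat) \<in> set ks \<Longrightarrow> k \<le> sum_list ks"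
  by (rule member_le_sum_list) simp_all

lemma prod_list_map_remove1:
  "x \<in> set xs \<Longrightarrow> prod_list (map f xs) = f x * (prod_list (map f (remove1 x xs)) :: 'b :: comm_monoid_mult)"
  by (induction xs) (auto simp: mult.left_commute)

text \<open>The two families below escape the comparison of the first few coefficients. The second one agrees
  with its dumbbell to high order, because the reflection swapping two equal paths with an odd number of
  inner vertices splits a factor off the permanent.\<close>

lemma theta_asym_exception:
  assumes eq: "dumbbell_series X 3 q 2 = theta_series X 0 1 2 * prod_list (map (cycle_series X) ks)"
    and q: "q \<ge> 8" and ks: "\<forall>k\<in>set ks. k \<ge> 6"
  shows False
proof -
  \<comment> \<open>Both series have the coefficients of \<open>s\<close> below degree 6. At degree
    6 they have 4 and 3, an odd difference, while cycles of length at least 6 change that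
    coefficient by an even amount.\<close>
  define s :: "int fps" where "s = 1 + 2 * X + 5 * X ^ 2 + 6 * X ^ 3 + 7 * X ^ 4 + 8 * X ^ 5"
  define q' e where "q' = q - 8" and "e = ((-1) ^ q :: int fps)"
  have "q = 8 + q'" "2 * q = 8 + (8 + 2 * q')" using q by (simp_all add: q'_def)
  then have pw: "X ^ q = X ^ 8 * X ^ q'" "X ^ (2 * q) = X ^ 8 * (X ^ 8 * X ^ (2 * q'))"
    by (metis power_add)+
  have U3: "loop_u X 3 = 1 + X + 2 * X ^ 2 + 2 * X ^ 3 + 2 * X ^ 5 - X ^ 6 + X ^ 7"
    by (simp add: loop_u_def algebra_simps flip: power_add power_Suc)
  have V3: "loop_v X 3 = X + X ^ 2 + 2 * X ^ 3 + 2 * X ^ 5 - 2 * X ^ 6 + X ^ 7 - X ^ 8"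
    by (simp add: loop_v_def algebra_simps power2_eq_square flip: power_add power_Suc)
  define A A2 where "A = X ^ q'" and "A2 = X ^ (2 * q')"
  have "dumbbell_series X 3 q 2 = loop_u X 3 * loop_u X q + X ^ 2 * loop_v X 3 * loop_v X q"
    by (simp add: dumbbell_series_def)
  also have "\<dots> = (s + 4 * X ^ 6) + X ^ 7 * (6 + X + 2 * X ^ 2 - X ^ 3 - X ^ 5
      + loop_u X 3 * X * (2 * (1 + X\<^sup>2) * A + e * (1 - X) * X ^ 8 * A2)
      + X ^ 3 * loop_v X 3 * (2 * (1 + X\<^sup>2) * A + e * (2 - X + X\<^sup>2) * X ^ 8 * A2))"
    unfolding U3 V3 loop_u_def[of _ q] loop_v_def[of _ q] pw s_def A_def[symmetric] A2_def[symmetric] e_def[symmetric]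
    by algebra
  finally have "ceq 7 (dumbbell_series X 3 q 2) (s + 4 * X ^ 6)" by (simp add: ceq_def)
  from ceq_nth[OF this, of 6] have "dumbbell_series X 3 q 2 $ 6 = s $ 6 + 4"
    by (simp add: numeral_fps_const fps_X_power_nth)
  moreover have "theta_series X 0 1 2 $ 6 = s $ 6 + 3"
  proof -
    have hs: "(-1) ^ Suc 0 * X ^ (2 * 0) = -1" "(-1) ^ Suc 1 * X ^ (2 * 1) = X ^ 2" "(-1) ^ Suc 2 * X ^ (2 * 2) = - (X ^ 4)"
      by simp_all
    have es: "X ^ (0 + 1) = X" "X ^ (0 + 2) = X ^ 2" "X ^ (1 + 2) = X ^ 3"
      by (simp_all add: power2_eq_square power3_eq_cube)
    have "theta_series X 0 1 2 = (1 + X + 2 * X\<^sup>2)\<^sup>2 - X ^ 4 * (1 + X)\<^sup>2 * (- 1 + X ^ 2 - X ^ 4)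
       + X ^ 4 * (1 - X)\<^sup>2 * (- (X ^ 2) + X ^ 4 - X ^ 6) - X ^ 6 * (2 - X + X\<^sup>2)\<^sup>2 * X ^ 6
       + 2 * (1 + X\<^sup>2)\<^sup>2 * X\<^sup>2 * (X * (1 + X ^ 6) + X ^ 2 * (1 - X ^ 4) + X ^ 3 * (1 + X ^ 2))"
      unfolding theta_series_def Let_def hs es by algebra
    also have "\<dots> = (s + 3 * X ^ 6) + X ^ 7 * ((8) * X ^ 0 + (8) * X ^ 2 + (-3) * X ^ 3 + (8) * X ^ 4 + (-7) * X ^ 5 + (6) * X ^ 6 + (-5) * X ^ 7 + (2) * X ^ 8 + (-1) * X ^ 9)"
      unfolding s_def by algebra
    finally have "ceq 7 (theta_series X 0 1 2) (s + 3 * X ^ 6)" by (simp add: ceq_def)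
    from ceq_nth[OF this, of 6] show ?thesis by (simp add: numeral_fps_const fps_X_power_nth)
  qed
  moreover have "dumbbell_series X 3 q 2 $ 6 = theta_series X 0 1 2 $ 6 + 2 * (theta_series X 0 1 2 * psum ks) $ 6"
  proof -
    have "ceq 7 (theta_series X 0 1 2 * prod_list (map (cycle_series X) ks)) (theta_series X 0 1 2 * (1 + 2 * psum ks))"
      using ks by (intro ceq_mult ceq_cycles[where m = 6]) (auto simp: ceq_def)
    from ceq_nth[OF this, of 6] have "dumbbell_series X 3 q 2 $ 6 = (theta_series X 0 1 2 + 2 * (theta_series X 0 1 2 * psum ks)) $ 6"
      unfolding eq by (simp add: algebra_simps)
    then show ?thesis unfolding fps_add_nth even_fps_nth(2) .
  qed
  ultimately have "s $ 6 + 4 = s $ 6 + 3 + 2 * (theta_series X 0 1 2 * psum ks) $ 6" by (simp only:)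
  then show False by presburger
qed

lemma theta_sym_exception:
  assumes eq: "dumbbell_series X (2 * i + 2) (2 * i + 2) r = theta_series X i i k * prod_list (map (cycle_series X) ks)"
    and i: "odd i" "k \<ge> i + 3" "2 * i + 2 \<in> set ks" and ks: "\<forall>k\<in>set ks. k \<ge> 3"
    and n: "2 * (2 * i + 2) + r = i + i + k + 4 + sum_list ks"
  shows False
proof -
  define a B w where "a = X ^ (2 * i + 2)" and "B = 1 + X + 2 * X\<^sup>2" and "w = 1 + X\<^sup>2"
  define ks' where "ks' = remove1 (2 * i + 2) ks"
  have ks': "sum_list ks = 2 * i + 2 + sum_list ks'" "\<forall>k\<in>set ks'. k \<ge> 3"
    "prod_list (map (cycle_series X) ks) = cycle_series X (2 * i + 2) * prod_list (map (cycle_series X) ks')"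
  proof -
    show "sum_list ks = 2 * i + 2 + sum_list ks'"
      unfolding ks'_def using sum_list_map_remove1[OF i(3), of "\<lambda>x. x"] by simp
    show "\<forall>k\<in>set ks'. k \<ge> 3" using ks set_remove1_subset[of "2 * i + 2" ks] by (auto simp: ks'_def)
    show "prod_list (map (cycle_series X) ks) = cycle_series X (2 * i + 2) * prod_list (map (cycle_series X) ks')"
      unfolding ks'_def using prod_list_map_remove1[OF i(3), of "cycle_series X"] .
  qed
  \<comment> \<open>The dumbbell path has at least k + 2 vertices, so its term has order at least 2
    k + 4, like that of the third theta path.\<close>
  have r: "r = k + 2 + sum_list ks'" using n ks'(1) by simp
  \<comment> \<open>The first degree at which a longer cycle of the theta graph or a further
    separate cycle shows.\<close>
  define \<nu> where "\<nu> = Min (set ((i + k + 2) # ks'))"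
  have \<nu>: "\<nu> \<le> i + k + 2" "\<forall>k\<in>set ks'. \<nu> \<le> k" "\<nu> \<in> set ((i + k + 2) # ks')"
  proof -
    show "\<nu> \<in> set ((i + k + 2) # ks')" unfolding \<nu>_def by (intro Min_in) simp_all
    show "\<nu> \<le> i + k + 2" "\<forall>k\<in>set ks'. \<nu> \<le> k" unfolding \<nu>_def by (auto intro!: Min_le)
  qed
  have \<nu>3: "\<nu> \<ge> 3" using \<nu>(3) ks'(2) i by auto
  \<comment> \<open>For the even length 2 i + 2, the looped cycle and the plain cycle both have
    series divisible by 1 + a.\<close>
  define U where "U = (1 + a) * (B + (1 - X) * a)"
  have pa: "X ^ (2 * (2 * i + 2)) = a\<^sup>2"
    unfolding a_def power_mult[symmetric] by (rule arg_cong[where f = "(^) X"]) simp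
  have U: "loop_u X (2 * i + 2) = U"
  proof -
    have e: "(-1) ^ (2 * i + 2) = (1 :: int fps)" by simp
    show ?thesis unfolding e loop_u_def pa a_def[symmetric] U_def B_def by algebra
  qed
  have cyc: "cycle_series X (2 * i + 2) = (1 + a)\<^sup>2"
  proof -
    have e: "(-1) ^ (2 * i + 2) = (1 :: int fps)" by simp
    show ?thesis unfolding e cycle_series_def pa a_def[symmetric] by algebra
  qed
  define x g where "x = X ^ (2 * i)" and "g = (-1) ^ Suc k * X ^ (2 * k)"
  have a: "a = X\<^sup>2 * x" by (simp only: a_def x_def power_add mult.commute)
  have xi: "X ^ (i + i) = x" by (simp add: x_def mult_2)
  have hx: "(-1) ^ Suc i * X ^ (2 * i) = x" using i(1) by (simp add: x_def)
  define E where "E = X ^ (i + k + 2) * (4 * w\<^sup>2 * (1 - a) * (1 + a)\<^sup>2)"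
  define G where "G = - (X ^ 4 * (1 + X)\<^sup>2) + X ^ 4 * (1 - X)\<^sup>2 * 2 * x - X ^ 6 * (2 - X + X\<^sup>2)\<^sup>2 * x * x - 2 * w\<^sup>2 * X ^ 4 * x"
  \<comment> \<open>The extra cycle turns the theta graph into the square of the looped cycle, up to
    \<open>E\<close>, which stems from the two longer theta cycles, and the terms of the third
    path.\<close>
  have T: "theta_series X i i k * (1 + a)\<^sup>2 = U * U + E + g * (G * (1 + a)\<^sup>2)"
  proof -
    have t: "theta_series X i i k = B\<^sup>2 - X ^ 4 * (1 + X)\<^sup>2 * (x + x + g) + X ^ 4 * (1 - X)\<^sup>2 * (x * x + x * g + x * g)
       - X ^ 6 * (2 - X + X\<^sup>2)\<^sup>2 * x * x * g
       + 2 * w\<^sup>2 * X\<^sup>2 * (x * (1 - X\<^sup>2 * g) + X ^ (i + k) * (1 - X\<^sup>2 * x) + X ^ (i + k) * (1 - X\<^sup>2 * x))"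
      unfolding theta_series_def Let_def hx xi g_def[symmetric] B_def w_def by (rule refl)
    show ?thesis unfolding t U_def E_def G_def power_add a B_def w_def by algebra
  qed
  have g4: "X ^ (2 * k + 4) dvd g * (G * (1 + a)\<^sup>2)"
  proof -
    have "G = X ^ 4 * (- ((1 + X)\<^sup>2) + (1 - X)\<^sup>2 * 2 * x - X\<^sup>2 * (2 - X + X\<^sup>2)\<^sup>2 * x * x - 2 * w\<^sup>2 * x)"
      unfolding G_def by algebra
    then obtain G' where G': "G = X ^ 4 * G'" by blast
    have "g * (G * (1 + a)\<^sup>2) = X ^ (2 * k + 4) * ((-1) ^ Suc k * G' * (1 + a)\<^sup>2)"
      unfolding g_def power_add G' by algebra
    then show ?thesis by simp
  qed
  have N: "\<nu> + 1 \<le> 2 * k + 4" using \<nu>(1) i(2) by simp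
  have 1: "ceq (\<nu> + 1) (dumbbell_series X (2 * i + 2) (2 * i + 2) r) (U * U)"
  proof -
    have "X dvd loop_v X (2 * i + 2)"
      unfolding loop_v_def by (intro dvd_add) (auto simp: power_add)
    then obtain V where V: "loop_v X (2 * i + 2) = X * V" by (auto simp: dvd_def)
    have e: "2 * r - 2 = (2 * k + 2) + 2 * sum_list ks'" using r by simp
    have "dumbbell_series X (2 * i + 2) (2 * i + 2) r - U * U =
        X ^ (2 * k + 2) * X ^ 2 * ((-1) ^ r * X ^ (2 * sum_list ks') * V * V)"
      unfolding dumbbell_series_def U V e power_add by algebra
    also have "\<dots> = X ^ (2 * k + 4) * ((-1) ^ r * X ^ (2 * sum_list ks') * V * V)"
      unfolding power_add by algebra
    finally show ?thesis unfolding ceq_def using X_power_dvd[OF N] by (simp only:) (rule dvd_mult2)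
  qed
  have 2: "ceq (\<nu> + 1) (theta_series X i i k * (1 + a)\<^sup>2) (U * U + E)"
    unfolding ceq_def T using dvd_trans[OF X_power_dvd[OF N] g4] by simp
  have Edvd: "X ^ \<nu> dvd E" unfolding E_def by (intro dvd_mult2 X_power_dvd \<nu>(1))
  have 3: "ceq (\<nu> + 1) (dumbbell_series X (2 * i + 2) (2 * i + 2) r) (U * U + E + 2 * (U * U * psum ks'))"
  proof -
    have "ceq (\<nu> + 1) (theta_series X i i k * (1 + a)\<^sup>2 * prod_list (map (cycle_series X) ks'))
        (U * U + E + 2 * (U * U * psum ks'))"
      by (rule ceq_mult_cycles[OF 2 Edvd, where m = \<nu>]) (use \<nu> \<nu>3 in auto)
    then show ?thesis unfolding eq ks'(3) cyc by (simp only: mult.assoc)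
  qed
  have "(U * U) $ \<nu> = (U * U + E + 2 * (U * U * psum ks')) $ \<nu>"
    using ceq_nth[OF 1, of \<nu>] ceq_nth[OF 3, of \<nu>] by simp
  then have zero: "E $ \<nu> + 2 * (U * U * psum ks') $ \<nu> = 0"
    unfolding fps_add_nth even_fps_nth(2) by simp
  have a0: "a $ 0 = 0" by (simp add: a_def)
  have "(U * U * psum ks') $ (\<nu> + 0) = (U * U) $ 0 * int (count_list ks' \<nu>)"
    using nth_mult_psum[OF \<nu>(2), of "U * U" 0] by simp
  moreover have "(U * U) $ 0 = 1" by (simp add: U_def B_def a0 numeral_fps_const)
  ultimately have "(U * U * psum ks') $ \<nu> = int (count_list ks' \<nu>)" by simp
  moreover have "E $ \<nu> = (if \<nu> = i + k + 2 then 4 else 0)"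
    unfolding E_def fps_X_power_mult_nth using \<nu>(1) by (simp add: a0 w_def numeral_fps_const power2_eq_square)
  moreover have "\<nu> = i + k + 2 \<or> count_list ks' \<nu> > 0" using \<nu>(3) by (auto simp: count_list_0_iff simp flip: neq0_conv)
  \<comment> \<open>Both contributions are nonnegative and one of them is positive, so they cannot
    cancel.\<close>
  ultimately show False using zero by (auto split: if_splits)
qed

text \<open>As i < j, the two longer paths start at 2 (j + 2) \<ge> m + 3. Below that, parity gives
  r = i + 2, and counting cycles degree by degree forces inner lengths i, i + 1, i + 2, which the
  coefficient at 2 (j + 2) excludes.\<close>

lemma theta_cycles_asym:
  assumes eq: "dumbbell_series X p q r = theta_series X i j k * prod_list (map (cycle_series X) ks)"
    and ge: "p \<ge> 3" "q \<ge> 3" "\<forall>k\<in>set ks. k \<ge> 3" "r \<ge> 2" "p \<le> q" and ijk: "i < j" "j \<le> k"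
    and sum: "p + q + r = i + j + k + 4 + sum_list ks"
  shows False
proof -
  define m where "m = Min (set ([p, q, i + j + 2] @ ks))"
  have m_le: "m \<le> x" if "x \<in> set ([p, q, i + j + 2] @ ks)" for x
    unfolding m_def using that by (intro Min_le) simp_all
  have m_in: "m \<in> set ([p, q, i + j + 2] @ ks)"
    unfolding m_def by (intro Min_in) simp_all
  have m: "3 \<le> m" "m \<le> p" "m \<le> q" "i \<le> j" "j \<le> k" "1 \<le> j" "m \<le> i + j + 2" "\<forall>k\<in>set ks. m \<le> k"
    using m_in m_le ge ijk by auto
  define c t l where "c = (\<lambda>n. int (count_list [p, q] n))" and "t = (\<lambda>n. int (count_list [i + j + 2, i + k + 2, j + k + 2] n))"
    and "l = (\<lambda>n. int (count_list ks n))"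
  have nonneg: "c n \<ge> 0" "t n \<ge> 0" "l n \<ge> 0" for n by (simp_all add: c_def t_def l_def)
  have l_mem: "l n > 0 \<longleftrightarrow> n \<in> set ks" for n by (metis count_list_0_iff l_def of_nat_0_less_iff not_gr_zero)
  define b where "b = (\<lambda>n. bcoeff r n - (bcoeff (i + 2) n + bcoeff (j + 2) n + bcoeff (k + 2) n))"
  note even_b = theta_equations(1)[OF eq m ge(4)]
  have F: "2 * c m + b m = 2 * t m + 2 * l m"
    "2 * (c m + c (m + 1)) + b (m + 1) = 2 * t (m + 1) + 2 * (2 * l m + l (m + 1))"
    "2 * (3 * c m + c (m + 1) + c (m + 2)) + b (m + 2) =
       2 * (2 * t m + t (m + 2)) + 2 * (5 * l m + 2 * l (m + 1) + l (m + 2))"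
    "m \<ge> 4 \<Longrightarrow> 2 * (c m + 3 * c (m + 1) + c (m + 2) + c (m + 3)) + b (m + 3) + (if r = 2 then 2 * c m else 0) =
       2 * (2 * t (m + 1) + t (m + 3)) + 2 * (4 * l m + 5 * l (m + 1) + 2 * l (m + 2) + l (m + 3))"
    unfolding b_def c_def t_def l_def by (fact theta_equations[OF eq m ge(4)])+
  have high: "bcoeff (j + 2) n = 0" "bcoeff (k + 2) n = 0" if "n < m + 3" for n
    using that m ijk by (auto intro!: bcoeff_low)
  have br: "bcoeff r n = bcoeff (i + 2) n" if "n < m + 3" for n
  proof (rule parity_bcoeff[OF _ that])
    fix n assume n: "n < m + 3"
    show "even (bcoeff r n - bcoeff (i + 2) n)" using even_b[of n] high[OF n] n by simp
  qed
  have b0: "b n = 0" if "n < m + 3" for n using br[OF that] high[OF that] by (simp add: b_def)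
  have E0: "c m = t m + l m" using F(1) b0[of m] by simp
  have E1: "c m + c (m + 1) = t (m + 1) + 2 * l m + l (m + 1)" using F(2) b0[of "m + 1"] by simp
  have E2: "3 * c m + c (m + 1) + c (m + 2) = 2 * t m + t (m + 2) + 5 * l m + 2 * l (m + 1) + l (m + 2)"
    using F(3) b0[of "m + 2"] by simp
  have c2: "c m + c (m + 1) + c (m + 2) \<le> 2" by (simp add: c_def)
  \<comment> \<open>Subtracting twice \<open>E0\<close> from \<open>E2\<close> leaves three times
    \<open>l m\<close> on the right and a sum of at most 2 on the left.\<close>
  have l0: "l m = 0" using E0 E2 c2 nonneg[of m] nonneg[of "m + 1"] nonneg[of "m + 2"] by linarith
  have E2': "c m + c (m + 1) + c (m + 2) = t (m + 2) + 2 * l (m + 1) + l (m + 2)" using E0 E2 l0 by linarith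
  have mg: "m = i + j + 2"
  proof (rule ccontr)
    assume "m \<noteq> i + j + 2"
    then have "m \<in> set [p, q]" using m_in l_mem[of m] l0 by auto
    then have "c m > 0" by (metis c_def count_list_0_iff not_gr_zero of_nat_0_less_iff)
    then have "t m > 0" using E0 l0 by simp
    then show False using \<open>m \<noteq> i + j + 2\<close> m by (auto simp: t_def split: if_splits)
  qed
  \<comment> \<open>Since i < j, the degree 2 (i + 2) lies below m + 3, so the shortest theta path
    is visible and has to be matched.\<close>
  have r: "r = i + 2"
  proof (rule linorder_cases[of r "i + 2"])
    assume "r < i + 2"
    then show ?thesis using br[of "2 * r"] bcoeff_low[of "2 * r" "i + 2"] bcoeff_diag(1)[of r] mg ijk by auto
  next
    assume "r > i + 2"
    then show ?thesis using br[of "2 * (i + 2)"] bcoeff_low[of "2 * (i + 2)" r] bcoeff_diag(1)[of "i + 2"] mg ijk by auto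
  qed
  have t: "t m = 1 + (if k = j then 1 else 0)" "t (m + 1) = (if k = j + 1 then 1 else 0) + (if k = i + 1 then 1 else 0)"
    "t (m + 2) = (if k = j + 2 then 1 else 0) + (if k = i + 2 then 1 else 0)"
    using ijk by (auto simp: t_def mg)
  have mem_le: "l n > 0 \<Longrightarrow> n \<le> sum_list ks" for n using l_mem member_le_sum_list_nat by blast
  show False
  proof (cases "k = j")
    case True
    then have "c m = 2" using E0 l0 t by simp
    then have pq: "p = m" "q = m" by (auto simp: c_def split: if_splits)
    then have "c (m + 1) = 0" by (simp add: c_def)
    then have "l (m + 1) > 0" using E1 \<open>c m = 2\<close> l0 t True by (auto split: if_splits)
    \<comment> \<open>The vertex count leaves 2 i + 2 vertices for the separate cycles, fewer than m
      + 1.\<close>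
    then show False using mem_le[of "m + 1"] sum pq mg r True ijk by simp
  next
    case False
    then have cm: "c m = 1" using E0 l0 t by simp
    then have p: "p = m" and qm: "q \<noteq> m" using ge(5) m by (auto simp: c_def split: if_splits)
    \<comment> \<open>So \<open>q\<close> exceeds every separate cycle length by at least k - i
      \<ge> 2.\<close>
    have q: "q + i = k + sum_list ks" using sum p mg r by simp
    have cq: "c (m + 1) = (if q = m + 1 then 1 else 0)" "c (m + 2) = (if q = m + 2 then 1 else 0)" "c (m + 3) = (if q = m + 3 then 1 else 0)"
      using p qm by (simp_all add: c_def)
    show False
    proof (cases "l (m + 1) > 0")
      case True
      then have "q > m + 2" using mem_le[of "m + 1"] q mg False ijk by simp
      then show False using E2' cm cq True nonneg[of "m + 2"] by simp
    next
      case l1: False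
      then have l1: "l (m + 1) = 0" using nonneg[of "m + 1"] by simp
      \<comment> \<open>At degree m + 1 the cycle of length \<open>m\<close> counts once for the
        dumbbell but not at all for the theta graph; only a second theta cycle, of length m + 1,
        restores the balance.\<close>
      have k: "k = j + 1" and c1: "c (m + 1) = 0"
        using E1 cm l0 l1 t cq False ijk by (auto split: if_splits)
      show False
      proof (cases "l (m + 2) > 0")
        case True
        then have qgt: "q > m + 3" using mem_le[of "m + 2"] q mg k ijk by simp
        then have l2: "l (m + 2) = 1" and "t (m + 2) = 0" using E2' cm c1 cq l1 True nonneg[of "m + 2"] by auto
        then have "j \<noteq> i + 1" using t k by (auto split: if_splits)
        then have j: "j \<ge> i + 2" using ijk by simp
        have "bcoeff (j + 2) (m + 3) = 0" "bcoeff (k + 2) (m + 3) = 0" using j k mg by (auto intro!: bcoeff_low)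
        then have b3: "b (m + 3) = 0" by (simp add: b_def r)
        have m4: "m \<ge> 4" using j mg by simp
        have "c m + (if r = 2 then c m else 0) = 2 * t (m + 1) + t (m + 3) + 2 * l (m + 2) + l (m + 3)"
          using F(4)[OF m4] b3 l0 l1 c1 cq qgt by (simp split: if_splits)
        then show False using cm l2 t k nonneg[of "m + 3"] by (auto split: if_splits)
      next
        case l2: False
        then have l2: "l (m + 2) = 0" using nonneg[of "m + 2"] by simp
        \<comment> \<open>At degree m + 2 the third theta cycle, of length j + k + 2, has to balance
          in the same way.\<close>
        have j: "j = i + 1" using E2' cm c1 l1 l2 t k cq by (auto split: if_splits)
        have mm: "m = 2 * i + 3" using mg j by simp
        have "ks \<noteq> []" using q k j ge by auto
        have ks_ge: "\<forall>n\<in>set ks. n \<ge> m + 3"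
        proof
          fix n assume n: "n \<in> set ks"
          then have "l n > 0" using l_mem by simp
          then have "n \<noteq> m" "n \<noteq> m + 1" "n \<noteq> m + 2" using l0 l1 l2 by auto
          then show "n \<ge> m + 3" using m n by (metis Suc_eq_plus1 add_2_eq_Suc' add_Suc_right le_antisym not_less_eq_eq numeral_3_eq_3 add_0_right add_Suc)
        qed
        obtain n where n: "n \<in> set ks" using \<open>ks \<noteq> []\<close> by (cases ks) auto
        have qge: "q \<ge> m + 5" using n ks_ge member_le_sum_list_nat[OF n] q k j by fastforce
        show False
        proof (cases "i = 0")
          case True
          \<comment> \<open>For i = 0 the minimum is m = 3, and degree m + 3 is out of reach of
            \<open>theta_compare\<close>.\<close>
          have "dumbbell_series X 3 q 2 = theta_series X 0 1 2 * prod_list (map (cycle_series X) ks)"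
            using eq p mm r k j True by (simp add: numeral_eq_Suc)
          then show False by (rule theta_asym_exception) (use qge ks_ge mm True in auto)
        next
          case False
          then have "even (bcoeff r (m + 3) - (bcoeff (i + 2) (m + 3) + bcoeff (j + 2) (m + 3) + bcoeff (k + 2) (m + 3)))"
            using even_b[of "m + 3"] mm by simp
          moreover have "bcoeff (k + 2) (m + 3) = 0" using k j mm by (intro bcoeff_low) simp
          \<comment> \<open>This is the degree at which the path with \<open>j\<close> inner
            vertices enters with an odd coefficient; everything else cancels or is even.\<close>
          moreover have "m + 3 = 2 * (j + 2)" using j mm by simp
          ultimately show False using r bcoeff_diag(2)[of "j + 2"] by simp
        qed
      qed
    qed
  qed
qed

text \<open>Modulo 2 the two equal paths cancel, so parity sees only \<open>r\<close> and the third
  path. Their doubled term acts like a cycle of length 2 i + 4 with sign (-1)^i; for odd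
  \<open>i\<close> it can compensate a separate cycle of length 2 i + 2, the case left to
  \<open>theta_sym_exception\<close>.\<close>

lemma theta_cycles_sym:
  assumes eq: "dumbbell_series X p q r = theta_series X i i k * prod_list (map (cycle_series X) ks)"
    and ge: "p \<ge> 3" "q \<ge> 3" "\<forall>k\<in>set ks. k \<ge> 3" "r \<ge> 2" and ik: "1 \<le> i" "i \<le> k"
    and sum: "p + q + r = i + i + k + 4 + sum_list ks"
  shows False
proof -
  define m where "m = Min (set ([p, q, i + i + 2] @ ks))"
  have m_le: "m \<le> x" if "x \<in> set ([p, q, i + i + 2] @ ks)" for x
    unfolding m_def using that by (intro Min_le) simp_all
  have m_in: "m \<in> set ([p, q, i + i + 2] @ ks)"
    unfolding m_def by (intro Min_in) simp_all
  have m: "3 \<le> m" "m \<le> p" "m \<le> q" "i \<le> i" "i \<le> k" "1 \<le> i" "m \<le> i + i + 2" "\<forall>k\<in>set ks. m \<le> k"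
    using m_in m_le ge ik by auto
  define c t l where "c = (\<lambda>n. int (count_list [p, q] n))" and "t = (\<lambda>n. int (count_list [i + i + 2, i + k + 2, i + k + 2] n))"
    and "l = (\<lambda>n. int (count_list ks n))"
  have nonneg: "c n \<ge> 0" "t n \<ge> 0" "l n \<ge> 0" for n by (simp_all add: c_def t_def l_def)
  define b where "b = (\<lambda>n. bcoeff r n - (bcoeff (i + 2) n + bcoeff (i + 2) n + bcoeff (k + 2) n))"
  note even_b = theta_equations(1)[OF eq m ge(4)]
  have F: "2 * c m + b m = 2 * t m + 2 * l m"
    "2 * (c m + c (m + 1)) + b (m + 1) = 2 * t (m + 1) + 2 * (2 * l m + l (m + 1))"
    "2 * (3 * c m + c (m + 1) + c (m + 2)) + b (m + 2) =
       2 * (2 * t m + t (m + 2)) + 2 * (5 * l m + 2 * l (m + 1) + l (m + 2))"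
    "m \<ge> 4 \<Longrightarrow> 2 * (c m + 3 * c (m + 1) + c (m + 2) + c (m + 3)) + b (m + 3) + (if r = 2 then 2 * c m else 0) =
       2 * (2 * t (m + 1) + t (m + 3)) + 2 * (4 * l m + 5 * l (m + 1) + 2 * l (m + 2) + l (m + 3))"
    unfolding b_def c_def t_def l_def by (fact theta_equations[OF eq m ge(4)])+
  have c4: "c m + c (m + 1) + c (m + 2) + c (m + 3) \<le> 2" by (simp add: c_def)
  have pos: "c m + t m + l m > 0"
  proof -
    have "count_list ([p, q] @ [i + i + 2, i + k + 2, i + k + 2] @ ks) m > 0"
      using m_in by (auto simp: count_list_0_iff simp flip: neq0_conv)
    then have "count_list [p, q] m + count_list [i + i + 2, i + k + 2, i + k + 2] m + count_list ks m > 0"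
      by (simp only: count_list_append add.assoc)
    then show ?thesis unfolding c_def t_def l_def by linarith
  qed
  have r_zero: "bcoeff r n = 0" if "n < N" "N \<le> m + 3 \<or> N = m + 4 \<and> m \<ge> 4" "N \<le> 2 * (k + 2)" for n N
  proof (rule bcoeff_even_zero[OF _ that(1)])
    fix n assume n: "n < N"
    then have "bcoeff (k + 2) n = 0" using that(3) by (intro bcoeff_low) simp
    moreover have "n < m + 3 \<or> n = m + 3 \<and> m \<ge> 4" using n that(2) by linarith
    ultimately show "even (bcoeff r n)" using even_b[of n] by auto
  qed
  show False
  proof (cases "m < i + i + 2")
    case True
    then have low: "bcoeff (i + 2) n = 0" "bcoeff (k + 2) n = 0" if "n < m + 3" for n
      using that ik by (auto intro!: bcoeff_low)
    then have b0: "b n = 0" if "n < m + 3" for n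
      using r_zero[of n "m + 3"] that True ik by (simp add: b_def)
    have "t m = 0" using True ik by (simp add: t_def)
    then show False using F(1,3) b0[of m] b0[of "m + 2"] c4 pos nonneg[of m] nonneg[of "m + 1"] nonneg[of "m + 2"] nonneg[of "m + 3"]
      by simp
  next
    case False
    then have mg: "m = i + i + 2" using m by simp
    show False
    proof (cases "k = i")
      case True
      have "b m = 0" using r_zero[of m "m + 2"] ik mg by (simp add: b_def bcoeff_low)
      moreover have "t m = 3" using True by (simp add: t_def mg)
      ultimately show False using F(1) c4 nonneg[of m] nonneg[of "m + 1"] nonneg[of "m + 2"] nonneg[of "m + 3"] by simp
    next
      case False
      then have k: "k \<ge> i + 1" using ik by simp
      have m4: "m \<ge> 4" using mg ik by simp
      define \<rho> where "\<rho> = ((-1) ^ i :: int)"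
      have \<rho>: "\<rho> = 1 \<or> \<rho> = -1" by (cases "even i") (simp_all add: \<rho>_def)
      have rz: "bcoeff r n = 0" if "n < m + 4" for n using r_zero[OF that] m4 k mg by simp
      \<comment> \<open>At degrees m + 2 = 2 (i + 2) and m + 3 the two equal paths contribute 2
        \<rho> and 4 \<rho>; the third path starts later.\<close>
      have b: "b m = 0" "b (m + 1) = 0" "b (m + 2) = - 2 * \<rho>" "b (m + 3) = - 4 * \<rho>"
        using k mg rz by (simp_all add: b_def bcoeff_def \<rho>_def)
      have r2: "r \<noteq> 2"
      proof
        assume "r = 2"
        then show False using rz[of 4] m4 by (simp add: bcoeff_def)
      qed
      have t: "t m = 1" "t (m + 1) = (if k = i + 1 then 2 else 0)" "t (m + 2) = (if k = i + 2 then 2 else 0)"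
        using k by (auto simp: t_def mg)
      have E: "c m = 1 + l m" "c m + c (m + 1) = t (m + 1) + 2 * l m + l (m + 1)"
        "3 * c m + c (m + 1) + c (m + 2) = 2 + t (m + 2) + 5 * l m + 2 * l (m + 1) + l (m + 2) + \<rho>"
        "c m + 3 * c (m + 1) + c (m + 2) + c (m + 3) = 2 * t (m + 1) + t (m + 3) + 4 * l m + 5 * l (m + 1) + 2 * l (m + 2) + l (m + 3) + 2 * \<rho>"
        using F m4 r2 unfolding b t(1) by simp_all
      note nn = nonneg[of m] nonneg[of "m + 1"] nonneg[of "m + 2"] nonneg[of "m + 3"]
      have "l m \<noteq> 0"
      proof
        assume l0: "l m = 0"
        show False
        proof (cases "k = i + 1")
          case True
          then have "t (m + 1) = 2" "t (m + 2) = 0" using t by simp_all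
          then show False using E l0 c4 nn by linarith
        next
          case False
          then have "t (m + 1) = 0" using t by simp
          then show False using E l0 c4 nn \<rho> by linarith
        qed
      qed
      then have l: "l m = 1" "c m = 2" using E(1) c4 nn by linarith+
      then have "c (m + 1) = 0" "c (m + 2) = 0" using c4 nn by linarith+
      \<comment> \<open>The balance at degree m + 2 reads 6 = 2 + 5 + \<rho> plus nonnegative terms,
        which leaves \<rho> = -1 and no room for further cycles.\<close>
      then have "t (m + 1) = 0" "t (m + 2) = 0" "\<rho> = -1" using E(2,3) l nn \<rho> by linarith+
      then have k3: "k \<ge> i + 3" and odd: "odd i" using t k by (auto simp: \<rho>_def split: if_splits)
      have pq: "p = 2 * i + 2" "q = 2 * i + 2" using l(2) mg by (auto simp: c_def split: if_splits)
      have "2 * i + 2 \<in> set ks" using l(1) mg by (metis count_list_0_iff l_def mult_2 of_nat_0 zero_neq_one)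
      then show False
        by (intro theta_sym_exception[OF eq[unfolded pq] odd k3 _ ge(3)]) (use sum pq in auto)
    qed
  qed
qed

theorem dumbbell_series_neq_theta:
  assumes eq: "dumbbell_series X p q r = theta_series X i j k * prod_list (map (cycle_series X) ks)"
    and ge: "p \<ge> 3" "q \<ge> 3" "\<forall>k\<in>set ks. k \<ge> 3" "r \<ge> 2" and ijk: "i \<le> j" "j \<le> k" "1 \<le> j"
    and sum: "p + q + r = i + j + k + 4 + sum_list ks"
  shows False
proof (cases "i = j")
  case True
  then show False using theta_cycles_sym[of p q r i k ks] assms by simp
next
  case False
  then have "i < j" using ijk by simp
  show False
  proof (cases "p \<le> q")
    case True
    show False by (rule theta_cycles_asym[OF eq ge True \<open>i < j\<close> ijk(2) sum])
  next
    case False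
    have "dumbbell_series X q p r = theta_series X i j k * prod_list (map (cycle_series X) ks)"
      using eq dumbbell_series_sym[of p q r] by simp
    from theta_cycles_asym[OF this ge(2,1,3,4) _ \<open>i < j\<close> ijk(2)] show False using False sum by simp
  qed
qed

section \<open>Coefficients of the permanental polynomial\<close>

text \<open>Integer polynomials are evaluated in two rings: integer polynomials themselves, to
  substitute 2 - x, and Laurent series.\<close>

definition int_poly_eval :: "'r::comm_ring_1 \<Rightarrow> int poly \<Rightarrow> 'r" where
  "int_poly_eval c p = poly (map_poly of_int p) c"

lemma int_poly_eval_pCons [simp]: "int_poly_eval c (pCons a p) = of_int a + c * int_poly_eval c p"
  by (cases "a = 0 \<and> p = 0") (auto simp: int_poly_eval_def map_poly_pCons)

lemma int_poly_eval_0 [simp]: "int_poly_eval c 0 = 0"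
  by (simp add: int_poly_eval_def)

lemma int_poly_eval_add [simp]: "int_poly_eval c (p + q) = int_poly_eval c p + int_poly_eval c q"
  by (induction p q rule: poly_induct2) (simp_all add: algebra_simps)

lemma int_poly_eval_smult [simp]: "int_poly_eval c (smult a p) = of_int a * int_poly_eval c p"
  by (induction p) (simp_all add: algebra_simps)

lemma int_poly_eval_mult [simp]: "int_poly_eval c (p * q) = int_poly_eval c p * int_poly_eval c q"
  by (induction p) (simp_all add: algebra_simps)

lemma int_poly_eval_uminus [simp]: "int_poly_eval c (- p) = - int_poly_eval c p"
  using int_poly_eval_smult[of c "-1" p] by simp

lemma int_poly_eval_diff [simp]: "int_poly_eval c (p - q) = int_poly_eval c p - int_poly_eval c q"
  using int_poly_eval_add[of c p "- q"] by simp

lemma int_poly_eval_1 [simp]: "int_poly_eval c 1 = 1"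
  by (simp add: one_pCons)

lemma int_poly_eval_sum: "int_poly_eval c (sum f A) = (\<Sum>x\<in>A. int_poly_eval c (f x))"
  by (induction A rule: infinite_finite_induct) simp_all

lemma int_poly_eval_prod: "int_poly_eval c (prod f A) = (\<Prod>x\<in>A. int_poly_eval c (f x))"
  by (induction A rule: infinite_finite_induct) simp_all

lemma int_poly_eval_permanent:
  "int_poly_eval c (permanent V M) = permanent V (\<lambda>u v. int_poly_eval c (M u v))"
  by (simp add: permanent_def int_poly_eval_sum int_poly_eval_prod)

lemma permanent_uminus:
  assumes "finite V"
  shows "permanent V (\<lambda>u v. - M u v) = (-1) ^ card V * permanent V M"
  using assms by (simp add: permanent_def prod_uminus sum_distrib_left)

lemma permanent_cong:
  assumes "\<And>u v. u \<in> V \<Longrightarrow> v \<in> V \<Longrightarrow> M u v = N u v"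
  shows "permanent V M = permanent V N"
  unfolding permanent_eq_pm using assms by (rule pm_cong)

lemma out_degree_eq_deg: "out_degree (with_proj G) v = deg (parcs G) v"
proof -
  have "out_arcs (with_proj G) v = Pair v ` nbrs (parcs G) v"
    by (auto simp: out_arcs_def nbrs_def)
  then show ?thesis by (simp add: out_degree_def card_image inj_on_def)
qed

lemma edges_on_pair_graph:
  assumes "pair_graph G"
  shows "edges_on (pverts G) (parcs G)"
proof -
  interpret pair_graph G by fact
  have "sym (parcs G)" using arcs_symmetric by (auto simp: sym_def)
  moreover have "irrefl (parcs G)" using no_loops by (metis irreflI fst_conv snd_conv)
  ultimately show ?thesis
    using pair_finite_verts in_arcsD1 in_arcsD2 by (auto simp: edges_on_def)
qed

text \<open>In the variable \<open>z = 2 - x\<close> a vertex of degree two contributes the diagonal entry \<open>z\<close>.\<close>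

lemma signless_laplacian_permanental_poly_eval:
  assumes "pair_graph G"
  shows "int_poly_eval (2 - z) (signless_laplacian_permanental_poly G) =
    (-1) ^ card (pverts G) *
      pm (weighted_adj (\<lambda>v. z + of_int (int (deg (parcs G) v) - 2)) (parcs G)) (pverts G) (pverts G)"
proof -
  have E: "edges_on (pverts G) (parcs G)" by (rule edges_on_pair_graph[OF assms])
  have "int_poly_eval (2 - z) (signless_laplacian_permanental_poly G) =
      permanent (pverts G) (\<lambda>u v. - weighted_adj (\<lambda>v. z + of_int (int (deg (parcs G) v) - 2)) (parcs G) u v)"
    unfolding signless_laplacian_permanental_poly_def int_poly_eval_permanent
  proof (rule permanent_cong)
    fix u v
    show "int_poly_eval (2 - z) ((if u = v then [:0, 1:] else 0) - [:signless_laplacian G u v:]) =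
        - weighted_adj (\<lambda>v. z + of_int (int (deg (parcs G) v) - 2)) (parcs G) u v"
      using E by (auto simp: signless_laplacian_def degree_matrix_def adjacency_matrix_def weighted_adj_def
          out_degree_eq_deg edges_on_def irrefl_def)
  qed
  also have "\<dots> = (-1) ^ card (pverts G) *
      permanent (pverts G) (weighted_adj (\<lambda>v. z + of_int (int (deg (parcs G) v) - 2)) (parcs G))"
    using E by (intro permanent_uminus) (simp add: edges_on_def)
  finally show ?thesis by (simp add: permanent_eq_pm)
qed

section \<open>The three leading coefficients\<close>

lemma sym_irrefl_induct [consumes 3, case_names empty edge]:
  assumes "finite E" "sym E" "irrefl E"
    and empty: "P {}"
    and edge: "\<And>E u v. finite E \<Longrightarrow> sym E \<Longrightarrow> irrefl E \<Longrightarrow> u \<noteq> v \<Longrightarrow> (u, v) \<notin> E \<Longrightarrow> (v, u) \<notin> E \<Longrightarrow> P E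
      \<Longrightarrow> P (insert (u, v) (insert (v, u) E))"
  shows "P E"
  using assms(1-3)
proof (induction "card E" arbitrary: E rule: less_induct)
  case less
  show ?case
  proof (cases "E = {}")
    case True
    then show ?thesis using empty by simp
  next
    case False
    then obtain u v where uv: "(u, v) \<in> E" by auto
    let ?E = "E - {(u, v), (v, u)}"
    have vu: "(v, u) \<in> E" "u \<noteq> v" using uv less.prems by (auto simp: sym_def irrefl_def)
    have "card ?E < card E" using uv less.prems by (intro psubset_card_mono) auto
    moreover have "finite ?E" "sym ?E" "irrefl ?E" using less.prems by (auto simp: sym_def irrefl_def)
    ultimately have "P (insert (u, v) (insert (v, u) ?E))"
      using vu less.hyps[of ?E] by (intro edge) auto
    moreover have "insert (u, v) (insert (v, u) ?E) = E" using uv vu by auto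
    ultimately show ?thesis by simp
  qed
qed

context
  fixes e :: "'a \<Rightarrow> int"
begin

abbreviation linear_adj :: "('a \<times> 'a) set \<Rightarrow> 'a \<Rightarrow> 'a \<Rightarrow> int poly" where
  "linear_adj E \<equiv> weighted_adj (\<lambda>v. [:e v, 1:]) E"

text \<open>Only diagonal entries have positive degree, and a bijection meets the diagonal in
  \<open>R \<inter> C\<close> only.\<close>

lemma degree_pm_linear_adj:
  assumes "finite R" "finite C"
  shows "degree (pm (linear_adj E) R C) \<le> card (R \<inter> C)"
  using assms
proof (induction R arbitrary: C rule: finite_induct)
  case empty
  show ?case
  proof (cases "C = {}")
    case False
    then obtain c where "c \<in> C" by auto
    then have "pm (linear_adj E) {} C = 0" by (intro pm_zero_column) auto
    then show ?thesis by simp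
  qed simp
next
  case (insert r R)
  have "pm (linear_adj E) (insert r R) C = (\<Sum>c\<in>C. linear_adj E r c * pm (linear_adj E) R (C - {c}))"
    using insert by (subst pm_expand_row[of _ _ r]) auto
  also have "degree \<dots> \<le> card (insert r R \<inter> C)"
  proof (rule degree_sum_le)
    fix c assume c: "c \<in> C"
    have IH: "degree (pm (linear_adj E) R (C - {c})) \<le> card (R \<inter> (C - {c}))" using insert by simp
    have "degree (linear_adj E r c) + card (R \<inter> (C - {c})) \<le> card (insert r R \<inter> C)"
    proof (cases "r = c")
      case True
      then have "insert r R \<inter> C = insert r (R \<inter> (C - {c}))" using c insert by auto
      then have "card (insert r R \<inter> C) = Suc (card (R \<inter> (C - {c})))" using insert True by simp
      then show ?thesis using True by (simp add: weighted_adj_def)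
    next
      case False
      then have "degree (linear_adj E r c) = 0" by (simp add: weighted_adj_def)
      moreover have "card (R \<inter> (C - {c})) \<le> card (insert r R \<inter> C)"
        using insert by (intro card_mono) auto
      ultimately show ?thesis by simp
    qed
    then show "degree (linear_adj E r c * pm (linear_adj E) R (C - {c})) \<le> card (insert r R \<inter> C)"
      using IH degree_mult_le[of "linear_adj E r c" "pm (linear_adj E) R (C - {c})"] by linarith
  qed (use insert in simp)
  finally show ?case .
qed

text \<open>The column \<open>v\<close> is deleted, so row \<open>v\<close> takes a constant entry,
  and the one in column \<open>u\<close> is zero. Three vertices \<open>u\<close>, \<open>v\<close>,
  \<open>c\<close> are then barred from the diagonal, which leaves degree at most
  \<open>card V - 3\<close>.\<close>

lemma coeff_pm_linear_adj_off_diagonal: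
  assumes V: "finite V" "u \<in> V" "v \<in> V" "u \<noteq> v" and E: "(v, u) \<notin> E" and n: "card V \<le> n + 2"
  shows "coeff (pm (linear_adj E) (V - {u}) (V - {v})) n = 0"
proof -
  have "pm (linear_adj E) (V - {u}) (V - {v}) =
      (\<Sum>c\<in>V - {v}. linear_adj E v c * pm (linear_adj E) (V - {u} - {v}) (V - {v} - {c}))"
    using V by (intro pm_expand_row) auto
  moreover have "coeff (linear_adj E v c * pm (linear_adj E) (V - {u} - {v}) (V - {v} - {c})) n = 0" if c: "c \<in> V - {v}" for c
  proof (cases "c = u")
    case True
    then show ?thesis using E V by (simp add: weighted_adj_def)
  next
    case False
    have "(V - {u} - {v}) \<inter> (V - {v} - {c}) = V - {u, v, c}" by auto
    moreover have "card (V - {u, v, c}) = card V - card {u, v, c}" using V c by (intro card_Diff_subset) auto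
    moreover have "card {u, v, c} = 3" using V c False by auto
    moreover have "card V \<ge> card {u, v, c}" using V c by (intro card_mono) auto
    ultimately have "card ((V - {u} - {v}) \<inter> (V - {v} - {c})) < n" using n by simp
    moreover have "degree (linear_adj E v c) = 0" using c by (auto simp: weighted_adj_def)
    ultimately have "degree (linear_adj E v c * pm (linear_adj E) (V - {u} - {v}) (V - {v} - {c})) < n"
      using degree_pm_linear_adj[of "V - {u} - {v}" "V - {v} - {c}" E] V
        degree_mult_le[of "linear_adj E v c" "pm (linear_adj E) (V - {u} - {v}) (V - {v} - {c})"] by simp
    then show ?thesis by (rule coeff_eq_0)
  qed
  ultimately show ?thesis by (simp add: coeff_sum)
qed

lemma coeff_pm_linear_adj_add_edge:
  assumes V: "finite V" "u \<in> V" "v \<in> V" "u \<noteq> v" and E: "(u, v) \<notin> E" "(v, u) \<notin> E" and n: "card V \<le> n + 2"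
  shows "coeff (pm (linear_adj (insert (u, v) (insert (v, u) E))) V V) n =
    coeff (pm (linear_adj E) V V) n + coeff (pm (linear_adj E) (V - {u} - {v}) (V - {u} - {v})) n"
  using V E coeff_pm_linear_adj_off_diagonal[OF V E(2) n] coeff_pm_linear_adj_off_diagonal[OF V(1,3,2) V(4)[symmetric] E(1) n]
  by (simp add: pm_weighted_adj_add_edge)

lemma pm_linear_adj_empty: "finite V \<Longrightarrow> pm (linear_adj {}) V V = (\<Prod>v\<in>V. [:e v, 1:])"
proof (induction V rule: finite_induct)
  case (insert v V)
  then show ?case using pm_isolated(1)[of V V v "{}" "{}" "\<lambda>v. [:e v, 1:]"] by simp
qed simp

lemma coeff_prod_linear:
  assumes "finite V"
  shows "coeff (\<Prod>v\<in>V. [:e v, 1:]) (card V) = 1"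
    "card V = Suc n \<Longrightarrow> coeff (\<Prod>v\<in>V. [:e v, 1:]) n = sum e V"
    "card V = Suc (Suc n) \<Longrightarrow> 2 * coeff (\<Prod>v\<in>V. [:e v, 1:]) n = (sum e V)\<^sup>2 - (\<Sum>v\<in>V. (e v)\<^sup>2)"
  using assms
proof (induction V arbitrary: n rule: finite_induct)
  case (insert v V)
  let ?P = "\<Prod>v\<in>V. [:e v, 1:]"
  have P: "(\<Prod>v\<in>insert v V. [:e v, 1:]) = smult (e v) ?P + pCons 0 ?P" using insert by simp
  have "degree ?P \<le> card V"
    using degree_pm_linear_adj[of V V "{}"] insert by (simp add: pm_linear_adj_empty)
  then have big: "coeff ?P (Suc (card V)) = 0" by (intro coeff_eq_0) simp
  {
    case 1
    then show ?case using insert big by (simp add: P)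
  next
    case 2
    then show ?case using insert by (cases n) (auto simp: P)
  next
    case 3
    then show ?case using insert by (cases n) (auto simp: P power2_eq_square algebra_simps card_1_singleton_iff)
  }
qed simp_all

text \<open>Among the top three coefficients an edge is seen only through the transposition of its
  ends, which costs two diagonal factors. Each edge is two arcs, which matches the doubling of the
  third coefficient.\<close>

lemma coeff_pm_linear_adj:
  assumes "finite E" "sym E" "irrefl E"
  shows "finite V \<Longrightarrow> coeff (pm (linear_adj E) V V) (card V) = 1"
    "finite V \<Longrightarrow> card V = Suc n \<Longrightarrow> coeff (pm (linear_adj E) V V) n = sum e V"
    "finite V \<Longrightarrow> card V = Suc (Suc n) \<Longrightarrow> E \<subseteq> V \<times> V \<Longrightarrow>
      2 * coeff (pm (linear_adj E) V V) n = (sum e V)\<^sup>2 - (\<Sum>v\<in>V. (e v)\<^sup>2) + int (card E)"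
  using assms
proof (induction E arbitrary: V n rule: sym_irrefl_induct)
  case empty
  {
    case 1
    then show ?case using coeff_prod_linear(1) by (simp add: pm_linear_adj_empty)
  next
    case 2
    then show ?case using coeff_prod_linear(2) by (simp add: pm_linear_adj_empty)
  next
    case 3
    then show ?case using coeff_prod_linear(3) by (simp add: pm_linear_adj_empty)
  }
next
  case (edge E u v)
  have zero: "coeff (pm (linear_adj E) (V - {u} - {v}) (V - {u} - {v})) n = 0"
    if "u \<in> V" "v \<in> V" "finite V" "card V \<le> Suc n" for V n
  proof -
    have "card (V - {u} - {v}) < card V" using that by (intro psubset_card_mono) auto
    moreover have "card (V - {u} - {v}) = card V - 2" using that edge(4) by simp
    moreover have "card {u, v} \<le> card V" using that by (intro card_mono) auto
    ultimately have "card (V - {u} - {v}) < n" using that edge(4) by simp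
    then show ?thesis
      using degree_pm_linear_adj[of "V - {u} - {v}" "V - {u} - {v}" E] that by (intro coeff_eq_0) simp
  qed
  have same: "pm (linear_adj (insert (u, v) (insert (v, u) E))) V V = pm (linear_adj E) V V"
    if "finite V" "u \<notin> V \<or> v \<notin> V" for V
    using that edge(4-6) by (auto simp: pm_weighted_adj_add_edge)
  {
    case 1
    then show ?case
      using edge same zero[of V "card V"] coeff_pm_linear_adj_add_edge[of V u v E "card V"]
      by (cases "u \<in> V \<and> v \<in> V") auto
  next
    case 2
    then show ?case
      using edge same zero[of V n] coeff_pm_linear_adj_add_edge[of V u v E n]
      by (cases "u \<in> V \<and> v \<in> V") auto
  next
    case 3
    then have uv: "u \<in> V" "v \<in> V" "E \<subseteq> V \<times> V" by auto
    have "card (V - {u} - {v}) = n" using 3 uv edge(4) by simp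
    then have "coeff (pm (linear_adj E) (V - {u} - {v}) (V - {u} - {v})) n = 1"
      using edge.IH(1)[of "V - {u} - {v}"] 3 by simp
    moreover have "card (insert (u, v) (insert (v, u) E)) = card E + 2"
      using edge by simp
    ultimately show ?case
      using edge.IH(3)[of V n] 3 uv coeff_pm_linear_adj_add_edge[of V u v E n] edge by simp
  }
qed

end

section \<open>Dumbbells up to isomorphism\<close>

lemma deg_add_edge:
  assumes "edges_on W E" "u \<in> W" "x \<in> W" "u \<noteq> x" "(u, x) \<notin> E" "(x, u) \<notin> E"
  shows "edges_on W (insert (u, x) (insert (x, u) E))"
    "deg (insert (u, x) (insert (x, u) E)) w = deg E w + (if w = u then 1 else 0) + (if w = x then 1 else 0)"
proof -
  show *: "edges_on W (insert (u, x) (insert (x, u) E))"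
    using assms by (auto simp: edges_on_def sym_def irrefl_def)
  have "insert (u, x) (insert (x, u) E) - {(u, x), (x, u)} = E" using assms by auto
  with remove_edge(4)[OF *, of u x w]
  show "deg (insert (u, x) (insert (x, u) E)) w = deg E w + (if w = u then 1 else 0) + (if w = x then 1 else 0)"
    by simp
qed

lemma edges_on_mono: "edges_on W E \<Longrightarrow> W \<subseteq> W' \<Longrightarrow> finite W' \<Longrightarrow> edges_on W' E"
  by (auto simp: edges_on_def)

lemma deg_add_path:
  assumes "edges_on W E" "u \<in> W" "v \<in> W" "distinct xs" "set xs \<inter> W = {}"
    "xs = [] \<longrightarrow> u \<noteq> v \<and> (u, v) \<notin> E \<and> (v, u) \<notin> E" "u = v \<longrightarrow> length xs \<noteq> 1"
  shows "edges_on (set xs \<union> W) (E \<union> walk_edges (u # xs @ [v])) \<and>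
    (\<forall>w. deg (E \<union> walk_edges (u # xs @ [v])) w =
      deg E w + (if w \<in> set xs then 2 else 0) + (if w = u then 1 else 0) + (if w = v then 1 else 0))"
  using assms
proof (induction xs arbitrary: u E W)
  case Nil
  then show ?case using deg_add_edge[of W E u v] by auto
next
  case (Cons x xs)
  let ?E = "insert (u, x) (insert (x, u) E)"
  have fin: "finite W" and sub: "E \<subseteq> W \<times> W" using Cons.prems by (auto simp: edges_on_def)
  have x: "x \<notin> W" "x \<noteq> u" "x \<noteq> v" "(u, x) \<notin> E" "(x, u) \<notin> E" using Cons.prems sub by auto
  have EW: "edges_on (insert x W) E" by (rule edges_on_mono[OF Cons.prems(1)]) (use fin in auto)
  have E: "edges_on (insert x W) ?E" "\<And>w. deg ?E w = deg E w + (if w = u then 1 else 0) + (if w = x then 1 else 0)"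
    using deg_add_edge[OF EW, of u x] x Cons.prems by auto
  have "edges_on (set xs \<union> insert x W) (?E \<union> walk_edges (x # xs @ [v])) \<and>
    (\<forall>w. deg (?E \<union> walk_edges (x # xs @ [v])) w =
      deg ?E w + (if w \<in> set xs then 2 else 0) + (if w = x then 1 else 0) + (if w = v then 1 else 0))"
    by (rule Cons.IH[OF E(1)]) (use Cons.prems x sub in auto)
  moreover have "E \<union> walk_edges (u # (x # xs) @ [v]) = ?E \<union> walk_edges (x # xs @ [v])" by auto
  moreover have "set (x # xs) \<union> W = set xs \<union> insert x W" by auto
  ultimately show ?case using x Cons.prems(4) E(2) by (auto simp del: walk_edges.simps)
qed

lemma dumbbell_degrees:
  assumes "dumbbell_with_cycles V E a b A R B {} {}"
  shows "edges_on V E" "deg E w = (if w = a \<or> w = b then 3 else if w \<in> V then 2 else 0)"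
proof -
  have dist: "distinct A" "distinct R" "distinct B" "a \<noteq> b"
    and disj: "set A \<inter> ({a, b} \<union> set R) = {}" "set R \<inter> {a, b} = {}" "set B \<inter> ({a, b} \<union> set R \<union> set A) = {}"
    and V: "V = set B \<union> (set A \<union> (set R \<union> {a, b}))"
    and E: "E = {} \<union> walk_edges (a # R @ [b]) \<union> walk_edges (a # A @ [a]) \<union> walk_edges (b # B @ [b])"
    and len: "length A \<ge> 2" "length B \<ge> 2"
    using assms by (auto simp: dumbbell_with_cycles_def)
  have ne: "A \<noteq> []" "B \<noteq> []" "length A \<noteq> 1" "length B \<noteq> 1" using len by auto
  have 0: "edges_on {a, b} {}" by (simp add: edges_on_def sym_def irrefl_def)
  have 1: "edges_on (set R \<union> {a, b}) ({} \<union> walk_edges (a # R @ [b]))"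
    "deg ({} \<union> walk_edges (a # R @ [b])) w = deg {} w + (if w \<in> set R then 2 else 0) + (if w = a then 1 else 0) + (if w = b then 1 else 0)"
    using deg_add_path[OF 0, of a b R] dist disj by auto
  have 2: "edges_on (set A \<union> (set R \<union> {a, b})) ({} \<union> walk_edges (a # R @ [b]) \<union> walk_edges (a # A @ [a]))"
    "deg ({} \<union> walk_edges (a # R @ [b]) \<union> walk_edges (a # A @ [a])) w = deg ({} \<union> walk_edges (a # R @ [b])) w
      + (if w \<in> set A then 2 else 0) + (if w = a then 1 else 0) + (if w = a then 1 else 0)"
    using deg_add_path[OF 1(1), of a a A] dist disj ne by blast+
  have 3: "edges_on (set B \<union> (set A \<union> (set R \<union> {a, b}))) E"
    "deg E w = deg ({} \<union> walk_edges (a # R @ [b]) \<union> walk_edges (a # A @ [a])) w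
      + (if w \<in> set B then 2 else 0) + (if w = b then 1 else 0) + (if w = b then 1 else 0)"
    unfolding E using deg_add_path[OF 2(1), of b b B] dist disj ne by blast+
  show "edges_on V E" using 3(1) V by simp
  have "deg {} w = 0" by (simp add: nbrs_def)
  then show "deg E w = (if w = a \<or> w = b then 3 else if w \<in> V then 2 else 0)"
    using 3(2) 2(2) 1(2) dist disj V by auto
qed

section \<open>Walks as lists, and isomorphisms of dumbbells\<close>

lemma walk_edges_snoc: "xs \<noteq> [] \<Longrightarrow> walk_edges (xs @ [y]) = walk_edges xs \<union> {(last xs, y), (y, last xs)}"
  by (induction xs rule: walk_edges.induct) auto

lemma walk_edges_Cons: "xs \<noteq> [] \<Longrightarrow> walk_edges (x # xs) = walk_edges xs \<union> {(x, hd xs), (hd xs, x)}"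
  by (cases xs) auto

lemma walk_edges_rev: "walk_edges (rev xs) = walk_edges xs"
proof (induction xs)
  case (Cons x xs)
  then show ?case by (cases "xs = []") (auto simp: walk_edges_snoc walk_edges_Cons last_rev)
qed simp

lemma walk_edges_map: "walk_edges (map f xs) = map_prod f f ` walk_edges xs"
  by (induction xs rule: walk_edges.induct) auto

lemma walk_edges_upt: "walk_edges [a..<a + n] = parcs (path_graph a n)"
proof (induction n)
  case (Suc n)
  show ?case
  proof (cases n)
    case (Suc k)
    have "walk_edges [a..<a + Suc n] = walk_edges [a..<a + n] \<union> {(a + k, a + n), (a + n, a + k)}"
    proof -
      have l: "[a..<a + Suc n] = [a..<a + n] @ [a + n]" "last [a..<a + n] = a + k" and ne: "[a..<a + n] \<noteq> []"
        using Suc by simp_all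
      show ?thesis using walk_edges_snoc[OF ne, of "a + n"] unfolding l .
    qed
    also have "\<dots> = parcs (path_graph a (Suc n))"
      unfolding Suc.IH using Suc by (auto simp: path_graph_def)
    finally show ?thesis .
  qed (auto simp: path_graph_def)
qed (auto simp: path_graph_def)

lemma dumbbell_with_cycles_dumbbell:
  assumes "p \<ge> 3" "q \<ge> 3" "r \<ge> 2"
  shows "dumbbell_with_cycles (pverts (dumbbell p q r)) (parcs (dumbbell p q r)) (p - 1) (p + r - 2)
    [0..<p - 1] [p..<p + r - 2] [p + r - 1..<p + r - 2 + q] {} {}"
proof -
  define a b where "a = p - 1" and "b = p + r - 2"
  have p: "[0..<p - 1] @ [a] = [0..<0 + p]" using assms by (simp add: a_def flip: upt_Suc_append)
  have r: "a # [p..<b] @ [b] = [a..<a + r]"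
  proof -
    have "[a..<a + r] = a # [Suc a..<a + r]" using assms by (simp add: upt_conv_Cons)
    moreover have "Suc a = p" "a + r = Suc b" using assms by (auto simp: a_def b_def)
    ultimately show ?thesis using assms by (simp add: b_def)
  qed
  have q: "b # [Suc b..<b + q] = [b..<b + q]" using assms by (simp add: upt_conv_Cons)
  have "walk_edges (a # [0..<p - 1] @ [a]) = parcs (cycle_graph 0 p)"
    unfolding p using assms by (subst walk_edges_Cons) (auto simp: walk_edges_upt[of 0 p, simplified] cycle_graph_def a_def)
  moreover have "walk_edges (a # [p..<b] @ [b]) = parcs (path_graph a r)"
    unfolding r by (rule walk_edges_upt)
  moreover have "walk_edges (b # [Suc b..<b + q] @ [b]) = parcs (cycle_graph b q)"
  proof -
    have "walk_edges ((b # [Suc b..<b + q]) @ [b]) = walk_edges [b..<b + q] \<union> {(last [b..<b + q], b), (b, last [b..<b + q])}"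
      unfolding q using assms by (intro walk_edges_snoc) simp
    moreover have "last [b..<b + q] = b + q - 1" using assms by simp
    ultimately show ?thesis by (auto simp: walk_edges_upt cycle_graph_def)
  qed
  moreover have "Suc b = p + r - 1" using assms by (simp add: b_def)
  ultimately have E: "parcs (dumbbell p q r) = {} \<union> walk_edges (a # [p..<b] @ [b]) \<union> walk_edges (a # [0..<p - 1] @ [a])
      \<union> walk_edges (b # [p + r - 1..<b + q] @ [b])"
    by (auto simp: dumbbell_def Let_def a_def b_def)
  have V: "pverts (dumbbell p q r) = set ([0..<p - 1] @ [a] @ [p..<b] @ [b] @ [p + r - 1..<b + q])"
    using assms by (auto simp: dumbbell_def Let_def cycle_graph_def path_graph_def a_def b_def)
  show ?thesis
    unfolding dumbbell_with_cycles_def a_def[symmetric] b_def[symmetric] using E V assms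
    by (auto simp: a_def b_def edges_on_def sym_def irrefl_def)
qed

lemma digraph_iso_map:
  assumes G: "pair_graph G" and inj: "inj_on f (pverts G)"
    and V: "pverts H = f ` pverts G" and E: "parcs H = map_prod f f ` parcs G"
  shows "digraph_iso (with_proj G) (with_proj H)"
proof -
  interpret pair_graph G by fact
  define h where "h = \<lparr>iso_verts = f, iso_arcs = map_prod f f, iso_head = snd, iso_tail = fst\<rparr>"
  have "inj_on (map_prod f f) (pverts G \<times> pverts G)" using inj by (intro map_prod_inj_on)
  moreover have "parcs G \<subseteq> pverts G \<times> pverts G" using in_arcsD1 in_arcsD2 by auto
  ultimately have "inj_on (map_prod f f) (parcs G)" by (rule inj_on_subset)
  then have "pre_digraph.digraph_isomorphism (with_proj G) h"
    using inj wf_digraph_axioms by (auto simp: pre_digraph.digraph_isomorphism_def h_def)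
  moreover have "with_proj H = app_iso h (with_proj G)"
    by (simp add: app_iso_def h_def with_proj_def V E)
  ultimately show ?thesis unfolding digraph_iso_def by blast
qed

text \<open>Concatenated vertex lists of equal shape are matched position by position; as all edges
  come from walks, \<open>walk_edges_map\<close> carries them along.\<close>

lemma digraph_iso_dumbbells:
  assumes G: "pair_graph G"
    and DG: "dumbbell_with_cycles (pverts G) (parcs G) a b A R B {} {}"
    and DH: "dumbbell_with_cycles (pverts H) (parcs H) a' b' A' R' B' {} {}"
    and len: "length A = length A'" "length R = length R'" "length B = length B'"
  shows "digraph_iso (with_proj G) (with_proj H)"
proof -
  let ?L = "A @ [a] @ R @ [b] @ B" and ?L' = "A' @ [a'] @ R' @ [b'] @ B'"
  have dist: "distinct ?L" "distinct ?L'" and V: "pverts G = set ?L" "pverts H = set ?L'"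
    and E: "parcs G = {} \<union> walk_edges (a # R @ [b]) \<union> walk_edges (a # A @ [a]) \<union> walk_edges (b # B @ [b])"
      "parcs H = {} \<union> walk_edges (a' # R' @ [b']) \<union> walk_edges (a' # A' @ [a']) \<union> walk_edges (b' # B' @ [b'])"
    using DG DH unfolding dumbbell_with_cycles_def by blast+
  have lenL: "length ?L = length ?L'" using len by simp
  define f where "f = (\<lambda>v. the (map_of (zip ?L ?L') v))"
  have nth: "f (?L ! i) = ?L' ! i" if "i < length ?L" for i
    unfolding f_def using map_of_zip_nth[OF lenL dist(1)] that lenL by simp
  have map: "map f ?L = ?L'"
  proof (rule nth_equalityI)
    show "length (map f ?L) = length ?L'" using lenL by simp
    show "map f ?L ! i = ?L' ! i" if "i < length (map f ?L)" for i
      using that nth by (simp only: length_map nth_map)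
  qed
  then have maps: "map f A = A'" "f a = a'" "map f R = R'" "f b = b'" "map f B = B'"
    using len by auto
  show ?thesis
  proof (rule digraph_iso_map[OF G])
    show "inj_on f (pverts G)" unfolding V(1) using dist(2) map by (metis distinct_map)
    show "pverts H = f ` pverts G" unfolding V map[symmetric] by (rule set_map)
    show "parcs H = map_prod f f ` parcs G"
      unfolding E maps[symmetric] image_Un walk_edges_map[symmetric] by simp
  qed
qed

lemma dumbbell_with_cycles_swap:
  assumes "dumbbell_with_cycles V E a b A R B W E0"
  shows "dumbbell_with_cycles V E b a B (rev R) A W E0"
proof -
  have "walk_edges (b # rev R @ [a]) = walk_edges (a # R @ [b])"
    using walk_edges_rev[of "a # R @ [b]"] by simp
  with assms show ?thesis unfolding dumbbell_with_cycles_def by auto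
qed

lemma thetapoly_sym: "thetapoly z i j k = thetapoly z j i k" "thetapoly z i j k = thetapoly z i k j"
  unfolding thetapoly_def Let_def by (simp_all only: ac_simps)

text \<open>That at most one parameter is 0 becomes \<open>1 \<le> j'\<close> after sorting.\<close>

lemma thetapoly_sorted:
  fixes i j k :: nat
  assumes "i \<noteq> 0 \<or> j \<noteq> 0" "j \<noteq> 0 \<or> k \<noteq> 0" "i \<noteq> 0 \<or> k \<noteq> 0"
  obtains i' j' k' where "i' \<le> j'" "j' \<le> k'" "1 \<le> j'" "i' + j' + k' = i + j + k" "thetapoly z i' j' k' = thetapoly z i j k"
proof -
  consider "i \<le> j \<and> j \<le> k" | "i \<le> k \<and> k \<le> j" | "j \<le> i \<and> i \<le> k" | "j \<le> k \<and> k \<le> i" | "k \<le> i \<and> i \<le> j" | "k \<le> j \<and> j \<le> i"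
    by linarith
  then show ?thesis
  proof cases
    case 1
    then show ?thesis using that[of i j k] assms by auto
  next
    case 2
    then show ?thesis using that[of i k j] assms thetapoly_sym(2)[of z i j k] by auto
  next
    case 3
    then show ?thesis using that[of j i k] assms thetapoly_sym(1)[of z i j k] by auto
  next
    case 4
    then show ?thesis using that[of j k i] assms thetapoly_sym(1)[of z i j k] thetapoly_sym(2)[of z j i k] by auto
  next
    case 5
    then show ?thesis using that[of k i j] assms thetapoly_sym(2)[of z i j k] thetapoly_sym(1)[of z i k j] by auto
  next
    case 6
    then show ?thesis
      using that[of k j i] assms thetapoly_sym(1)[of z i j k] thetapoly_sym(2)[of z j i k] thetapoly_sym(1)[of z j k i] by auto
  qed
qed

text \<open>For integers x^2 - x \<ge> 0, with equality only at 0 and 1. The two sums agree, so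
  every value is 0 or 1, and the total 2 counts the ones.\<close>

lemma sum_excess_two:
  fixes e :: "'a \<Rightarrow> int"
  assumes "finite V" "sum e V = 2" "(\<Sum>v\<in>V. (e v)\<^sup>2) = 2"
  obtains a b where "a \<in> V" "b \<in> V" "a \<noteq> b" "e a = 1" "e b = 1" "\<And>v. v \<in> V - {a, b} \<Longrightarrow> e v = 0"
proof -
  have nonneg: "x\<^sup>2 - x \<ge> 0" for x :: int
  proof -
    have "x * (x - 1) \<ge> 0" by (cases "x \<ge> 1") (auto intro!: mult_nonneg_nonneg mult_nonpos_nonpos)
    then show ?thesis by (simp add: power2_eq_square algebra_simps)
  qed
  have "(\<Sum>v\<in>V. (e v)\<^sup>2 - e v) = 0" using assms by (simp add: sum_subtractf)
  then have "\<forall>v\<in>V. (e v)\<^sup>2 - e v = 0" using assms(1) nonneg by (subst (asm) sum_nonneg_eq_0_iff) auto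
  then have e01: "e v = 0 \<or> e v = 1" if "v \<in> V" for v
    using that by (auto simp: power2_eq_square)
  have "sum e V = (\<Sum>v\<in>{v\<in>V. e v = 1}. 1)"
    using assms(1) e01 by (intro sum.mono_neutral_cong_right) auto
  then have "card {v\<in>V. e v = 1} = 2" using assms(2) by simp
  then obtain a b where ab: "{v\<in>V. e v = 1} = {a, b}" "a \<noteq> b" by (auto simp: card_2_iff)
  show thesis
  proof (rule that[of a b])
    show "e v = 0" if "v \<in> V - {a, b}" for v using e01[of v] that ab(1) by auto
  qed (use ab in auto)
qed

section \<open>Invariants read off the polynomial\<close>

definition excess :: "('a \<times> 'a) set \<Rightarrow> 'a \<Rightarrow> int" where
  "excess E v = int (deg E v) - 2"

lemma card_edges:
  assumes "edges_on V E"
  shows "int (card E) = (\<Sum>v\<in>V. excess E v) + 2 * int (card V)"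
proof -
  have "E = (SIGMA v:V. nbrs E v)" using assms by (auto simp: edges_on_def nbrs_def)
  moreover have "finite (nbrs E v)" for v
    using assms by (intro finite_subset[of "nbrs E v" V]) (auto simp: edges_on_def nbrs_def)
  ultimately have "card E = (\<Sum>v\<in>V. deg E v)"
    using assms card_SigmaI[of V "nbrs E"] by (simp add: edges_on_def)
  then show ?thesis by (simp add: excess_def sum_subtractf)
qed

lemma degree_pm_linear_adj_eq:
  assumes "edges_on V E"
  shows "degree (pm (linear_adj e E) V V) = card V"
proof (rule antisym)
  show "degree (pm (linear_adj e E) V V) \<le> card V"
    using degree_pm_linear_adj[of V V e E] assms by (simp add: edges_on_def)
  have "finite E" using assms finite_subset[of E "V \<times> V"] by (auto simp: edges_on_def)
  then have "coeff (pm (linear_adj e E) V V) (card V) = 1"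
    using coeff_pm_linear_adj(1)[of E V e] assms by (simp add: edges_on_def)
  then show "card V \<le> degree (pm (linear_adj e E) V V)" by (intro le_degree) simp
qed

lemma coeffs_pm_linear_adj_excess:
  assumes "edges_on V E" "card V = Suc (Suc n)"
  shows "coeff (pm (linear_adj (excess E) E) V V) (Suc n) = sum (excess E) V"
    "2 * coeff (pm (linear_adj (excess E) E) V V) n =
      (sum (excess E) V)\<^sup>2 - (\<Sum>v\<in>V. (excess E v)\<^sup>2) + sum (excess E) V + 2 * int (card V)"
proof -
  have E: "finite E" "sym E" "irrefl E" "finite V" "E \<subseteq> V \<times> V"
    using assms(1) finite_subset[of E "V \<times> V"] by (auto simp: edges_on_def)
  show "coeff (pm (linear_adj (excess E) E) V V) (Suc n) = sum (excess E) V"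
    using coeff_pm_linear_adj(2)[OF E(1-4)] assms(2) by simp
  show "2 * coeff (pm (linear_adj (excess E) E) V V) n =
      (sum (excess E) V)\<^sup>2 - (\<Sum>v\<in>V. (excess E v)\<^sup>2) + sum (excess E) V + 2 * int (card V)"
    using coeff_pm_linear_adj(3)[OF E(1-4) assms(2) E(5), of "excess E"] card_edges[OF assms(1)] by simp
qed

lemma eval_eq_pm_linear_adj:
  assumes "pair_graph G"
  shows "int_poly_eval [:2, -1:] (signless_laplacian_permanental_poly G) =
    (-1) ^ card (pverts G) * pm (linear_adj (excess (parcs G)) (parcs G)) (pverts G) (pverts G)"
proof -
  have e1: "(2 :: int poly) - [:0, 1:] = [:2, -1:]" by (simp add: numeral_poly)
  have e2: "(\<lambda>v. [:0, 1 :: int:] + of_int (int (deg (parcs G) v) - 2)) = (\<lambda>v. [:excess (parcs G) v, 1:])"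
    by (simp add: fun_eq_iff of_int_poly excess_def)
  show ?thesis
    using signless_laplacian_permanental_poly_eval[OF assms, of "[:0, 1 :: int:]"] unfolding e1 e2 .
qed

text \<open>The degree of the polynomial is the number of vertices; once this agrees, the signs
  cancel and the next two coefficients give the sums over the excesses. The last claim is applied to
  Laurent series.\<close>

lemma permanental_poly_invariants:
  assumes G: "pair_graph G" and H: "pair_graph H"
    and eq: "signless_laplacian_permanental_poly G = signless_laplacian_permanental_poly H"
    and card: "card (pverts H) \<ge> 2"
  shows "card (pverts G) = card (pverts H)"
    "sum (excess (parcs G)) (pverts G) = sum (excess (parcs H)) (pverts H)"
    "(\<Sum>v\<in>pverts G. (excess (parcs G) v)\<^sup>2) = (\<Sum>v\<in>pverts H. (excess (parcs H) v)\<^sup>2)"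
    "pm (weighted_adj (\<lambda>v. z + of_int (excess (parcs G) v)) (parcs G)) (pverts G) (pverts G) =
     pm (weighted_adj (\<lambda>v. z + of_int (excess (parcs H) v)) (parcs H)) (pverts H) (pverts H)"
proof -
  let ?FG = "pm (linear_adj (excess (parcs G)) (parcs G)) (pverts G) (pverts G)"
  let ?FH = "pm (linear_adj (excess (parcs H)) (parcs H)) (pverts H) (pverts H)"
  have EG: "edges_on (pverts G) (parcs G)" and EH: "edges_on (pverts H) (parcs H)"
    using G H by (auto intro: edges_on_pair_graph)
  have F: "(-1) ^ card (pverts G) * ?FG = (-1) ^ card (pverts H) * ?FH"
    using eval_eq_pm_linear_adj[OF G] eval_eq_pm_linear_adj[OF H] eq by simp
  have deg: "degree ((-1) ^ n * p) = degree p" for n and p :: "int poly"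
    by (cases "even n") simp_all
  have "degree ((-1) ^ card (pverts G) * ?FG) = card (pverts G)" "degree ((-1) ^ card (pverts H) * ?FH) = card (pverts H)"
    unfolding deg using EG EH by (simp_all add: degree_pm_linear_adj_eq)
  then show n: "card (pverts G) = card (pverts H)" using F by simp
  have sign: "(-1) ^ k * x = (-1) ^ k * y \<Longrightarrow> x = y" for k and x y :: "'x::comm_ring_1"
    by (cases "even k") simp_all
  have F: "?FG = ?FH" using F unfolding n by (rule sign)
  obtain m where m: "card (pverts H) = Suc (Suc m)" using card by (metis add_2_eq_Suc le_Suc_ex)
  note CG = coeffs_pm_linear_adj_excess[OF EG, unfolded n, OF m] and CH = coeffs_pm_linear_adj_excess[OF EH m]
  show s: "sum (excess (parcs G)) (pverts G) = sum (excess (parcs H)) (pverts H)"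
    using CG(1) CH(1) F by simp
  show "(\<Sum>v\<in>pverts G. (excess (parcs G) v)\<^sup>2) = (\<Sum>v\<in>pverts H. (excess (parcs H) v)\<^sup>2)"
    using CG(2) CH(2) F s by simp
  have "int_poly_eval (2 - z) (signless_laplacian_permanental_poly G) = int_poly_eval (2 - z) (signless_laplacian_permanental_poly H)"
    using eq by simp
  then show "pm (weighted_adj (\<lambda>v. z + of_int (excess (parcs G) v)) (parcs G)) (pverts G) (pverts G) =
     pm (weighted_adj (\<lambda>v. z + of_int (excess (parcs H) v)) (parcs H)) (pverts H) (pverts H)"
    unfolding signless_laplacian_permanental_poly_eval[OF G] signless_laplacian_permanental_poly_eval[OF H] n excess_def
    by (cases "even (card (pverts H))") simp_all
qed

theorem theorem1p3:
  fixes p q r :: nat and H :: "'v pair_pre_digraph"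
  assumes "p \<ge> 3" and "q \<ge> 3" and "r \<ge> 2"
    and "pair_graph H"
    and "signless_laplacian_permanental_poly H = signless_laplacian_permanental_poly (dumbbell p q r)"
  shows "digraph_iso (with_proj H) (with_proj (dumbbell p q r))"
proof -
  let ?D = "dumbbell p q r"
  define VH EH VD ED where "VH = pverts H" and "EH = parcs H" and "VD = pverts ?D" and "ED = parcs ?D"
  define z :: "int fls" where "z = fls_X_inv - fls_X"
  have D: "pair_graph ?D" by (rule pair_graph_dumbbell[OF assms(1-3)])
  note DD = dumbbell_with_cycles_dumbbell[OF assms(1-3)]
  define a0 b0 where "a0 = p - 1" and "b0 = p + r - 2"
  have DD': "dumbbell_with_cycles VD ED a0 b0 [0..<p - 1] [p..<p + r - 2] [p + r - 1..<p + r - 2 + q] {} {}"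
    using DD unfolding VD_def ED_def a0_def b0_def .
  have ab0: "a0 \<noteq> b0" "a0 \<in> VD" "b0 \<in> VD" "finite VD"
    using DD' unfolding dumbbell_with_cycles_def by auto
  have cardD: "card VD = p + q + r - 2"
  proof -
    have "VD = {0..<p + q + r - 2}"
      using assms(1-3) by (auto simp: VD_def dumbbell_def Let_def cycle_graph_def path_graph_def)
    then show ?thesis by simp
  qed
  have excD: "excess ED v = (if v = a0 \<or> v = b0 then 1 else if v \<in> VD then 0 else -2)" for v
    using dumbbell_degrees(2)[OF DD', of v] by (simp add: excess_def)
  have sumD: "sum (excess ED) VD = 2" "(\<Sum>v\<in>VD. (excess ED v)\<^sup>2) = 2"
  proof -
    have two: "sum f VD = f a0 + f b0 + sum f (VD - {a0, b0})" for f :: "nat \<Rightarrow> int"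
      using ab0 by (simp add: sum.remove[of VD a0] sum.remove[of "VD - {a0}" b0] Diff_insert2[symmetric] insert_commute)
    have "excess ED v = 0" if "v \<in> VD - {a0, b0}" for v using that by (simp add: excD)
    then have "(\<Sum>v\<in>VD - {a0, b0}. excess ED v) = 0" "(\<Sum>v\<in>VD - {a0, b0}. (excess ED v)\<^sup>2) = 0" by simp_all
    then show "sum (excess ED) VD = 2" "(\<Sum>v\<in>VD. (excess ED v)\<^sup>2) = 2"
      unfolding two using ab0 by (simp_all add: excD)
  qed
  have card2: "card (pverts ?D) \<ge> 2" using cardD assms(1-3) by (simp add: VD_def)
  note inv = permanental_poly_invariants[OF assms(4) D assms(5) card2, folded VH_def EH_def VD_def ED_def]
  have EH: "edges_on VH EH" unfolding VH_def EH_def by (rule edges_on_pair_graph[OF assms(4)])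
  have finH: "finite VH" using EH by (simp add: edges_on_def)
  obtain a b where ab: "a \<in> VH" "b \<in> VH" "a \<noteq> b" "excess EH a = 1" "excess EH b = 1"
    and exc0: "\<And>v. v \<in> VH - {a, b} \<Longrightarrow> excess EH v = 0"
    by (rule sum_excess_two[OF finH inv(2,3)[unfolded sumD]]) blast
  have core: "two_core VH EH a b" and deg3: "deg EH a = 3" "deg EH b = 3"
    using EH ab exc0 by (auto simp: two_core_def excess_def)
  define d where "d = (\<lambda>v. z + of_int (excess EH v))"
  have d: "d a = z + 1" "d b = z + 1" "\<And>w. w \<in> VH - {a, b} \<Longrightarrow> d w = z"
    using ab exc0 by (simp_all add: d_def)
  have pmD: "pm (weighted_adj (\<lambda>v. z + of_int (excess ED v)) ED) VD VD = dumbbellpoly z p q r"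
  proof -
    have "length [p..<p + r - 2] + 2 = r" "length [p + r - 1..<p + r - 2 + q] + 1 = q" "length [0..<p - 1] + 1 = p"
      using assms(1-3) by auto
    moreover have "pm (weighted_adj (\<lambda>v. z + of_int (excess ED v)) ED) VD VD =
        dumbbellpoly z (length [0..<p - 1] + 1) (length [p + r - 1..<p + r - 2 + q] + 1) (length [p..<p + r - 2] + 2)
          * pm (weighted_adj (\<lambda>v. z + of_int (excess ED v)) {}) {} {}"
      by (rule pm_dumbbell_with_cycles[OF DD']) (simp_all add: excD)
    ultimately show ?thesis by (simp only: pm_empty mult_1_right)
  qed
  then have pmH: "pm (weighted_adj d EH) VH VH = dumbbellpoly z p q r"
    using inv(4)[of z] by (simp add: d_def)
  show ?thesis
  proof (cases rule: two_cubic_vertices_cases[OF core deg3])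
    case (1 A R B W E0)
    note H = 1
    have W: "edges_on W E0" "\<And>w. w \<in> W \<Longrightarrow> deg E0 w = 2" "W \<subseteq> VH - {a, b}" "finite W"
      using H by (auto simp: dumbbell_with_cycles_def edges_on_def)
    have dW: "\<And>w. w \<in> W \<Longrightarrow> d w = z" using d(3) W(3) by auto
    obtain ks where ks: "\<And>k. k \<in> set ks \<Longrightarrow> k \<ge> 3" "sum_list ks = card W"
      "pm (weighted_adj d E0) W W = prod_list (map (cyclepoly z) ks)"
      by (rule pm_regular[OF W(1,2) dW]) blast+
    have "card VH = card (set (A @ [a] @ R @ [b] @ B)) + card W"
      using H W(4) unfolding dumbbell_with_cycles_def by (metis card_Un_disjoint finite_set)
    also have "card (set (A @ [a] @ R @ [b] @ B)) = length (A @ [a] @ R @ [b] @ B)"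
      using H unfolding dumbbell_with_cycles_def by (metis distinct_card)
    finally have sum: "p + q + r = (length A + 1) + (length B + 1) + (length R + 2) + sum_list ks"
      using inv(1) cardD ks(2) assms(1-3) by simp
    have "dumbbellpoly z p q r = dumbbellpoly z (length A + 1) (length B + 1) (length R + 2) * prod_list (map (cyclepoly z) ks)"
      using pm_dumbbell_with_cycles[OF H d] pmH ks(3) by simp
    then have eq: "dumbbell_series X p q r =
        dumbbell_series X (length A + 1) (length B + 1) (length R + 2) * prod_list (map (cycle_series X) ks)"
      by (intro series_eq(1)[OF assms(3) ks(1)]) (use sum in \<open>auto simp: z_def\<close>)
    have len: "length A + 1 \<ge> 3" "length B + 1 \<ge> 3" "\<forall>k\<in>set ks. k \<ge> 3" "length R + 2 \<ge> 2"
      using H ks(1) by (auto simp: dumbbell_with_cycles_def)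
    note det = dumbbell_series_determined[OF eq assms(1,2) len(1-3) assms(3) len(4)]
    have "W = {}" using ks(2) det(1) W(4) by simp
    moreover from this have "E0 = {}" using W(1) by (auto simp: edges_on_def)
    ultimately have H0: "dumbbell_with_cycles (pverts H) (parcs H) a b A R B {} {}"
      using H by (simp add: VH_def EH_def)
    from det(2) show ?thesis
    proof
      assume pq: "p = length A + 1 \<and> q = length B + 1"
      \<comment> \<open>The path length is read off the number of vertices, not off the
        series.\<close>
      then have r: "r = length R + 2" using sum det(1) by simp
      show ?thesis
      proof (rule digraph_iso_dumbbells[OF assms(4) H0 DD])
        show "length A = length [0..<p - 1]" "length R = length [p..<p + r - 2]"
          "length B = length [p + r - 1..<p + r - 2 + q]"
          unfolding length_upt length_rev using pq r by linarith+
      qed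
    next
      assume pq: "p = length B + 1 \<and> q = length A + 1"
      then have r: "r = length R + 2" using sum det(1) by simp
      show ?thesis
      proof (rule digraph_iso_dumbbells[OF assms(4) dumbbell_with_cycles_swap[OF H0] DD])
        show "length B = length [0..<p - 1]" "length (rev R) = length [p..<p + r - 2]"
          "length A = length [p + r - 1..<p + r - 2 + q]"
          unfolding length_upt length_rev using pq r by linarith+
      qed
    qed
  next
    case (2 xs ys zs W E0)
    note H = 2
    have W: "edges_on W E0" "\<And>w. w \<in> W \<Longrightarrow> deg E0 w = 2" "W \<subseteq> VH - {a, b}" "finite W"
      using H by (auto simp: theta_with_cycles_def edges_on_def)
    have dW: "\<And>w. w \<in> W \<Longrightarrow> d w = z" using d(3) W(3) by auto
    obtain ks where ks: "\<And>k. k \<in> set ks \<Longrightarrow> k \<ge> 3" "sum_list ks = card W"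
      "pm (weighted_adj d E0) W W = prod_list (map (cyclepoly z) ks)"
      by (rule pm_regular[OF W(1,2) dW]) blast+
    have "card VH = card (set (a # b # xs @ ys @ zs)) + card W"
      using H W(4) unfolding theta_with_cycles_def by (metis card_Un_disjoint finite_set)
    also have "card (set (a # b # xs @ ys @ zs)) = length (a # b # xs @ ys @ zs)"
      using H unfolding theta_with_cycles_def by (metis distinct_card)
    finally have sum: "p + q + r = length xs + length ys + length zs + 4 + sum_list ks"
      using inv(1) cardD ks(2) assms(1-3) by simp
    have "dumbbellpoly z p q r = thetapoly z (length xs) (length ys) (length zs) * prod_list (map (cyclepoly z) ks)"
      using pm_theta_with_cycles[OF H d] pmH ks(3) by simp
    moreover obtain i j k where ijk: "i \<le> j" "j \<le> k" "1 \<le> j" "i + j + k = length xs + length ys + length zs"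
      "thetapoly z i j k = thetapoly z (length xs) (length ys) (length zs)"
      by (rule thetapoly_sorted[of "length xs" "length ys" "length zs" z])
        (use H in \<open>auto simp: theta_with_cycles_def\<close>)
    ultimately have eq: "dumbbell_series X p q r = theta_series X i j k * prod_list (map (cycle_series X) ks)"
      by (intro series_eq(2)[OF assms(3) ks(1)]) (use sum in \<open>auto simp: z_def\<close>)
    have False
      by (rule dumbbell_series_neq_theta[OF eq assms(1,2) _ assms(3) ijk(1-3)]) (use ks(1) sum ijk(4) in auto)
    then show ?thesis ..
  qed
qed

end
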